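(* For $n=1,\ldots,N$ consider the series $$\mathcal{T}_{(n)}(z)=\mathrm{tr}_{1,\ldots,n}\,A^h_{(n)}\,\mathcal{T}_1(z)\,\mathcal{T}_2(ze^{-h})\cdots\mathcal{T}_n(ze^{-(n-1)h})\in\widetilde{\mathrm{Y}}(\widehat{\mathcal{R}})[[z^{\pm1}]].$$ The coefficients of all $\mathcal{T}_{(n)}(z)$, $n=1,\ldots,N$, mutually commute.
   Context: Fix an integer $N\geq2$ and a formal parameter $h$; $e_{ij}$ are the matrix units of $\mathrm{End}\,\mathbb{C}^N$. The trigonometric $R$-matrix of type $A$ is $$\mathcal{R}(x,y)=(xe^{-h/2}-ye^{h/2})\sum_{i}e_{ii}\otimes e_{ii}+(x-y)\sum_{i\neq j}e_{ii}\otimes e_{jj}+(e^{-h/2}-e^{h/2})x\sum_{i>j}e_{ij}\otimes e_{ji}+(e^{-h/2}-e^{h/2})y\sum_{i<j}e_{ij}\otimes e_{ji},$$ sums over $i,j=1,\ldots,N$, and $\widehat{\mathcal{R}}(x)=e^{-h/2}\mathcal{R}(x,1)$. $\mathrm{Y}(\widehat{\mathcal{R}})$ is the associative algebra over $\mathbb{C}[[h]]$ generated by $\tau_{ij}^{(r)}$, $r\in\mathbb{Z}$, $i,j=1,\ldots,N$, subject to $$\widehat{\mathcal{R}}(x/y)\mathcal{T}_1(x)\mathcal{T}_2(y)=\mathcal{T}_2(y)\mathcal{T}_1(x)\widehat{\mathcal{R}}(x/y),$$ where $\mathcal{T}(x)=\sum_{i,j}e_{ij}\otimes\tau_{ij}(x)$,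 $\tau_{ij}(x)=\sum_{r\in\mathbb{Z}}\tau_{ij}^{(-r)}x^r$, and $\mathcal{T}_k(x)$ is the copy whose matrix part acts on the $k$-th tensor factor. For $p\ge0$ let $I_p$ be the two-sided ideal generated by $h^{p+1}$ and all $\tau_{ij}^{(-r)}$ with $r>p$; the completed algebra is $\widetilde{\mathrm{Y}}(\widehat{\mathcal{R}})=\varprojlim\mathrm{Y}(\widehat{\mathcal{R}})/I_p$. Let $P^h=\sum_ie_{ii}\otimes e_{ii}+e^{h/2}\sum_{i>j}e_{ij}\otimes e_{ji}+e^{-h/2}\sum_{i<j}e_{ij}\otimes e_{ji}$. The symmetric group $\mathfrak{S}_n$ acts on $(\mathbb{C}^N)^{\otimes n}$ (with coefficients extended to $\mathbb{C}[[h]]$) so that the transposition $(i,i+1)$ acts as $P^h$ on the tensor factors $i,i+1$; $A^h_{(n)}$ is the image of $\frac{1}{n!}\sum_{p\in\mathfrak{S}_n}\mathrm{sgn}(p)\,p$ under this action. $\mathrm{tr}_{1,\ldots,n}$ is the trace over the $n$ tensor factors $\mathrm{End}\,\mathbb{C}^N$. *)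

theory Defs
  imports
    "HOL-Algebra.QuotRing"
    "HOL-Library.Poly_Mapping"
    "HOL-Computational_Algebra.Polynomial"
    "HOL-Computational_Algebra.Formal_Power_Series"
    "HOL-Combinatorics.Permutations"
    "HOL-Library.Cardinality"
begin

text \<open>
  The index set \<open>{1, \<dots>, N}\<close> is a finite linearly ordered type \<open>'n\<close>, so \<open>N\<close> is \<open>CARD('n)\<close>.
  The ground ring \<open>\<complex>[[h]]\<close> is \<^typ>\<open>complex fps\<close>, with \<open>h\<close> the series \<^term>\<open>fps_X\<close>;
  \<open>e\<^sup>c\<^sup>h\<close> is \<open>fps_exp c\<close>.
\<close>

section \<open>The free algebra on the generators\<close>

text \<open>\<open>Gen i j r\<close> is the letter \<open>\<tau>\<^sub>i\<^sub>j\<^sup>(\<^sup>r\<^sup>)\<close>. The free monoid is written additively, as required by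
  the convolution product of \<^typ>\<open>'a \<Rightarrow>\<^sub>0 'b\<close>.\<close>

datatype 'n gen = Gen 'n 'n int

datatype 'n gword = GWord (letters: "'n gen list")

instantiation gword :: (type) monoid_add
begin

definition zero_gword :: "'a gword" where "0 = GWord []"

definition plus_gword :: "'a gword \<Rightarrow> 'a gword \<Rightarrow> 'a gword"
  where "v + w = GWord (letters v @ letters w)"

instance
  by standard (simp_all add: zero_gword_def plus_gword_def)

end

type_synonym 'n falg = "'n gword \<Rightarrow>\<^sub>0 complex fps"

definition scalF :: "complex fps \<Rightarrow> 'n falg"
  where "scalF c = Poly_Mapping.single 0 c"

definition tauF :: "'n \<Rightarrow> 'n \<Rightarrow> int \<Rightarrow> 'n falg"
  where "tauF i j r = Poly_Mapping.single (GWord [Gen i j r]) 1"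

definition free_alg :: "'n falg ring"
  where "free_alg = \<lparr>carrier = UNIV, monoid.mult = (*), one = 1, ring.zero = 0, add = (+)\<rparr>"


section \<open>The R-matrix\<close>

text \<open>Elements of \<open>End \<complex>\<^sup>N\<close> and \<open>End \<complex>\<^sup>N \<otimes> End \<complex>\<^sup>N\<close> over a ring are given by their entries:
  first argument the row, second argument the column.\<close>

definition munit :: "'n \<Rightarrow> 'n \<Rightarrow> 'n \<Rightarrow> 'n \<Rightarrow> 'a::comm_ring_1"
  where "munit i j = (\<lambda>r c. if r = i \<and> c = j then 1 else 0)"

definition tens :: "('n \<Rightarrow> 'n \<Rightarrow> 'a::comm_ring_1) \<Rightarrow> ('n \<Rightarrow> 'n \<Rightarrow> 'a) \<Rightarrow> 'n \<times> 'n \<Rightarrow> 'n \<times> 'n \<Rightarrow> 'a"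
  where "tens A B = (\<lambda>r c. A (fst r) (fst c) * B (snd r) (snd c))"

definition Rmat :: "complex fps poly \<Rightarrow> complex fps poly \<Rightarrow>
    'n::{finite,linorder} \<times> 'n \<Rightarrow> 'n \<times> 'n \<Rightarrow> complex fps poly"
  where "Rmat x y = (\<lambda>r c.
      (x * [:fps_exp (-1/2):] - y * [:fps_exp (1/2):]) *
        (\<Sum>i\<in>UNIV. tens (munit i i) (munit i i) r c)
    + (x - y) * (\<Sum>(i, j) | i \<noteq> j. tens (munit i i) (munit j j) r c)
    + [:fps_exp (-1/2) - fps_exp (1/2):] * x * (\<Sum>(i, j) | i > j. tens (munit i j) (munit j i) r c)
    + [:fps_exp (-1/2) - fps_exp (1/2):] * y * (\<Sum>(i, j) | i < j. tens (munit i j) (munit j i) r c))"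

text \<open>The entries of \<open>Rhat(x)\<close> as polynomials in \<open>x\<close>.\<close>

definition Rhat :: "'n::{finite,linorder} \<times> 'n \<Rightarrow> 'n \<times> 'n \<Rightarrow> complex fps poly"
  where "Rhat r c = smult (fps_exp (-1/2)) (Rmat [:0, 1:] 1 r c)"


section \<open>The algebra \<open>Y(Rhat)\<close>\<close>

text \<open>Entries of the coefficients of \<open>x\<^sup>a y\<^sup>b\<close> in \<open>\<T>\<^sub>1(x) \<T>\<^sub>2(y)\<close> and in \<open>\<T>\<^sub>2(y) \<T>\<^sub>1(x)\<close>.\<close>

definition TT12 :: "int \<Rightarrow> int \<Rightarrow> 'n \<times> 'n \<Rightarrow> 'n \<times> 'n \<Rightarrow> 'n falg"
  where "TT12 a b r c = tauF (fst r) (fst c) (- a) * tauF (snd r) (snd c) (- b)"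

definition TT21 :: "int \<Rightarrow> int \<Rightarrow> 'n \<times> 'n \<Rightarrow> 'n \<times> 'n \<Rightarrow> 'n falg"
  where "TT21 a b r c = tauF (snd r) (snd c) (- b) * tauF (fst r) (fst c) (- a)"

text \<open>The entry \<open>(r, c)\<close> of the coefficient of \<open>x\<^sup>a y\<^sup>b\<close> in
  \<open>Rhat(x/y) \<T>\<^sub>1(x) \<T>\<^sub>2(y) - \<T>\<^sub>2(y) \<T>\<^sub>1(x) Rhat(x/y)\<close>: the monomial \<open>(x/y)\<^sup>s\<close> of \<open>Rhat(x/y)\<close>
  meets the coefficient of \<open>x\<^bsup>a-s\<^esup> y\<^bsup>b+s\<^esup>\<close>.\<close>

definition rtt_rel :: "int \<Rightarrow> int \<Rightarrow> 'n::{finite,linorder} \<times> 'n \<Rightarrow> 'n \<times> 'n \<Rightarrow> 'n falg"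
  where "rtt_rel a b r c =
      (\<Sum>k\<in>UNIV. \<Sum>s\<le>degree (Rhat r k).
          scalF (coeff (Rhat r k) s) * TT12 (a - int s) (b + int s) k c)
    - (\<Sum>k\<in>UNIV. \<Sum>s\<le>degree (Rhat k c).
          TT21 (a - int s) (b + int s) r k * scalF (coeff (Rhat k c) s))"

definition rtt_ideal :: "'n::{finite,linorder} falg set"
  where "rtt_ideal = Idl\<^bsub>free_alg\<^esub> {rtt_rel a b r c | a b r c. True}"

definition Yalg :: "'n::{finite,linorder} falg set ring"
  where "Yalg = free_alg Quot rtt_ideal"

definition toY :: "'n::{finite,linorder} falg \<Rightarrow> 'n falg set"
  where "toY x = rtt_ideal +>\<^bsub>free_alg\<^esub> x"


section \<open>The completion\<close>

definition Iid :: "nat \<Rightarrow> 'n::{finite,linorder} falg set set"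
  where "Iid p = Idl\<^bsub>Yalg\<^esub>
    ({toY (scalF (fps_X ^ (p + 1)))} \<union> {toY (tauF i j (- r)) | i j r. r > int p})"

definition Yq :: "nat \<Rightarrow> 'n::{finite,linorder} falg set set ring"
  where "Yq p = Yalg Quot Iid p"

type_synonym 'n ytilde = "nat \<Rightarrow> 'n falg set set"

text \<open>The inverse limit of the rings \<^term>\<open>Yq p\<close>. For \<open>p \<le> q\<close> the transition map sends the coset
  \<open>x + I\<^sub>q\<close> to \<open>x + I\<^sub>p\<close>, which is the only coset of \<open>I\<^sub>p\<close> containing it.\<close>

definition Ytilde :: "'n::{finite,linorder} ytilde ring"
  where "Ytilde = \<lparr>
    carrier = {f. (\<forall>p. f p \<in> carrier (Yq p)) \<and> (\<forall>p q. p \<le> q \<longrightarrow> f q \<subseteq> f p)},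
    monoid.mult = (\<lambda>f g p. f p \<otimes>\<^bsub>Yq p\<^esub> g p),
    one = (\<lambda>p. \<one>\<^bsub>Yq p\<^esub>),
    ring.zero = (\<lambda>p. \<zero>\<^bsub>Yq p\<^esub>),
    add = (\<lambda>f g p. f p \<oplus>\<^bsub>Yq p\<^esub> g p)\<rparr>"

definition toYt :: "'n::{finite,linorder} falg \<Rightarrow> 'n ytilde"
  where "toYt x = (\<lambda>p. Iid p +>\<^bsub>Yalg\<^esub> toY x)"

abbreviation scal :: "complex fps \<Rightarrow> 'n::{finite,linorder} ytilde"
  where "scal c \<equiv> toYt (scalF c)"

abbreviation tau :: "'n::{finite,linorder} \<Rightarrow> 'n \<Rightarrow> int \<Rightarrow> 'n ytilde"
  where "tau i j r \<equiv> toYt (tauF i j r)"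

text \<open>Sums of infinite families in the completion, for the inverse limit topology: the component
  in \<open>Y/I\<^sub>p\<close> is the sum of the terms that do not vanish there, provided these are finitely many
  (for the family defining \<open>\<T>\<^sub>(\<^sub>n\<^sub>)(z)\<close> they are, see \<open>T_prod_summable\<close> below).\<close>

definition csummable :: "('i \<Rightarrow> 'n::{finite,linorder} ytilde) \<Rightarrow> 'i set \<Rightarrow> bool"
  where "csummable F A \<longleftrightarrow> (\<forall>p. finite {i \<in> A. F i p \<noteq> \<zero>\<^bsub>Yq p\<^esub>})"

definition csum :: "('i \<Rightarrow> 'n::{finite,linorder} ytilde) \<Rightarrow> 'i set \<Rightarrow> 'n ytilde"
  where "csum F A = (\<lambda>p. finsum (Yq p) (\<lambda>i. F i p) {i \<in> A. F i p \<noteq> \<zero>\<^bsub>Yq p\<^esub>})"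


section \<open>Operators on \<open>n\<close>-fold tensor powers and the h-antisymmetrizer\<close>

text \<open>Elements of \<open>(End \<complex>\<^sup>N)\<^sup>\<otimes>\<^sup>n\<close> over a ring are given by their entries in the basis of
  \<open>(\<complex>\<^sup>N)\<^sup>\<otimes>\<^sup>n\<close> indexed by lists of length \<open>n\<close>; entries at other lists are \<open>0\<close>. The tensor factors are
  numbered from \<open>0\<close>, so \<open>\<T>\<^sub>k\<close> acts on factor \<open>k - 1\<close>.\<close>

definition idx :: "nat \<Rightarrow> 'n list set"
  where "idx n = {I. length I = n}"

type_synonym 'n oper = "'n list \<Rightarrow> 'n list \<Rightarrow> complex fps"

definition op_one :: "nat \<Rightarrow> 'n oper"
  where "op_one n = (\<lambda>I J. if I \<in> idx n \<and> I = J then 1 else 0)"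

definition op_mult :: "nat \<Rightarrow> 'n oper \<Rightarrow> 'n oper \<Rightarrow> 'n oper"
  where "op_mult n A B = (\<lambda>I J. \<Sum>K\<in>idx n. A I K * B K J)"

definition Ph :: "'n::{finite,linorder} \<times> 'n \<Rightarrow> 'n \<times> 'n \<Rightarrow> complex fps"
  where "Ph = (\<lambda>r c.
      (\<Sum>i\<in>UNIV. tens (munit i i) (munit i i) r c)
    + fps_exp (1/2) * (\<Sum>(i, j) | i > j. tens (munit i j) (munit j i) r c)
    + fps_exp (-1/2) * (\<Sum>(i, j) | i < j. tens (munit i j) (munit j i) r c))"

definition Ph_adj :: "nat \<Rightarrow> nat \<Rightarrow> 'n::{finite,linorder} oper"
  where "Ph_adj n k = (\<lambda>I J.
    if I \<in> idx n \<and> J \<in> idx n \<and> (\<forall>l<n. l \<noteq> k \<and> l \<noteq> Suc k \<longrightarrow> I ! l = J ! l)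
    then Ph (I ! k, I ! Suc k) (J ! k, J ! Suc k) else 0)"

text \<open>\<open>\<rho>\<close> is a homomorphism from \<open>\<SS>\<^sub>n\<close> (permutations of \<open>{0, \<dots>, n-1}\<close>) that maps the adjacent
  transpositions to \<open>P\<^sup>h\<close>; the last clause fixes the values at functions outside \<open>\<SS>\<^sub>n\<close>, so that
  there is exactly one such \<open>\<rho>\<close> (see \<open>sym_action_expl\<close> and \<open>is_sym_action_unique\<close> below).\<close>

definition is_sym_action :: "nat \<Rightarrow> ((nat \<Rightarrow> nat) \<Rightarrow> 'n::{finite,linorder} oper) \<Rightarrow> bool"
  where "is_sym_action n \<rho> \<longleftrightarrow>
      \<rho> id = op_one n
    \<and> (\<forall>p q. p permutes {..<n} \<longrightarrow> q permutes {..<n} \<longrightarrow> \<rho> (p \<circ> q) = op_mult n (\<rho> p) (\<rho> q))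
    \<and> (\<forall>k. Suc k < n \<longrightarrow> \<rho> (transpose k (Suc k)) = Ph_adj n k)
    \<and> (\<forall>p. \<not> p permutes {..<n} \<longrightarrow> \<rho> p = (\<lambda>I J. 0))"

definition sym_action :: "nat \<Rightarrow> (nat \<Rightarrow> nat) \<Rightarrow> 'n::{finite,linorder} oper"
  where "sym_action n = (THE \<rho>. is_sym_action n \<rho>)"

definition Ah :: "nat \<Rightarrow> 'n::{finite,linorder} oper"
  where "Ah n = (\<lambda>I J. fps_const (1 / fact n) *
    (\<Sum>p | p permutes {..<n}. of_int (sign p) * sym_action n p I J))"


section \<open>The series \<open>\<T>\<^sub>(\<^sub>n\<^sub>)(z)\<close>\<close>

definition mat_mult :: "('a, 'b) ring_scheme \<Rightarrow> nat \<Rightarrow>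
    ('n list \<Rightarrow> 'n list \<Rightarrow> 'a) \<Rightarrow> ('n list \<Rightarrow> 'n list \<Rightarrow> 'a) \<Rightarrow> 'n list \<Rightarrow> 'n list \<Rightarrow> 'a"
  where "mat_mult R n A B = (\<lambda>I J. finsum R (\<lambda>K. A I K \<otimes>\<^bsub>R\<^esub> B K J) (idx n))"

definition mat_one :: "('a, 'b) ring_scheme \<Rightarrow> nat \<Rightarrow> 'n list \<Rightarrow> 'n list \<Rightarrow> 'a"
  where "mat_one R n = (\<lambda>I J. if I \<in> idx n \<and> I = J then \<one>\<^bsub>R\<^esub> else \<zero>\<^bsub>R\<^esub>)"

text \<open>The coefficient of \<open>z\<^sup>a\<close> in \<open>\<T>\<^bsub>k+1\<^esub>(z e\<^bsup>-kh\<^esup>)\<close>.\<close>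

definition T_copy :: "nat \<Rightarrow> nat \<Rightarrow> int \<Rightarrow> 'n list \<Rightarrow> 'n list \<Rightarrow> 'n::{finite,linorder} ytilde"
  where "T_copy n k a = (\<lambda>I J.
    if I \<in> idx n \<and> J \<in> idx n \<and> (\<forall>l<n. l \<noteq> k \<longrightarrow> I ! l = J ! l)
    then scal (fps_exp (- (of_nat k * of_int a))) \<otimes>\<^bsub>Ytilde\<^esub> tau (I ! k) (J ! k) (- a)
    else \<zero>\<^bsub>Ytilde\<^esub>)"

text \<open>The product of the coefficients of \<open>z\<^bsup>as!0\<^esup>, \<dots>, z\<^bsup>as!(n-1)\<^esup>\<close> in the \<open>n\<close> factors of
  \<open>\<T>\<^sub>1(z) \<T>\<^sub>2(z e\<^bsup>-h\<^esup>) \<dots> \<T>\<^sub>n(z e\<^bsup>-(n-1)h\<^esup>)\<close>, and the coefficient of \<open>z\<^sup>a\<close> in the whole product.\<close>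

definition T_term :: "nat \<Rightarrow> int list \<Rightarrow> 'n list \<Rightarrow> 'n list \<Rightarrow> 'n::{finite,linorder} ytilde"
  where "T_term n as =
    foldr (\<lambda>k. mat_mult Ytilde n (T_copy n k (as ! k))) [0..<n] (mat_one Ytilde n)"

definition T_prod :: "nat \<Rightarrow> int \<Rightarrow> 'n list \<Rightarrow> 'n list \<Rightarrow> 'n::{finite,linorder} ytilde"
  where "T_prod n a = (\<lambda>I J. csum (\<lambda>as. T_term n as I J) {as. length as = n \<and> sum_list as = a})"

text \<open>The coefficient of \<open>z\<^sup>a\<close> in \<open>\<T>\<^sub>(\<^sub>n\<^sub>)(z)\<close>.\<close>

definition Tn :: "nat \<Rightarrow> int \<Rightarrow> 'n::{finite,linorder} ytilde"
  where "Tn n a = finsum Ytilde (\<lambda>I. finsum Ytilde (\<lambda>J.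
    scal (Ah n I J) \<otimes>\<^bsub>Ytilde\<^esub> T_prod n a J I) (idx n)) (idx n)"


section \<open>Well-definedness\<close>

subsection \<open>The action of the symmetric group\<close>

lemma finite_idx [simp]: "finite (idx n :: 'n::finite list set)"
  unfolding idx_def using finite_lists_length_eq[of "UNIV :: 'n set" n] by simp

lemma permute_list_eq_nth:
  assumes "length I = n" "length J = n"
  shows "permute_list p I = J \<longleftrightarrow> (\<forall>l<n. I ! p l = J ! l)"
  using assms by (auto simp: permute_list_def list_eq_iff_nth_eq)

definition ninv :: "'n::linorder list \<Rightarrow> nat"
  where "ninv I = card {(i, j). i < j \<and> j < length I \<and> I ! i > I ! j}"

lemma ninv_swap:
  fixes I J :: "'n::linorder list"
  assumes len: "length I = n" "Suc k < n" and J: "J = permute_list (transpose k (Suc k)) I"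
  shows "ninv I + (if I ! k < I ! Suc k then 1 else 0) = ninv J + (if I ! k > I ! Suc k then 1 else 0)"
proof -
  define t where "t = transpose k (Suc k)"
  have t: "t permutes {..<n}" unfolding t_def using len by (intro permutes_swap_id) auto
  have tt [simp]: "t (t x) = x" for x by (simp add: t_def)
  have Jn: "J ! l = I ! t l" if "l < n" for l
    using that len J by (simp add: permute_list_def t_def)
  have lJ: "length J = n" using len J by simp
  have tl: "t l < n \<longleftrightarrow> l < n" for l using permutes_in_image[OF t, of l] by simp
  define S where "S = {(i, j). i < j \<and> j < n \<and> (i, j) \<noteq> (k, Suc k)}"
  have finS: "finite S"
    by (rule finite_subset[of _ "{..<n} \<times> {..<n}"]) (auto simp: S_def)
  define A where "A = (\<lambda>K::'n list. {(i, j). (i, j) \<in> S \<and> K ! i > K ! j})"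
  have mapS: "map_prod t t x \<in> S" if "x \<in> S" for x
    using that len(2) unfolding S_def t_def by (auto simp: transpose_def split: if_splits)
  have finA: "finite (A K)" for K by (rule finite_subset[OF _ finS]) (auto simp: A_def)
  have bij: "bij_betw (map_prod t t) (A J) (A I)"
  proof (rule bij_betw_byWitness[where f' = "map_prod t t"])
    show "map_prod t t ` A J \<subseteq> A I"
    proof
      fix y assume "y \<in> map_prod t t ` A J"
      then obtain i j where y: "y = map_prod t t (i, j)" and ij: "(i, j) \<in> S" "J ! i > J ! j"
        by (auto simp: A_def)
      moreover from ij have "i < n" "j < n" by (auto simp: S_def)
      ultimately show "y \<in> A I"
        using mapS[of "(i, j)"] by (auto simp: A_def Jn tl)
    qed
    show "map_prod t t ` A I \<subseteq> A J"
    proof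
      fix y assume "y \<in> map_prod t t ` A I"
      then obtain i j where y: "y = map_prod t t (i, j)" and ij: "(i, j) \<in> S" "I ! i > I ! j"
        by (auto simp: A_def)
      moreover from ij have "i < n" "j < n" by (auto simp: S_def)
      ultimately show "y \<in> A J"
        using mapS[of "(i, j)"] by (auto simp: A_def Jn tl)
    qed
  qed auto
  have "card (A J) = card (A I)" using bij by (rule bij_betw_same_card)
  moreover have "ninv K = card (A K) + (if K ! k > K ! Suc k then 1 else 0)" if "length K = n" for K
  proof -
    have "{(i, j). i < j \<and> j < length K \<and> K ! i > K ! j} =
        A K \<union> (if K ! k > K ! Suc k then {(k, Suc k)} else {})"
      using that len(2) by (auto simp: A_def S_def split: if_splits)
    moreover have "(k, Suc k) \<notin> A K" by (auto simp: A_def S_def)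
    ultimately show ?thesis using finA[of K] unfolding ninv_def by auto
  qed
  moreover have "J ! k = I ! Suc k" "J ! Suc k = I ! k"
    using len(2) by (auto simp: Jn t_def)
  ultimately show ?thesis using lJ len by auto
qed

lemma Ph_entry:
  "Ph (i, j) (k, l) = (if k = j \<and> l = i then
     (if i = j then 1 else if i > j then fps_exp (1/2) else fps_exp (-1/2)) else 0)"
proof -
  have tens_ent: "tens (munit i' j') (munit j' i') (i, j) (k, l) =
      (if i' = i \<and> j' = j then (if k = j \<and> l = i then 1 else 0) else 0)"
    for i' j' :: 'a
    by (auto simp: tens_def munit_def)
  have 1: "(\<Sum>i'\<in>UNIV. tens (munit i' i') (munit i' i') (i, j) (k, l)) =
     (if i = j \<and> k = j \<and> l = i then 1 else (0 :: complex fps))"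
  proof -
    have "(\<Sum>i'\<in>UNIV. tens (munit i' i') (munit i' i') (i, j) (k, l)) =
       (\<Sum>i'\<in>UNIV. if i' = i then (if i = j \<and> k = j \<and> l = i then 1 else (0 :: complex fps)) else 0)"
      by (intro sum.cong) (auto simp: tens_ent)
    then show ?thesis by simp
  qed
  have 2: "(\<Sum>(i', j') | Q i' j'. tens (munit i' j') (munit j' i') (i, j) (k, l)) =
     (if Q i j \<and> k = j \<and> l = i then 1 else (0 :: complex fps))" for Q
  proof -
    have "(\<Sum>(i', j') | Q i' j'. tens (munit i' j') (munit j' i') (i, j) (k, l)) =
      (\<Sum>x\<in>{(i', j'). Q i' j'}. if x = (i, j) then (if k = j \<and> l = i then 1 else (0 :: complex fps)) else 0)"
      by (intro sum.cong) (auto simp: tens_ent split: if_splits)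
    then show ?thesis by simp
  qed
  show ?thesis by (auto simp: Ph_def 1 2)
qed

definition sym_action_expl :: "nat \<Rightarrow> (nat \<Rightarrow> nat) \<Rightarrow> 'n::{finite,linorder} oper"
  where "sym_action_expl n p = (\<lambda>I J.
    if p permutes {..<n} \<and> I \<in> idx n \<and> J \<in> idx n \<and> permute_list p I = J
    then fps_exp ((of_nat (ninv I) - of_nat (ninv J)) / 2) else 0)"

lemma sym_action_expl: "is_sym_action n (sym_action_expl n :: _ \<Rightarrow> 'n::{finite,linorder} oper)"
  unfolding is_sym_action_def
proof (intro conjI allI impI)
  show "sym_action_expl n id = (op_one n :: 'n oper)"
    by (intro ext) (auto simp: sym_action_expl_def op_one_def permutes_id)
next
  fix p q :: "nat \<Rightarrow> nat"
  assume p: "p permutes {..<n}" and q: "q permutes {..<n}"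
  have pq: "p \<circ> q permutes {..<n}" using p q by (rule permutes_compose[rotated])
  show "sym_action_expl n (p \<circ> q) = (op_mult n (sym_action_expl n p) (sym_action_expl n q) :: 'n oper)"
  proof (intro ext)
    fix I J :: "'n list"
    show "sym_action_expl n (p \<circ> q) I J = op_mult n (sym_action_expl n p) (sym_action_expl n q) I J"
    proof (cases "I \<in> idx n")
      case False
      then show ?thesis by (simp add: sym_action_expl_def op_mult_def)
    next
      case True
      define K0 where "K0 = permute_list p I"
      have K0: "K0 \<in> idx n" using True by (simp add: K0_def idx_def)
      have comp: "permute_list (p \<circ> q) I = permute_list q K0"
        using True q unfolding K0_def idx_def by (intro permute_list_compose) auto
      have "op_mult n (sym_action_expl n p) (sym_action_expl n q) I J =
          (\<Sum>K\<in>idx n. if K = K0 then sym_action_expl n p I K0 * sym_action_expl n q K0 J else 0)"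
        unfolding op_mult_def by (intro sum.cong) (auto simp: sym_action_expl_def K0_def)
      also have "\<dots> = sym_action_expl n p I K0 * sym_action_expl n q K0 J"
        using K0 by simp
      also have "\<dots> = sym_action_expl n (p \<circ> q) I J"
        using True K0 p q pq
        by (auto simp: sym_action_expl_def comp K0_def[symmetric] fps_exp_add_mult[symmetric]
            diff_divide_distrib)
      finally show ?thesis by simp
    qed
  qed
next
  fix k assume k: "Suc k < n"
  define t where "t = transpose k (Suc k)"
  have t: "t permutes {..<n}" unfolding t_def using k by (intro permutes_swap_id) auto
  show "sym_action_expl n (transpose k (Suc k)) = (Ph_adj n k :: 'n oper)"
  proof (intro ext)
    fix I J :: "'n list"
    show "sym_action_expl n (transpose k (Suc k)) I J = Ph_adj n k I J"
    proof (cases "I \<in> idx n \<and> J \<in> idx n")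
      case False
      then show ?thesis by (auto simp: sym_action_expl_def Ph_adj_def)
    next
      case True
      then have len: "length I = n" "length J = n" by (auto simp: idx_def)
      have eq: "permute_list t I = J \<longleftrightarrow>
        (\<forall>l<n. l \<noteq> k \<and> l \<noteq> Suc k \<longrightarrow> I ! l = J ! l) \<and> J ! k = I ! Suc k \<and> J ! Suc k = I ! k"
        (is "?L \<longleftrightarrow> ?R")
      proof
        assume ?L
        then have *: "I ! t l = J ! l" if "l < n" for l
          using that by (simp add: permute_list_eq_nth[OF len])
        have "I ! l = J ! l" if "l < n" "l \<noteq> k" "l \<noteq> Suc k" for l
          using *[OF that(1)] that by (simp add: t_def)
        then show ?R using *[of k] *[of "Suc k"] k by (auto simp: t_def)
      next
        assume R: ?R
        show ?L unfolding permute_list_eq_nth[OF len]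
        proof (intro allI impI)
          fix l assume "l < n"
          consider "l = k" | "l = Suc k" | "l \<noteq> k" "l \<noteq> Suc k" by blast
          then show "I ! t l = J ! l"
          proof cases
            case 1
            have "t l = Suc k" using 1 by (simp add: t_def)
            with R 1 show ?thesis by metis
          next
            case 2
            have "t l = k" using 2 by (simp add: t_def)
            with R 2 show ?thesis by metis
          next
            case 3
            have "t l = l" using 3 by (simp add: t_def)
            with R 3 \<open>l < n\<close> show ?thesis by metis
          qed
        qed
      qed
      show ?thesis
      proof (cases "permute_list t I = J")
        case False
        show ?thesis
        proof -
          have "\<not> ((\<forall>l<n. l \<noteq> k \<and> l \<noteq> Suc k \<longrightarrow> I ! l = J ! l) \<and> J ! k = I ! Suc k \<and> J ! Suc k = I ! k)"
            using False eq by blast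
          then have "Ph_adj n k I J = 0" unfolding Ph_adj_def Ph_entry by (metis (no_types, lifting))
          then show ?thesis using False by (simp add: sym_action_expl_def t_def)
        qed
      next
        case L: True
        note nv = ninv_swap[OF len(1) k, of J, folded t_def, OF L[symmetric]]
        from L eq have R: "\<forall>l<n. l \<noteq> k \<and> l \<noteq> Suc k \<longrightarrow> I ! l = J ! l"
          "J ! k = I ! Suc k" "J ! Suc k = I ! k" by blast+
        have Ph1: "Ph_adj n k I J = Ph (I ! k, I ! Suc k) (I ! Suc k, I ! k)"
          unfolding Ph_adj_def R(2,3) by (rule if_P) (use True R(1) in blast)
        have rhs: "Ph_adj n k I J = (if I ! k = I ! Suc k then 1
            else if I ! k > I ! Suc k then fps_exp (1/2) else fps_exp (-1/2))"
          unfolding Ph1 Ph_entry by (cases "I ! k" "I ! Suc k" rule: linorder_cases) auto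
        have "(of_nat (ninv I) - of_nat (ninv J) :: complex) =
          (if I ! k > I ! Suc k then 1 else 0) - (if I ! k < I ! Suc k then 1 else 0)"
        proof -
          have "(of_nat (ninv I + (if I ! k < I ! Suc k then 1 else 0)) :: complex) =
              of_nat (ninv J + (if I ! k > I ! Suc k then 1 else 0))"
            by (simp only: nv)
          then show ?thesis by (auto simp: algebra_simps split: if_splits)
        qed
        then have "sym_action_expl n t I J = fps_exp
            (((if I ! k > I ! Suc k then 1 else 0) - (if I ! k < I ! Suc k then 1 else 0)) / 2)"
          using True L t by (simp add: sym_action_expl_def)
        also have "\<dots> = Ph_adj n k I J"
          unfolding rhs by (cases "I ! k" "I ! Suc k" rule: linorder_cases) auto
        finally show ?thesis by (simp add: t_def)
      qed
    qed
  qed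
next
  fix p :: "nat \<Rightarrow> nat" assume "\<not> p permutes {..<n}"
  then show "sym_action_expl n p = (\<lambda>I J. 0 :: complex fps)" by (simp add: sym_action_expl_def)
qed

lemma permutes_adj_transps:
  assumes "p permutes {..<n::nat}"
  shows "\<exists>xs. (\<forall>x\<in>set xs. Suc x < n) \<and> p = apply_adj_transps xs"
proof -
  have tr: "\<exists>xs. (\<forall>x\<in>set xs. Suc x < n) \<and> transpose a b = apply_adj_transps xs"
    if ab: "a < n" "b < n" "a \<noteq> b" for a b
  proof -
    have *: "\<exists>xs. (\<forall>x\<in>set xs. Suc x < n) \<and> transpose a b = apply_adj_transps xs"
      if "a < b" "b < n" for a b
      using that set_adj_transp_seq[of a b] adj_transp_seq_correct[of a b]
      by (intro exI[of _ "adj_transp_seq a b"]) auto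
    show ?thesis using *[of a b] *[of b a] ab by (cases "a < b") (auto simp: transpose_commute)
  qed
  have app: "apply_adj_transps xs \<circ> apply_adj_transps ys = apply_adj_transps (xs @ ys)" for xs ys
    by (induction xs) (auto simp: fun_eq_iff)
  have fin: "finite {..<n}" by simp
  from assms fin show ?thesis
  proof (induction rule: permutes_induct)
    case id
    show ?case by (intro exI[of _ "[]"]) simp
  next
    case (swap a b p)
    then obtain ys where ys: "\<forall>x\<in>set ys. Suc x < n" "p = apply_adj_transps ys" by blast
    obtain xs where xs: "\<forall>x\<in>set xs. Suc x < n" "transpose a b = apply_adj_transps xs"
    proof (cases "a = b")
      case True
      then show ?thesis using that[of "[]"] by simp
    next
      case False
      then show ?thesis using tr[of a b] swap that by auto
    qed
    show ?case using xs ys app by (intro exI[of _ "xs @ ys"]) auto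
  qed
qed

lemma is_sym_action_unique:
  fixes \<rho> \<rho>' :: "_ \<Rightarrow> 'n::{finite,linorder} oper"
  assumes "is_sym_action n \<rho>" "is_sym_action n \<rho>'"
  shows "\<rho> = \<rho>'"
proof
  fix p
  show "\<rho> p = \<rho>' p"
  proof (cases "p permutes {..<n}")
    case False
    then show ?thesis using assms by (simp add: is_sym_action_def)
  next
    case True
    then obtain xs where xs: "\<forall>x\<in>set xs. Suc x < n" "p = apply_adj_transps xs"
      using permutes_adj_transps by blast
    from xs(1) have "\<rho> (apply_adj_transps xs) = \<rho>' (apply_adj_transps xs)"
    proof (induction xs)
      case Nil
      show ?case using assms unfolding is_sym_action_def apply_adj_transps_Nil by metis
    next
      case (Cons x xs)
      have 1: "transpose x (Suc x) permutes {..<n}" using Cons.prems by (intro permutes_swap_id) auto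
      have 2: "apply_adj_transps xs permutes {..<n}"
        using Cons.prems by (intro permutes_apply_adj_transps) auto
      have 3: "Suc x < n" "\<forall>y\<in>set xs. Suc y < n" using Cons.prems by auto
      have "\<rho>'' (transpose x (Suc x) \<circ> apply_adj_transps xs) =
          op_mult n (Ph_adj n x) (\<rho>'' (apply_adj_transps xs))" if "is_sym_action n \<rho>''" for \<rho>'' :: "_ \<Rightarrow> 'n oper"
        using that 1 2 3(1) unfolding is_sym_action_def by metis
      from this[OF assms(1)] this[OF assms(2)] Cons.IH[OF 3(2)] show ?case
        by (simp only: apply_adj_transps_Cons Suc_eq_plus1[symmetric])
    qed
    then show ?thesis using xs by simp
  qed
qed

theorem sym_action: "is_sym_action n (sym_action n)"
  unfolding sym_action_def
  by (rule theI[of _ "sym_action_expl n"]) (auto intro: sym_action_expl is_sym_action_unique)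


subsection \<open>The rings\<close>

lemma ring_free_alg: "ring (free_alg :: 'n falg ring)"
proof -
  have "\<exists>y. x + y = 0" for x :: "'n falg" using add.right_inverse by blast
  then show ?thesis unfolding free_alg_def using add.right_inverse
    by unfold_locales (auto simp: algebra_simps Units_def)
qed

lemma ideal_rtt: "ideal rtt_ideal (free_alg :: 'n::{finite,linorder} falg ring)"
  unfolding rtt_ideal_def
  by (rule ring.genideal_ideal[OF ring_free_alg]) (simp add: free_alg_def)

lemma ring_Yalg: "ring (Yalg :: 'n::{finite,linorder} falg set ring)"
  unfolding Yalg_def by (rule ideal.quotient_is_ring[OF ideal_rtt])

lemma toY_hom: "toY \<in> ring_hom free_alg (Yalg :: 'n::{finite,linorder} falg set ring)"
  using ideal.rcos_ring_hom[OF ideal_rtt] unfolding Yalg_def toY_def[abs_def] by (simp add: eta_contract_eq)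

lemma toY_closed [simp]: "toY x \<in> carrier (Yalg :: 'n::{finite,linorder} falg set ring)"
  by (rule ring_hom_closed[OF toY_hom]) (simp add: free_alg_def)

lemma ideal_Iid: "ideal (Iid p) (Yalg :: 'n::{finite,linorder} falg set ring)"
  unfolding Iid_def by (rule ring.genideal_ideal[OF ring_Yalg]) auto

lemma ring_Yq: "ring (Yq p :: 'n::{finite,linorder} falg set set ring)"
  unfolding Yq_def by (rule ideal.quotient_is_ring[OF ideal_Iid])

lemma Iid_antimono:
  assumes "p \<le> q" shows "Iid q \<subseteq> (Iid p :: 'n::{finite,linorder} falg set set)"
proof -
  interpret Y: ring "Yalg :: 'n falg set ring" by (rule ring_Yalg)
  interpret Ip: ideal "Iid p" "Yalg :: 'n falg set ring" by (rule ideal_Iid)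
  let ?G = "\<lambda>p. {toY (scalF (fps_X ^ (p + 1)))} \<union> {toY (tauF i j (- r)) | i j r. r > int p} :: 'n falg set set"
  have G: "?G p \<subseteq> Iid p" unfolding Iid_def by (rule Y.genideal_self) auto
  have "fps_X ^ (q + 1) = fps_X ^ (q - p) * (fps_X ^ (p + 1) :: complex fps)"
    using assms by (simp flip: power_add)
  then have "scalF (fps_X ^ (q + 1)) = scalF (fps_X ^ (q - p)) * (scalF (fps_X ^ (p + 1)) :: 'n falg)"
    unfolding scalF_def by (simp only: mult_single add_0)
  then have "toY (scalF (fps_X ^ (q + 1))) =
      toY (scalF (fps_X ^ (q - p))) \<otimes>\<^bsub>Yalg\<^esub> (toY (scalF (fps_X ^ (p + 1))) :: 'n falg set)"
    using ring_hom_mult[OF toY_hom, of "scalF (fps_X ^ (q - p))" "scalF (fps_X ^ (p + 1)) :: 'n falg"]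
    by (simp add: free_alg_def)
  moreover have "toY (scalF (fps_X ^ (p + 1))) \<in> (Iid p :: 'n falg set set)" using G by blast
  ultimately have "toY (scalF (fps_X ^ (q + 1))) \<in> (Iid p :: 'n falg set set)"
    using Ip.I_l_closed toY_closed by metis
  moreover have "{toY (tauF i j (- r)) | i j r. r > int q} \<subseteq> (Iid p :: 'n falg set set)"
    using G assms by fastforce
  ultimately have "?G q \<subseteq> Iid p" by auto
  then show ?thesis unfolding Iid_def[of q] by (intro Y.genideal_minimal ideal_Iid)
qed

lemma Yq_carrier: "carrier (Yq p) = {Iid p +>\<^bsub>Yalg\<^esub> x | x. x \<in> carrier Yalg}"
  by (auto simp: Yq_def FactRing_def A_RCOSETS_def' a_r_coset_def')

lemma Ytilde_rep:
  assumes "f \<in> carrier (Ytilde :: 'n::{finite,linorder} ytilde ring)" "p \<le> q"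
  obtains x where "x \<in> carrier Yalg" "f q = Iid q +>\<^bsub>Yalg\<^esub> x" "f p = Iid p +>\<^bsub>Yalg\<^esub> x"
proof -
  interpret Ip: ideal "Iid p" "Yalg :: 'n falg set ring" by (rule ideal_Iid)
  interpret Iq: ideal "Iid q" "Yalg :: 'n falg set ring" by (rule ideal_Iid)
  have "f q \<in> carrier (Yq q)" "f p \<in> carrier (Yq p)" "f q \<subseteq> f p"
    using assms by (auto simp: Ytilde_def)
  then obtain x y where x: "x \<in> carrier Yalg" "f q = Iid q +>\<^bsub>Yalg\<^esub> x"
    and y: "y \<in> carrier Yalg" "f p = Iid p +>\<^bsub>Yalg\<^esub> y" by (auto simp: Yq_carrier)
  have "x \<in> f q" using x Iq.a_rcos_self by simp
  then have "x \<in> Iid p +>\<^bsub>Yalg\<^esub> y" using \<open>f q \<subseteq> f p\<close> y by auto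
  then have "f p = Iid p +>\<^bsub>Yalg\<^esub> x" using Ip.a_repr_independence[OF _ y(1)] y(2) Ip.a_subgroup by metis
  then show ?thesis using that x by auto
qed

lemma Iid_coset_mono:
  assumes "p \<le> q"
  shows "Iid q +>\<^bsub>Yalg\<^esub> x \<subseteq> Iid p +>\<^bsub>Yalg\<^esub> (x :: 'n::{finite,linorder} falg set)"
  using Iid_antimono[OF assms, where 'n = 'n] by (auto simp: a_r_coset_def')

lemma coset_hom: "(+>\<^bsub>Yalg\<^esub>) (Iid p) \<in> ring_hom Yalg (Yq p :: 'n::{finite,linorder} falg set set ring)"
  unfolding Yq_def by (rule ideal.rcos_ring_hom[OF ideal_Iid])

lemma ring_Ytilde: "ring (Ytilde :: 'n::{finite,linorder} ytilde ring)"
proof -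
  interpret Y: ring "Yalg :: 'n falg set ring" by (rule ring_Yalg)
  interpret Q: ring "Yq p :: 'n falg set set ring" for p by (rule ring_Yq)
  let ?S = "Ytilde :: 'n ytilde ring"
  have S: "f \<in> carrier ?S \<longleftrightarrow> (\<forall>p. f p \<in> carrier (Yq p)) \<and> (\<forall>p q. p \<le> q \<longrightarrow> f q \<subseteq> f p)" for f
    by (simp add: Ytilde_def)
  have mem: "f \<in> carrier ?S" if "\<And>p q. p \<le> q \<Longrightarrow>
      \<exists>x\<in>carrier Yalg. f q = Iid q +>\<^bsub>Yalg\<^esub> x \<and> f p = Iid p +>\<^bsub>Yalg\<^esub> x" for f
    unfolding S
  proof (intro conjI allI impI)
    fix p show "f p \<in> carrier (Yq p)" using that[of p p] by (auto simp: Yq_carrier)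
  next
    fix p q :: nat assume "p \<le> q"
    then show "f q \<subseteq> f p" using that[of p q] Iid_coset_mono by metis
  qed
  have one: "\<one>\<^bsub>?S\<^esub> \<in> carrier ?S"
  proof (rule mem)
    fix p q :: nat
    show "\<exists>x\<in>carrier Yalg. \<one>\<^bsub>?S\<^esub> q = Iid q +>\<^bsub>Yalg\<^esub> x \<and> \<one>\<^bsub>?S\<^esub> p = Iid p +>\<^bsub>Yalg\<^esub> x"
      using ring_hom_one[OF coset_hom]
      by (intro bexI[of _ "\<one>\<^bsub>Yalg\<^esub>"]) (auto simp: Ytilde_def)
  qed
  have zero: "\<zero>\<^bsub>?S\<^esub> \<in> carrier ?S"
  proof (rule mem)
    fix p q :: nat
    show "\<exists>x\<in>carrier Yalg. \<zero>\<^bsub>?S\<^esub> q = Iid q +>\<^bsub>Yalg\<^esub> x \<and> \<zero>\<^bsub>?S\<^esub> p = Iid p +>\<^bsub>Yalg\<^esub> x"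
      using ring_hom_zero[OF coset_hom ring_Yalg ring_Yq]
      by (intro bexI[of _ "\<zero>\<^bsub>Yalg\<^esub>"]) (auto simp: Ytilde_def)
  qed
  have mult: "f \<otimes>\<^bsub>?S\<^esub> g \<in> carrier ?S" if fg: "f \<in> carrier ?S" "g \<in> carrier ?S" for f g
  proof (rule mem)
    fix p q :: nat assume pq: "p \<le> q"
    obtain x where x: "x \<in> carrier Yalg" "f q = Iid q +>\<^bsub>Yalg\<^esub> x" "f p = Iid p +>\<^bsub>Yalg\<^esub> x"
      using Ytilde_rep[OF fg(1) pq] .
    obtain y where y: "y \<in> carrier Yalg" "g q = Iid q +>\<^bsub>Yalg\<^esub> y" "g p = Iid p +>\<^bsub>Yalg\<^esub> y"
      using Ytilde_rep[OF fg(2) pq] .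
    show "\<exists>z\<in>carrier Yalg. (f \<otimes>\<^bsub>?S\<^esub> g) q = Iid q +>\<^bsub>Yalg\<^esub> z \<and> (f \<otimes>\<^bsub>?S\<^esub> g) p = Iid p +>\<^bsub>Yalg\<^esub> z"
      using x y ring_hom_mult[OF coset_hom x(1) y(1)]
      by (intro bexI[of _ "x \<otimes>\<^bsub>Yalg\<^esub> y"]) (auto simp: Ytilde_def)
  qed
  have add: "f \<oplus>\<^bsub>?S\<^esub> g \<in> carrier ?S" if fg: "f \<in> carrier ?S" "g \<in> carrier ?S" for f g
  proof (rule mem)
    fix p q :: nat assume pq: "p \<le> q"
    obtain x where x: "x \<in> carrier Yalg" "f q = Iid q +>\<^bsub>Yalg\<^esub> x" "f p = Iid p +>\<^bsub>Yalg\<^esub> x"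
      using Ytilde_rep[OF fg(1) pq] .
    obtain y where y: "y \<in> carrier Yalg" "g q = Iid q +>\<^bsub>Yalg\<^esub> y" "g p = Iid p +>\<^bsub>Yalg\<^esub> y"
      using Ytilde_rep[OF fg(2) pq] .
    show "\<exists>z\<in>carrier Yalg. (f \<oplus>\<^bsub>?S\<^esub> g) q = Iid q +>\<^bsub>Yalg\<^esub> z \<and> (f \<oplus>\<^bsub>?S\<^esub> g) p = Iid p +>\<^bsub>Yalg\<^esub> z"
      using x y ring_hom_add[OF coset_hom x(1) y(1)]
      by (intro bexI[of _ "x \<oplus>\<^bsub>Yalg\<^esub> y"]) (auto simp: Ytilde_def)
  qed
  have neg: "\<exists>g\<in>carrier ?S. g \<oplus>\<^bsub>?S\<^esub> f = \<zero>\<^bsub>?S\<^esub>" if f: "f \<in> carrier ?S" for f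
  proof (rule bexI[of _ "\<lambda>p. \<ominus>\<^bsub>Yq p\<^esub> f p"])
    show "(\<lambda>p. \<ominus>\<^bsub>Yq p\<^esub> f p) \<oplus>\<^bsub>?S\<^esub> f = \<zero>\<^bsub>?S\<^esub>"
      using f by (auto simp: Ytilde_def Q.l_neg)
    show "(\<lambda>p. \<ominus>\<^bsub>Yq p\<^esub> f p) \<in> carrier ?S"
    proof (rule mem)
      fix p q :: nat assume pq: "p \<le> q"
      obtain x where x: "x \<in> carrier Yalg" "f q = Iid q +>\<^bsub>Yalg\<^esub> x" "f p = Iid p +>\<^bsub>Yalg\<^esub> x"
        using Ytilde_rep[OF f pq] .
      have "\<ominus>\<^bsub>Yq p\<^esub> (Iid p +>\<^bsub>Yalg\<^esub> x) = Iid p +>\<^bsub>Yalg\<^esub> (\<ominus>\<^bsub>Yalg\<^esub> x)" for p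
      proof -
        interpret H: ring_hom_ring "Yalg :: 'n falg set ring" "Yq p" "(+>\<^bsub>Yalg\<^esub>) (Iid p)"
          by (rule ring_hom_ringI2[OF ring_Yalg ring_Yq coset_hom])
        show ?thesis using H.abelian_group.hom_a_inv[OF x(1)] by simp
      qed
      then show "\<exists>z\<in>carrier Yalg. \<ominus>\<^bsub>Yq q\<^esub> f q = Iid q +>\<^bsub>Yalg\<^esub> z \<and> \<ominus>\<^bsub>Yq p\<^esub> f p = Iid p +>\<^bsub>Yalg\<^esub> z"
        using x by (intro bexI[of _ "\<ominus>\<^bsub>Yalg\<^esub> x"]) auto
    qed
  qed
  have c: "f p \<in> carrier (Yq p)" if "f \<in> carrier ?S" for f p using that by (simp add: S)
  have sel: "(f \<otimes>\<^bsub>?S\<^esub> g) = (\<lambda>p. f p \<otimes>\<^bsub>Yq p\<^esub> g p)" "(f \<oplus>\<^bsub>?S\<^esub> g) = (\<lambda>p. f p \<oplus>\<^bsub>Yq p\<^esub> g p)"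
    "\<one>\<^bsub>?S\<^esub> = (\<lambda>p. \<one>\<^bsub>Yq p\<^esub>)" "\<zero>\<^bsub>?S\<^esub> = (\<lambda>p. \<zero>\<^bsub>Yq p\<^esub>)" for f g
    by (simp_all add: Ytilde_def)
  show ?thesis
  proof (rule ringI)
    show "abelian_group ?S"
    proof (rule abelian_groupI)
      show "\<And>x. x \<in> carrier ?S \<Longrightarrow> \<exists>y\<in>carrier ?S. y \<oplus>\<^bsub>?S\<^esub> x = \<zero>\<^bsub>?S\<^esub>" by (rule neg)
    qed (use add zero in \<open>auto simp: sel c Q.a_ac fun_eq_iff\<close>)
    show "Group.monoid ?S"
      by (rule Group.monoid.intro) (use mult one in \<open>auto simp: sel c Q.m_assoc fun_eq_iff\<close>)
  qed (auto simp: sel c Q.l_distr Q.r_distr fun_eq_iff)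
qed

lemma Ytilde_eval_hom:
  "(\<lambda>f. f p) \<in> ring_hom (Ytilde :: 'n::{finite,linorder} ytilde ring) (Yq p)"
  by (rule ring_hom_memI) (auto simp: Ytilde_def)

lemma toYt_closed [simp]: "toYt x \<in> carrier (Ytilde :: 'n::{finite,linorder} ytilde ring)"
  by (auto simp: Ytilde_def toYt_def Yq_carrier dest: subsetD[OF Iid_coset_mono])

subsection \<open>Convergence of the coefficients of \<open>\<T>\<^sub>(\<^sub>n\<^sub>)(z)\<close>\<close>

lemma csum_closed:
  fixes F :: "'i \<Rightarrow> 'n::{finite,linorder} ytilde"
  assumes F: "\<And>i. i \<in> A \<Longrightarrow> F i \<in> carrier Ytilde" and sm: "csummable F A"
  shows "csum F A \<in> carrier Ytilde"
proof -
  interpret S: ring "Ytilde :: 'n ytilde ring" by (rule ring_Ytilde)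
  interpret Q: ring "Yq p :: 'n falg set set ring" for p by (rule ring_Yq)
  define supp where "supp = (\<lambda>p. {i \<in> A. F i p \<noteq> \<zero>\<^bsub>Yq p\<^esub>})"
  have fin: "finite (supp p)" for p using sm by (simp add: csummable_def supp_def)
  have Fp: "F i p \<in> carrier (Yq p)" if "i \<in> A" for i p using F[OF that] by (simp add: Ytilde_def)
  have mono: "supp p \<subseteq> supp q" if pq: "p \<le> q" for p q
  proof
    fix i assume i: "i \<in> supp p"
    show "i \<in> supp q"
    proof (rule ccontr)
      assume "i \<notin> supp q"
      with i have iA: "i \<in> A" and z: "F i q = \<zero>\<^bsub>Yq q\<^esub>" by (auto simp: supp_def)
      interpret Y: ring "Yalg :: 'n falg set ring" by (rule ring_Yalg)
      interpret Ip: ideal "Iid p" "Yalg :: 'n falg set ring" by (rule ideal_Iid)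
      interpret Iq: ideal "Iid q" "Yalg :: 'n falg set ring" by (rule ideal_Iid)
      obtain x where x: "x \<in> carrier Yalg" "F i q = Iid q +>\<^bsub>Yalg\<^esub> x" "F i p = Iid p +>\<^bsub>Yalg\<^esub> x"
        using Ytilde_rep[OF F[OF iA] pq] .
      have "x \<in> Iid q +>\<^bsub>Yalg\<^esub> x" using x(1) by (rule Iq.a_rcos_self)
      then have "x \<in> Iid q" using x(2) z by (simp add: Yq_def FactRing_def)
      then have "x \<in> Iid p" using Iid_antimono[OF pq] by blast
      then have "F i p = \<zero>\<^bsub>Yq p\<^esub>"
        using x(3) Ip.a_rcos_const by (simp add: Yq_def FactRing_def)
      with i show False by (simp add: supp_def)
    qed
  qed
  have ev: "finsum Ytilde F B p = finsum (Yq p) (\<lambda>i. F i p) B" if "finite B" "B \<subseteq> A" for B p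
    using that
  proof (induction B)
    case empty
    have "finsum Ytilde F {} = \<zero>\<^bsub>Ytilde\<^esub>" by simp
    then show ?case by (simp only:) (simp add: Ytilde_def)
  next
    case (insert i B)
    then have "finsum Ytilde F (insert i B) = F i \<oplus>\<^bsub>Ytilde\<^esub> finsum Ytilde F B"
      using F by (intro S.finsum_insert) auto
    moreover have "finsum (Yq p) (\<lambda>i. F i p) (insert i B) = F i p \<oplus>\<^bsub>Yq p\<^esub> finsum (Yq p) (\<lambda>i. F i p) B"
      using insert Fp by (intro Q.finsum_insert) auto
    ultimately show ?case using insert by (simp add: Ytilde_def)
  qed
  have at: "csum F A p = finsum Ytilde F (supp q) p" if pq: "p \<le> q" for p q
  proof -
    have "csum F A p = finsum (Yq p) (\<lambda>i. F i p) (supp p)" by (simp add: csum_def supp_def)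
    also have "\<dots> = finsum (Yq p) (\<lambda>i. F i p) (supp q)"
      using mono[OF pq] fin Fp by (intro Q.add.finprod_mono_neutral_cong_left) (auto simp: supp_def)
    also have "\<dots> = finsum Ytilde F (supp q) p" using ev[of "supp q"] fin by (auto simp: supp_def)
    finally show ?thesis .
  qed
  have cl: "finsum Ytilde F (supp q) \<in> carrier Ytilde" for q
    using F by (intro S.finsum_closed) (auto simp: supp_def)
  show ?thesis
    unfolding Ytilde_def
  proof (simp, intro conjI allI impI)
    fix p show "csum F A p \<in> carrier (Yq p)" using at[of p p] cl[of p] by (simp add: Ytilde_def)
  next
    fix p q :: nat assume pq: "p \<le> q"
    show "csum F A q \<subseteq> csum F A p" using at[OF pq] at[of q q] cl[of q] pq by (simp add: Ytilde_def)
  qed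
qed

lemma T_copy_closed: "T_copy n k a I J \<in> carrier (Ytilde :: 'n::{finite,linorder} ytilde ring)"
proof -
  interpret S: ring "Ytilde :: 'n ytilde ring" by (rule ring_Ytilde)
  show ?thesis by (simp add: T_copy_def)
qed

lemma T_copy_zero:
  assumes "a > int p"
  shows "T_copy n k a I J p = \<zero>\<^bsub>Yq p :: 'n::{finite,linorder} falg set set ring\<^esub>"
proof -
  interpret Y: ring "Yalg :: 'n falg set ring" by (rule ring_Yalg)
  interpret Q: ring "Yq p :: 'n falg set set ring" by (rule ring_Yq)
  interpret Ip: ideal "Iid p" "Yalg :: 'n falg set ring" by (rule ideal_Iid)
  have "toY (tauF i j (- a)) \<in> Iid p" for i j :: 'n
  proof -
    have "{toY (scalF (fps_X ^ (p + 1)))} \<union> {toY (tauF i j (- r)) | i j r. r > int p} \<subseteq> (Iid p :: 'n falg set set)"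
      unfolding Iid_def by (rule Y.genideal_self) auto
    then show ?thesis using assms by blast
  qed
  then have "tau i j (- a) p = \<zero>\<^bsub>Yq p\<^esub>" for i j :: 'n
    by (simp add: toYt_def Yq_def FactRing_def Ip.a_rcos_const)
  moreover have "scal c p \<in> carrier (Yq p :: 'n falg set set ring)" for c
    using toYt_closed[of "scalF c :: 'n falg"] unfolding Ytilde_def by simp
  ultimately show ?thesis by (simp add: T_copy_def Ytilde_def)
qed

lemma mat_mult_closed:
  fixes A B :: "'n::finite list \<Rightarrow> 'n list \<Rightarrow> 'a"
  assumes "ring R" "\<And>I J. A I J \<in> carrier R" "\<And>I J. B I J \<in> carrier R"
  shows "mat_mult R n A B I J \<in> carrier R"
proof -
  interpret ring R by fact
  show ?thesis unfolding mat_mult_def using assms(2,3) by (intro finsum_closed) auto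
qed

lemma T_term_closed_aux:
  "foldr (\<lambda>k. mat_mult Ytilde n (T_copy n k (as ! k))) ks (mat_one Ytilde n) I J
     \<in> carrier (Ytilde :: 'n::{finite,linorder} ytilde ring)"
proof (induction ks arbitrary: I J)
  case Nil
  interpret S: ring "Ytilde :: 'n ytilde ring" by (rule ring_Ytilde)
  show ?case by (simp add: mat_one_def)
next
  case (Cons k ks)
  then show ?case by (auto intro!: mat_mult_closed ring_Ytilde T_copy_closed)
qed

lemma T_term_closed: "T_term n as I J \<in> carrier (Ytilde :: 'n::{finite,linorder} ytilde ring)"
  unfolding T_term_def by (rule T_term_closed_aux)

lemma Ytilde_finsum_zero:
  fixes F :: "'i \<Rightarrow> 'n::{finite,linorder} ytilde"
  assumes "finite A" "\<And>i. i \<in> A \<Longrightarrow> F i \<in> carrier Ytilde" "\<And>i. i \<in> A \<Longrightarrow> F i p = \<zero>\<^bsub>Yq p\<^esub>"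
  shows "finsum Ytilde F A p = \<zero>\<^bsub>Yq p\<^esub>"
  using assms
proof (induction A)
  case empty
  interpret S: ring "Ytilde :: 'n ytilde ring" by (rule ring_Ytilde)
  have "finsum Ytilde F {} = \<zero>\<^bsub>Ytilde\<^esub>" by simp
  then show ?case by (simp only:) (simp add: Ytilde_def)
next
  case (insert i B)
  interpret S: ring "Ytilde :: 'n ytilde ring" by (rule ring_Ytilde)
  interpret Q: ring "Yq p :: 'n falg set set ring" by (rule ring_Yq)
  have "finsum Ytilde F (insert i B) = F i \<oplus>\<^bsub>Ytilde\<^esub> finsum Ytilde F B"
    using insert by (intro S.finsum_insert) auto
  then show ?case using insert by (simp add: Ytilde_def)
qed

lemma T_term_zero:
  assumes "k < n" "as ! k > int p"
  shows "T_term n as I J p = \<zero>\<^bsub>Yq p :: 'n::{finite,linorder} falg set set ring\<^esub>"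
proof -
  interpret S: ring "Ytilde :: 'n ytilde ring" by (rule ring_Ytilde)
  interpret Q: ring "Yq p :: 'n falg set set ring" by (rule ring_Yq)
  define M :: "nat list \<Rightarrow> 'n list \<Rightarrow> 'n list \<Rightarrow> 'n ytilde" where
    "M = (\<lambda>ks. foldr (\<lambda>k. mat_mult Ytilde n (T_copy n k (as ! k))) ks (mat_one Ytilde n))"
  have Mc: "M ks I J \<in> carrier Ytilde" for ks I J unfolding M_def by (rule T_term_closed_aux)
  have Mq: "M ks I J p \<in> carrier (Yq p)" for ks I J using Mc[of ks I J] unfolding Ytilde_def by simp
  have Tq: "T_copy n l a I J p \<in> carrier (Yq p :: 'n falg set set ring)" for l a I J
    using T_copy_closed[of n l a I J] unfolding Ytilde_def by simp
  have "k \<in> set ks \<Longrightarrow> M ks I J p = \<zero>\<^bsub>Yq p\<^esub>" for ks I J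
  proof (induction ks arbitrary: I J)
    case (Cons l ks)
    have "(T_copy n l (as ! l) I K \<otimes>\<^bsub>Ytilde\<^esub> M ks K J) p = \<zero>\<^bsub>Yq p\<^esub>" for K
    proof (cases "l = k")
      case True
      then show ?thesis using assms(2) Mq by (simp add: Ytilde_def T_copy_zero)
    next
      case False
      then have "M ks K J p = \<zero>\<^bsub>Yq p\<^esub>" using Cons by simp
      then show ?thesis using Tq by (simp add: Ytilde_def)
    qed
    moreover have "M (l # ks) I J = finsum Ytilde (\<lambda>K. T_copy n l (as ! l) I K \<otimes>\<^bsub>Ytilde\<^esub> M ks K J) (idx n)"
      by (simp add: M_def mat_mult_def)
    ultimately show ?case
      by (simp add: Ytilde_finsum_zero Mc T_copy_closed)
  qed simp
  then show ?thesis using assms by (simp add: T_term_def M_def)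
qed

lemma T_prod_summable:
  "csummable (\<lambda>as. T_term n as I J :: 'n::{finite,linorder} ytilde) {as. length as = n \<and> sum_list as = a}"
  unfolding csummable_def
proof
  fix p :: nat
  let ?lo = "a - int n * int p"
  have "{as \<in> {as. length as = n \<and> sum_list as = a}. T_term n as I J p \<noteq> \<zero>\<^bsub>Yq p :: 'n falg set set ring\<^esub>}
      \<subseteq> {as. set as \<subseteq> {?lo..int p} \<and> length as = n}"
  proof
    fix as
    assume "as \<in> {as \<in> {as. length as = n \<and> sum_list as = a}. T_term n as I J p \<noteq> \<zero>\<^bsub>Yq p :: 'n falg set set ring\<^esub>}"
    then have as: "length as = n" "sum_list as = a" and nz: "T_term n as I J p \<noteq> \<zero>\<^bsub>Yq p :: 'n falg set set ring\<^esub>"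
      by auto
    have le: "as ! k \<le> int p" if "k < n" for k
      using T_term_zero[OF that, of p as I J] nz by fastforce
    have "set as \<subseteq> {?lo..int p}"
    proof
      fix x assume "x \<in> set as"
      then obtain k where k: "k < n" "x = as ! k" using as by (auto simp: in_set_conv_nth)
      have "a = (\<Sum>i<n. as ! i)" using as by (simp add: sum_list_sum_nth atLeast0LessThan)
      also have "\<dots> = as ! k + (\<Sum>i\<in>{..<n} - {k}. as ! i)" using k by (simp add: sum.remove)
      also have "(\<Sum>i\<in>{..<n} - {k}. as ! i) \<le> (\<Sum>i\<in>{..<n} - {k}. int p)"
        using le by (intro sum_mono) auto
      also have "\<dots> \<le> int n * int p"
        using k by (simp add: mult_right_mono)
      finally show "x \<in> {?lo..int p}" using k le by auto
    qed
    with as show "as \<in> {as. set as \<subseteq> {?lo..int p} \<and> length as = n}" by simp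
  qed
  then show "finite {as \<in> {as. length as = n \<and> sum_list as = a}. T_term n as I J p \<noteq> \<zero>\<^bsub>Yq p :: 'n falg set set ring\<^esub>}"
    by (rule finite_subset) (rule finite_lists_length_eq, simp)
qed

theorem Tn_closed: "Tn n a \<in> carrier (Ytilde :: 'n::{finite,linorder} ytilde ring)"
proof -
  interpret S: ring "Ytilde :: 'n ytilde ring" by (rule ring_Ytilde)
  have "T_prod n a I J \<in> carrier (Ytilde :: 'n ytilde ring)" for I J
    unfolding T_prod_def by (rule csum_closed[OF T_term_closed T_prod_summable])
  then show ?thesis unfolding Tn_def by (intro S.finsum_closed) auto
qed

end

theory Submission
  imports Defs "HOL-Computational_Algebra.Formal_Laurent_Series"
begin

text \<open>Modulo \<open>I\<^sub>p\<close> the series \<open>\<T>(x)\<close> has only finitely many positive powers of \<open>x\<close>, so it is a Laurent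
  series in \<open>x\<^sup>-\<^sup>1\<close> and all products below make sense. Put \<open>q = e\<^sup>h\<close>, \<open>s = e\<^bsup>h/2\<^esup>\<close>, let \<open>P\<close> be the flip of
  two tensor factors and \<open>Q\<close> the operator \<open>P\<^sup>h\<close>. Then
  \<open>\<R>(x, y) = (x - y) (1 - Q) + s\<^sup>-\<^sup>1 (x - q y) P\<close>, and this formula governs the whole proof.

  Fusion. At \<open>x = q y\<close> only \<open>(q - 1) y (1 - Q)\<close> remains of \<open>\<R>\<close>. Its factor \<open>q - 1\<close> is a multiple of \<open>h\<close>
  and cannot be cancelled in the algebra. But the second summand contributes
  \<open>(\<T>\<^sub>2(x) \<T>\<^sub>1(y) - \<T>\<^sub>2(y) \<T>\<^sub>1(x)) P\<close> to the RTT relation, which is antisymmetric in \<open>x\<close> and \<open>y\<close> and hence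
  divisible by \<open>x - y\<close>. After division by \<open>x - y\<close> the substitution \<open>x = q y\<close> is harmless and gives
  \<open>(1 - Q) \<T>\<^sub>1(z) \<T>\<^sub>2(z q\<^sup>-\<^sup>1) = \<T>\<^sub>2(z q\<^sup>-\<^sup>1) \<T>\<^sub>1(z) (1 - Q)\<close> (\<open>fusion_op\<close>). Since \<open>Q\<^sup>2 = 1\<close>, multiplication by
  \<open>1 + Q\<close> shows that \<open>A \<T>\<^sub>1(z) \<cdots> \<T>\<^sub>n(z q\<^bsup>-(n-1)\<^esup>)\<close> is unchanged if the antisymmetrizer \<open>A\<close> is also put on
  its right (\<open>absorbs_fusion\<close>). The R-matrix fuses in the same way (\<open>fusion_identities\<close>), and so does
  its inverse up to a factor, which is the same R-matrix with \<open>s\<close> and \<open>s\<^sup>-\<^sup>1\<close> exchanged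
  (\<open>unitarity_identities\<close>).

  Commutation. Take \<open>n + m\<close> sites, let \<open>T\<close> be the fused product with parameter \<open>x\<close> on the first \<open>n\<close> of
  them and \<open>V\<close> the one with parameter \<open>y\<close> on the other \<open>m\<close>, and let \<open>D\<close> be the product of both
  antisymmetrizers. The product \<open>R\<close> of all R-matrices between the two groups satisfies
  \<open>R T V = V T R\<close>, and with \<open>R' R = R R' = F\<close>, a central factor,
  \<open>F tr D T V = tr D R' R T V = tr D R' V T R = tr D R' D V T D R D = tr D R D R' D V T = F tr D V T\<close>
  (\<open>commute_mod_trace\<close>). Only \<open>R\<close> and \<open>D\<close>, which have central entries, are moved around the trace. The
  factor \<open>F\<close> is a product of terms \<open>x - c y\<close> with invertible constants \<open>c\<close>, and these can be cancelled
  because the powers of \<open>x\<close> are bounded above (\<open>NN_cancel\<close>). Finally the traces factorize into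
  \<open>\<T>\<^sub>(\<^sub>n\<^sub>)(x) \<T>\<^sub>(\<^sub>m\<^sub>)(y)\<close> and \<open>\<T>\<^sub>(\<^sub>m\<^sub>)(y) \<T>\<^sub>(\<^sub>n\<^sub>)(x)\<close> (\<open>Tr_emb_emb\<close>).

  The quotients by \<open>I\<^sub>p\<close> are not types. So all calculations take place in the free algebra, or in matrices and
  Laurent series over it, modulo the ideal \<open>redI p\<close> of the elements that vanish in \<open>Y/I\<^sub>p\<close>, with the generators that
  lie in this ideal because of their exponent replaced by \<open>0\<close>.\<close>

section \<open>Row-finite matrices\<close>

text \<open>Operators on infinitely many tensor sites are matrices indexed by configurations \<open>nat \<Rightarrow> 'n\<close>. Row-finiteness
  is what makes their products finite sums, and with it they form a ring in the sense of the type classes.\<close>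

typedef (overloaded) ('i, 'a::zero) rfmat = "{M :: 'i \<Rightarrow> 'i \<Rightarrow> 'a. \<forall>i. finite {j. M i j \<noteq> 0}}"
  morphisms ent Rfmat
  by (intro exI[of _ "\<lambda>_ _. 0"]) auto

setup_lifting type_definition_rfmat

lemma finite_row: "finite {j. ent A i j \<noteq> 0}"
  using ent[of A] by auto

lemma rfmat_eqI: "(\<And>i j. ent A i j = ent B i j) \<Longrightarrow> A = B"
  by (metis ent_inject ext)

instantiation rfmat :: (type, ab_group_add) ab_group_add
begin
lift_definition zero_rfmat :: "('a, 'b) rfmat" is "\<lambda>_ _. 0" by simp
lift_definition plus_rfmat :: "('a, 'b) rfmat \<Rightarrow> ('a, 'b) rfmat \<Rightarrow> ('a, 'b) rfmat"
  is "\<lambda>A B i j. A i j + B i j"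
proof -
  fix A B :: "'a \<Rightarrow> 'a \<Rightarrow> 'b" and i
  assume "\<And>i. finite {j. A i j \<noteq> 0}" "\<And>i. finite {j. B i j \<noteq> 0}"
  then have "finite ({j. A i j \<noteq> 0} \<union> {j. B i j \<noteq> 0})" by blast
  then show "finite {j. A i j + B i j \<noteq> 0}" by (rule rev_finite_subset) auto
qed
lift_definition uminus_rfmat :: "('a, 'b) rfmat \<Rightarrow> ('a, 'b) rfmat" is "\<lambda>A i j. - A i j" by simp
lift_definition minus_rfmat :: "('a, 'b) rfmat \<Rightarrow> ('a, 'b) rfmat \<Rightarrow> ('a, 'b) rfmat"
  is "\<lambda>A B i j. A i j - B i j"
proof -
  fix A B :: "'a \<Rightarrow> 'a \<Rightarrow> 'b" and i
  assume "\<And>i. finite {j. A i j \<noteq> 0}" "\<And>i. finite {j. B i j \<noteq> 0}"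
  then have "finite ({j. A i j \<noteq> 0} \<union> {j. B i j \<noteq> 0})" by blast
  then show "finite {j. A i j - B i j \<noteq> 0}" by (rule rev_finite_subset) auto
qed
instance
  by standard (transfer; simp add: fun_eq_iff algebra_simps)+
end

lemmas ent_linear [simp] = zero_rfmat.rep_eq plus_rfmat.rep_eq uminus_rfmat.rep_eq minus_rfmat.rep_eq

lemma ent_sum [simp]: "ent (\<Sum>x\<in>S. F x) i j = (\<Sum>x\<in>S. ent (F x) i j)"
  by (induction S rule: infinite_finite_induct) auto

instantiation rfmat :: (type, ring_1) ring_1
begin
lift_definition one_rfmat :: "('a, 'b) rfmat" is "\<lambda>i j. if j = i then 1 else 0" by simp
lift_definition times_rfmat :: "('a, 'b) rfmat \<Rightarrow> ('a, 'b) rfmat \<Rightarrow> ('a, 'b) rfmat"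
  is "\<lambda>A B i j. \<Sum>k | A i k \<noteq> 0. A i k * B k j"
proof -
  fix A B :: "'a \<Rightarrow> 'a \<Rightarrow> 'b" and i
  assume fin: "\<And>i. finite {j. A i j \<noteq> 0}" "\<And>i. finite {j. B i j \<noteq> 0}"
  then have "finite (\<Union>k\<in>{k. A i k \<noteq> 0}. {j. B k j \<noteq> 0})" by blast
  then show "finite {j. (\<Sum>k | A i k \<noteq> 0. A i k * B k j) \<noteq> 0}"
  proof (rule rev_finite_subset, intro subsetI)
    fix j assume "j \<in> {j. (\<Sum>k | A i k \<noteq> 0. A i k * B k j) \<noteq> 0}"
    then obtain k where "A i k \<noteq> 0" "A i k * B k j \<noteq> 0"
      by (metis (mono_tags, lifting) mem_Collect_eq sum.not_neutral_contains_not_neutral)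
    then show "j \<in> (\<Union>k\<in>{k. A i k \<noteq> 0}. {j. B k j \<noteq> 0})" by auto
  qed
qed

lemma ent_times_superset:
  assumes "finite S" "{k. ent A i k \<noteq> 0} \<subseteq> S"
  shows "ent (A * B) i j = (\<Sum>k\<in>S. ent A i k * ent B k j)"
  unfolding times_rfmat.rep_eq using assms by (intro sum.mono_neutral_left) auto

instance
proof
  fix A B C :: "('a, 'b) rfmat"
  show "A * B * C = A * (B * C)"
  proof (rule rfmat_eqI)
    fix i l
    define S where "S = {k. ent A i k \<noteq> 0}"
    define T where "T = (\<Union>k\<in>S. {j. ent B k j \<noteq> 0})"
    have fin: "finite S" "finite T" by (auto simp: S_def T_def finite_row)
    have AB: "ent (A * B) i j = (\<Sum>k\<in>S. ent A i k * ent B k j)" for j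
      by (rule ent_times_superset) (use fin S_def in auto)
    have "{j. ent (A * B) i j \<noteq> 0} \<subseteq> T"
    proof
      fix j assume "j \<in> {j. ent (A * B) i j \<noteq> 0}"
      then have "(\<Sum>k\<in>S. ent A i k * ent B k j) \<noteq> 0" by (simp add: AB)
      then obtain k where "k \<in> S" "ent A i k * ent B k j \<noteq> 0"
        by (rule sum.not_neutral_contains_not_neutral)
      moreover from this have "ent B k j \<noteq> 0" by auto
      ultimately show "j \<in> T" by (auto simp: T_def)
    qed
    then have "ent (A * B * C) i l = (\<Sum>j\<in>T. (\<Sum>k\<in>S. ent A i k * ent B k j) * ent C j l)"
      using ent_times_superset[OF fin(2), of "A * B" i C l] by (simp add: AB)
    also have "\<dots> = (\<Sum>k\<in>S. \<Sum>j\<in>T. ent A i k * (ent B k j * ent C j l))"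
      unfolding sum_distrib_right mult.assoc by (rule sum.swap)
    also have "\<dots> = (\<Sum>k\<in>S. ent A i k * ent (B * C) k l)"
    proof (intro sum.cong refl)
      fix k assume "k \<in> S"
      then have "ent (B * C) k l = (\<Sum>j\<in>T. ent B k j * ent C j l)"
        using fin by (intro ent_times_superset) (auto simp: T_def)
      then show "(\<Sum>j\<in>T. ent A i k * (ent B k j * ent C j l)) = ent A i k * ent (B * C) k l"
        by (simp add: sum_distrib_left)
    qed
    also have "\<dots> = ent (A * (B * C)) i l"
      by (rule ent_times_superset[symmetric]) (use fin S_def in auto)
    finally show "ent (A * B * C) i l = ent (A * (B * C)) i l" .
  qed
  show "(A + B) * C = A * C + B * C"
  proof (rule rfmat_eqI)
    fix i j
    define S where "S = {k. ent A i k \<noteq> 0} \<union> {k. ent B i k \<noteq> 0}"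
    have "finite S" by (simp add: S_def finite_row)
    then have "ent (X * C) i j = (\<Sum>k\<in>S. ent X i k * ent C k j)" if "X \<in> {A, B, A + B}" for X
      using that by (intro ent_times_superset) (auto simp: S_def)
    then show "ent ((A + B) * C) i j = ent (A * C + B * C) i j"
      by (simp add: distrib_right sum.distrib)
  qed
  show "A * (B + C) = A * B + A * C"
    by (rule rfmat_eqI) (simp add: times_rfmat.rep_eq distrib_left sum.distrib)
  show "1 * A = A"
    by (rule rfmat_eqI, subst ent_times_superset[of "{i}" for i]) (auto simp: one_rfmat.rep_eq)
  show "A * 1 = A"
    by (rule rfmat_eqI) (simp add: times_rfmat.rep_eq one_rfmat.rep_eq finite_row if_distrib cong: if_cong)
  show "(0 :: ('a, 'b) rfmat) \<noteq> 1"
    by transfer (auto simp: fun_eq_iff)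
qed
end

lemma ent_one: "ent 1 i j = (if j = i then 1 else 0)"
  by (rule one_rfmat.rep_eq[THEN fun_cong, THEN fun_cong])

subsection \<open>Monomial matrices\<close>

lift_definition monomial :: "('i \<Rightarrow> 'a::zero) \<Rightarrow> ('i \<Rightarrow> 'i) \<Rightarrow> ('i, 'a) rfmat"
  is "\<lambda>c \<sigma> i j. if j = \<sigma> i then c i else 0"
  by simp

lemma ent_monomial: "ent (monomial c \<sigma>) i j = (if j = \<sigma> i then c i else 0)"
  by (rule monomial.rep_eq[THEN fun_cong, THEN fun_cong])

lemma ent_monomial_times [simp]: "ent (monomial c \<sigma> * B) i j = c i * ent B (\<sigma> i) j"
  by (subst ent_times_superset[of "{\<sigma> i}"]) (auto simp: ent_monomial)

lemma ent_times_monomial: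
  assumes "\<And>i. \<sigma> (\<sigma> i) = i"
  shows "ent (B * monomial c \<sigma>) i j = ent B i (\<sigma> j) * c (\<sigma> j)"
proof -
  have "j = \<sigma> k \<longleftrightarrow> k = \<sigma> j" for k using assms by metis
  then have "ent (B * monomial c \<sigma>) i j = (\<Sum>k | ent B i k \<noteq> 0. if k = \<sigma> j then ent B i (\<sigma> j) * c (\<sigma> j) else 0)"
    unfolding times_rfmat.rep_eq by (intro sum.cong) (auto simp: ent_monomial)
  then show ?thesis by (auto simp: finite_row)
qed

lemma monomial_mult_monomial: "monomial c \<sigma> * monomial d \<tau> = monomial (\<lambda>i. c i * d (\<sigma> i)) (\<tau> \<circ> \<sigma>)"
  by (rule rfmat_eqI) (simp add: ent_monomial)

text \<open>The image of the coefficient ring in the matrix ring; central if \<open>c\<close> is.\<close>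

definition scalar :: "'a::ring_1 \<Rightarrow> ('i, 'a) rfmat"
  where "scalar c = monomial (\<lambda>_. c) id"

lemma ent_scalar_times [simp]: "ent (scalar c * B) i j = c * ent B i j"
  by (simp add: scalar_def)

lemma ent_times_scalar [simp]: "ent (B * scalar c) i j = ent B i j * c"
  by (simp add: scalar_def ent_times_monomial)

lemma scalar_1 [simp]: "scalar 1 = 1" and scalar_0 [simp]: "scalar 0 = 0"
  and scalar_add: "scalar (a + b) = scalar a + scalar b" and scalar_mult: "scalar (a * b) = scalar a * scalar b"
  and scalar_minus: "scalar (- a) = - scalar a"
  by (rule rfmat_eqI; simp add: scalar_def ent_monomial ent_one)+

section \<open>Operators on tensor sites\<close>

definition swap_sites :: "nat \<Rightarrow> nat \<Rightarrow> (nat \<Rightarrow> 'n) \<Rightarrow> nat \<Rightarrow> 'n"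
  where "swap_sites k l f = f(k := f l, l := f k)"

lemma swap_sites_twice [simp]: "swap_sites k l (swap_sites k l f) = f"
  by (auto simp: swap_sites_def)

lemma swap_sites_commute: "swap_sites k l = swap_sites l k"
  by (auto simp: swap_sites_def fun_eq_iff)

lemma swap_sites_disjoint:
  assumes "k \<notin> {i, j}" "l \<notin> {i, j}"
  shows "swap_sites k l (swap_sites i j f) = swap_sites i j (swap_sites k l f)"
  using assms by (auto simp: swap_sites_def fun_eq_iff)

text \<open>Sites are numbered by all natural numbers, so that no operator has to be told how many sites there are.\<close>

type_synonym ('n, 'a) op = "(nat \<Rightarrow> 'n, 'a) rfmat"

definition flip :: "nat \<Rightarrow> nat \<Rightarrow> ('n, 'a::ring_1) op"
  where "flip k l = monomial (\<lambda>_. 1) (swap_sites k l)"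

text \<open>The matrix coefficients of \<open>P\<^sup>h\<close>, with \<open>s\<close> and \<open>s'\<close> in place of \<open>e\<^bsup>h/2\<^esup>\<close> and \<open>e\<^bsup>-h/2\<^esup>\<close>.\<close>

definition qcoeff :: "'a::ring_1 \<Rightarrow> 'a \<Rightarrow> 'n::linorder \<Rightarrow> 'n \<Rightarrow> 'a"
  where "qcoeff s s' i j = (if i = j then 1 else if j < i then s else s')"

definition qflip :: "'a \<Rightarrow> 'a \<Rightarrow> nat \<Rightarrow> nat \<Rightarrow> ('n::linorder, 'a::ring_1) op"
  where "qflip s s' k l = monomial (\<lambda>f. qcoeff s s' (f k) (f l)) (swap_sites k l)"

text \<open>On the sites \<open>k\<close> and \<open>l\<close> the R-matrix is \<open>x U - y W\<close>, where \<open>U\<close> and \<open>W\<close> are the cases \<open>c = s'\<close> and \<open>c = s\<close>.\<close>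

definition Rop :: "'a \<Rightarrow> 'a \<Rightarrow> 'a \<Rightarrow> nat \<Rightarrow> nat \<Rightarrow> ('n::linorder, 'a::ring_1) op"
  where "Rop s s' c k l = 1 - qflip s s' k l + scalar c * flip k l"

lemma ent_flip_times [simp]: "ent (flip k l * B) f g = ent B (swap_sites k l f) g"
  by (simp add: flip_def)

lemma ent_qflip_times [simp]:
  "ent (qflip s s' k l * B) f g = qcoeff s s' (f k) (f l) * ent B (swap_sites k l f) g"
  by (simp add: qflip_def)

lemma ent_Rop_times:
  "ent (Rop s s' c k l * B) f g = ent B f g + (c - qcoeff s s' (f k) (f l)) * ent B (swap_sites k l f) g"
  by (simp add: Rop_def distrib_right left_diff_distrib mult.assoc)

lemma ent_times_flip [simp]: "ent (B * flip k l) f g = ent B f (swap_sites k l g)"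
  by (simp add: flip_def ent_times_monomial)

lemma ent_times_qflip [simp]:
  "ent (B * qflip s s' k l) f g = ent B f (swap_sites k l g) * qcoeff s s' (g l) (g k)"
  by (auto simp add: qflip_def ent_times_monomial swap_sites_def qcoeff_def)

lemma ent_times_Rop:
  "ent (B * Rop s s' c k l) f g = ent B f g + (ent B f (swap_sites k l g) * (c - qcoeff s s' (g l) (g k)))"
proof -
  have "B * (scalar c * flip k l) = B * scalar c * flip k l" by (simp add: mult.assoc)
  then show ?thesis by (simp add: Rop_def distrib_left right_diff_distrib)
qed

text \<open>Reading the two sites in the other order inverts \<open>s\<close>. This symmetry turns every identity for the R-matrix into
  one for its inverse and for its second tensor factor.\<close>

lemma qflip_commute: "qflip s s' l k = (qflip s' s k l :: ('n::linorder, 'a::ring_1) op)"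
proof -
  have "qcoeff s s' i j = qcoeff s' s j i" for i j :: 'n by (auto simp: qcoeff_def)
  then show ?thesis unfolding qflip_def by (simp add: swap_sites_commute[of l k])
qed

lemma flip_commute: "flip l k = flip k l"
  by (simp add: flip_def swap_sites_commute)

lemma Rop_commute: "Rop s s' c l k = Rop s' s c k l"
  by (simp add: Rop_def qflip_commute[of s s' l k] flip_commute[of l k])

subsection \<open>Identities\<close>

lemma trichotomy:
  obtains "x < y" "\<not> y < x" "x \<noteq> y" "y \<noteq> x" | "x = y" | "y < x" "\<not> x < y" "x \<noteq> y" "y \<noteq> (x :: 'a::linorder)"
  by (cases x y rule: linorder_cases) auto

locale sqrt_q =
  fixes s s' :: "'a::ring_1"
  assumes ss' [simp]: "s * s' = 1" and s's [simp]: "s' * s = 1"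
    and central_s: "s * a = a * s" and central_s': "s' * a = a * s'"
begin

lemma ss'_left [simp]: "s * (s' * a) = a" "s' * (s * a) = a"
  by (simp_all flip: mult.assoc)

abbreviation Q :: "nat \<Rightarrow> nat \<Rightarrow> ('n::linorder, 'a) op" where "Q \<equiv> qflip s s'"
abbreviation U :: "nat \<Rightarrow> nat \<Rightarrow> ('n::linorder, 'a) op" where "U \<equiv> Rop s s' s'"
abbreviation W :: "nat \<Rightarrow> nat \<Rightarrow> ('n::linorder, 'a) op" where "W \<equiv> Rop s s' s"

lemma qcoeff_central: "qcoeff s s' i j * a = a * qcoeff s s' i j"
  by (simp add: qcoeff_def central_s central_s')

lemma Q_Q: "Q k l * Q k l = (1 :: ('n::linorder, 'a) op)"
proof (rule rfmat_eqI)
  fix f g :: "nat \<Rightarrow> 'n"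
  have "ent (Q k l * (Q k l * 1)) f g = ent 1 f g"
    by (simp only: ent_qflip_times swap_sites_twice) (auto simp: swap_sites_def qcoeff_def)
  then show "ent (Q k l * Q k l) f g = ent 1 f g" by simp
qed

text \<open>These are the coefficients of \<open>x\<^sup>2\<close>, \<open>y\<^sup>2\<close> and \<open>- x y\<close> in
  \<open>(1 - Q\<^sub>k\<^sub>l) R\<^sub>k\<^sub>r(x, y) R\<^sub>l\<^sub>r(x s\<^sup>-\<^sup>2, y) (1 + Q\<^sub>k\<^sub>l) = 0\<close>, up to powers of \<open>s\<close>. All factors only permute the three
  values \<open>a, b, c\<close> of the row index at the sites \<open>k, l, r\<close>, with coefficients that depend on the order of these
  values. So for each order of \<open>a, b, c\<close> a linear combination of six entries has to vanish.\<close>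

lemma fusion_identities:
  fixes k l r :: nat
  assumes kl: "k \<noteq> l" "k \<noteq> r" "l \<noteq> r"
  defines "F \<equiv> \<lambda>A B. (1 - Q k l) * (A k r * (B l r * (1 + Q k l))) :: ('n::linorder, 'a) op"
  shows "F U U = 0" and "F W W = 0" and "F U W + scalar (s' * s') * F W U = 0"
proof -
  have "ent (F U U) f g = 0 \<and> ent (F W W) f g = 0 \<and> ent (F U W + scalar (s' * s') * F W U) f g = 0" for f g
  proof -
    define V where "V = (\<lambda>a b c. f(k := a, l := b, r := c))"
    define E where "E = (\<lambda>a b c. ent 1 (V a b c) g :: 'a)"
    have E: "ent 1 (V a b c) g = E a b c" for a b c by (simp add: E_def)
    have V: "f = V (f k) (f l) (f r)" "V a b c k = a" "V a b c l = b" "V a b c r = c"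
      "swap_sites k l (V a b c) = V b a c" "swap_sites k r (V a b c) = V c b a" "swap_sites l r (V a b c) = V a c b" for a b c
      using kl by (auto simp: V_def swap_sites_def fun_eq_iff)
    \<comment> \<open>\<open>V a b c\<close> is the configuration with values \<open>a\<close>, \<open>b\<close>, \<open>c\<close> at the three sites.\<close>
    obtain a b c where f: "f = V a b c" using V(1) by blast
    have split: "(1 - Q k l) * B = B - Q k l * B" "1 + Q k l = 1 + Q k l * 1" for B :: "('n, 'a) op"
      by (simp_all add: left_diff_distrib)
    show ?thesis
      unfolding f F_def split
      apply (simp only: ent_linear ent_scalar_times ent_Rop_times ent_qflip_times V E)
      apply (cases a b rule: trichotomy; cases b c rule: trichotomy; cases a c rule: trichotomy;
        (order | (simp add: qcoeff_def algebra_simps)))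
      done
  qed
  then show "F U U = 0" "F W W = 0" "F U W + scalar (s' * s') * F W U = 0"
    by (auto intro!: rfmat_eqI)
qed

text \<open>The coefficients of \<open>x\<^sup>2\<close>, \<open>y\<^sup>2\<close> and \<open>- x y\<close> in
  \<open>R(x, y; s) R(x, y; s\<^sup>-\<^sup>1) = (x - s\<^sup>2 y) (x - s\<^sup>-\<^sup>2 y)\<close>. By the symmetry above, the second factor is \<open>- R\<^sub>2\<^sub>1(y, x; s)\<close>.\<close>

lemma unitarity_identities:
  fixes k l :: nat
  assumes "k \<noteq> l"
  defines "U' \<equiv> Rop s' s s k l :: ('n::linorder, 'a) op" and "W' \<equiv> Rop s' s s' k l"
  shows "U k l * U' = 1" and "W k l * W' = 1" and "U k l * W' + W k l * U' = scalar (s * s + s' * s')"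
proof -
  have "ent (U k l * (U' * 1)) f g = ent 1 f g \<and> ent (W k l * (W' * 1)) f g = ent 1 f g
      \<and> ent (U k l * (W' * 1) + W k l * (U' * 1)) f g = ent (scalar (s * s + s' * s') * 1) f g" for f g
  proof -
    define V where "V = (\<lambda>a b. f(k := a, l := b))"
    have V: "f = V (f k) (f l)" "V a b k = a" "V a b l = b" "swap_sites k l (V a b) = V b a" for a b
      using assms by (auto simp: V_def swap_sites_def fun_eq_iff)
    obtain a b where f: "f = V a b" using V(1) by blast
    show ?thesis
      unfolding f U'_def W'_def
      apply (simp only: ent_linear ent_scalar_times ent_Rop_times ent_qflip_times V)
      apply (cases a b rule: trichotomy; simp add: qcoeff_def algebra_simps)
      done
  qed
  then show "U k l * U' = 1" "W k l * W' = 1" "U k l * W' + W k l * U' = scalar (s * s + s' * s')"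
    by (auto intro!: rfmat_eqI)
qed

end

subsection \<open>Operators on a single site\<close>

lift_definition site :: "nat \<Rightarrow> ('n::finite \<Rightarrow> 'n \<Rightarrow> 'a::zero) \<Rightarrow> ('n, 'a) op"
  is "\<lambda>k M f g. if g = f(k := g k) then M (f k) (g k) else 0"
proof -
  fix k :: nat and M :: "'n \<Rightarrow> 'n \<Rightarrow> 'a" and f :: "nat \<Rightarrow> 'n"
  have "{g. (if g = f(k := g k) then M (f k) (g k) else 0) \<noteq> 0} \<subseteq> range (\<lambda>j. f(k := j))"
    by (auto split: if_splits)
  then show "finite {g. (if g = f(k := g k) then M (f k) (g k) else 0) \<noteq> 0}"
    by (rule finite_subset) simp
qed

lemma ent_site: "ent (site k M) f g = (if g = f(k := g k) then M (f k) (g k) else 0)"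
  by (rule site.rep_eq[THEN fun_cong, THEN fun_cong])

text \<open>Left multiplication acts on rows: an identity between products of site operators is checked by letting the
  factors act one after the other on the row index of an arbitrary matrix.\<close>

lemma ent_site_times:
  "ent (site k M * B) f g = (\<Sum>j\<in>UNIV. M (f k) j * ent B (f(k := j)) g)"
proof -
  have inj: "inj (\<lambda>j. f(k := j))" by (rule injI) (metis fun_upd_same)
  have "ent (site k M * B) f g = (\<Sum>h\<in>range (\<lambda>j. f(k := j)). ent (site k M) f h * ent B h g)"
  proof (rule ent_times_superset)
    show "{h. ent (site k M) f h \<noteq> 0} \<subseteq> range (\<lambda>j. f(k := j))"
      by (auto simp: ent_site split: if_splits)
  qed simp
  also have "\<dots> = (\<Sum>j\<in>UNIV. M (f k) j * ent B (f(k := j)) g)"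
    using inj by (subst sum.reindex) (auto simp: ent_site)
  finally show ?thesis .
qed

lemma ent_site_site:
  assumes "k \<noteq> l"
  shows "ent (site k M * site l N) f g =
    (if g = f(k := g k, l := g l) then M (f k) (g k) * N (f l) (g l) else 0)"
proof -
  have "ent (site k M * site l N) f g =
    (\<Sum>j\<in>UNIV. if j = g k then (if g = f(k := g k, l := g l) then M (f k) (g k) * N (f l) (g l) else 0) else 0)"
    unfolding ent_site_times
  proof (intro sum.cong refl)
    fix j
    show "M (f k) j * ent (site l N) (f(k := j)) g =
      (if j = g k then (if g = f(k := g k, l := g l) then M (f k) (g k) * N (f l) (g l) else 0) else 0)"
    proof (cases "j = g k")
      case False
      then have "g \<noteq> f(k := j, l := g l)" using assms by (metis fun_upd_other fun_upd_same)
      then show ?thesis using False by (simp add: ent_site)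
    qed (use assms in \<open>auto simp: ent_site\<close>)
  qed
  then show ?thesis by simp
qed

lemma site_zero [simp]: "site k (\<lambda>_ _. 0) = (0 :: ('n::finite, 'a::ring_1) op)"
  by (rule rfmat_eqI) (simp add: ent_site)

text \<open>This is why the flip in \<open>\<R>\<close> contributes a term antisymmetric in the two parameters to the RTT relation.\<close>

lemma flip_site_site:
  assumes "k \<noteq> l"
  shows "flip k l * (site k M * site l N) = (site l M * site k N * flip k l :: ('n::finite, 'a::ring_1) op)"
proof (rule rfmat_eqI)
  fix f g :: "nat \<Rightarrow> 'n"
  have "g = (swap_sites k l f)(k := g k, l := g l) \<longleftrightarrow> swap_sites k l g = f(l := g k, k := g l)"
    using assms by (auto simp: swap_sites_def fun_eq_iff)
  moreover have "swap_sites k l h k = h l" "swap_sites k l h l = h k" for h :: "nat \<Rightarrow> 'n"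
    by (auto simp: swap_sites_def)
  ultimately show "ent (flip k l * (site k M * site l N)) f g = ent (site l M * site k N * flip k l) f g"
    using assms by (simp add: ent_site_site)
qed

lemma site_monomial_commute:
  assumes "\<And>f j. c (f(k := j)) = c f" "\<And>f j. \<sigma> (f(k := j)) = (\<sigma> f)(k := j)" "\<And>f. \<sigma> f k = f k"
    and "\<And>f a. c f * a = a * c f"
  shows "site k M * monomial c \<sigma> = monomial c \<sigma> * site k M"
proof (rule rfmat_eqI)
  fix f g
  have "a * (c f * b) = c f * (a * b)" for a b by (metis assms(4) mult.assoc)
  then have "ent (site k M * (monomial c \<sigma> * 1)) f g = ent (monomial c \<sigma> * (site k M * 1)) f g"
    by (simp only: ent_site_times assms(1-3) sum_distrib_left ent_monomial_times)
  then show "ent (site k M * monomial c \<sigma>) f g = ent (monomial c \<sigma> * site k M) f g" by simp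
qed

context sqrt_q
begin

lemma flip_site_commute:
  "k \<notin> {i, j} \<Longrightarrow> site k M * flip i j = (flip i j * site k M :: ('n::{finite,linorder}, 'a) op)"
  unfolding flip_def by (rule site_monomial_commute) (auto simp: swap_sites_def fun_eq_iff)

lemma Q_site_commute:
  "k \<notin> {i, j} \<Longrightarrow> site k M * Q i j = (Q i j * site k M :: ('n::{finite,linorder}, 'a) op)"
  unfolding qflip_def by (rule site_monomial_commute) (auto simp: swap_sites_def fun_eq_iff qcoeff_central)

lemma disjoint_commute:
  assumes "k \<notin> {i, j}" "l \<notin> {i, j}"
  shows "Q k l * Q i j = (Q i j * Q k l :: ('n::linorder, 'a) op)" (is ?th1)
    and "Q k l * flip i j = (flip i j * Q k l :: ('n::linorder, 'a) op)" (is ?th2)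
    and "flip k l * flip i j = (flip i j * flip k l :: ('n::linorder, 'a) op)" (is ?th3)
proof -
  have [simp]: "swap_sites k l f i = f i" "swap_sites k l f j = f j" "swap_sites i j f k = f k" "swap_sites i j f l = f l" for f :: "nat \<Rightarrow> 'n"
    using assms by (auto simp: swap_sites_def)
  have comp: "swap_sites k l \<circ> swap_sites i j = (swap_sites i j \<circ> swap_sites k l :: (nat \<Rightarrow> 'n) \<Rightarrow> _)"
    using swap_sites_disjoint[OF assms] by (auto simp: fun_eq_iff)
  show ?th1 ?th2 ?th3
    unfolding qflip_def flip_def monomial_mult_monomial comp by (simp_all add: qcoeff_central[of _ _ "qcoeff s s' (_ i) (_ j)"])
qed

end

section \<open>Congruence modulo a two-sided ideal\<close>

text \<open>The rings \<open>Y/I\<^sub>p\<close> depend on \<open>p\<close> and are not types; congruences in a ring of the type class take their place.\<close>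

locale two_sided =
  fixes J :: "'r::ring_1 set"
  assumes zero_mem [simp]: "0 \<in> J"
    and add_mem: "a \<in> J \<Longrightarrow> b \<in> J \<Longrightarrow> a + b \<in> J"
    and l_mem: "a \<in> J \<Longrightarrow> c * a \<in> J"
    and r_mem: "a \<in> J \<Longrightarrow> a * c \<in> J"
begin

definition cng :: "'r \<Rightarrow> 'r \<Rightarrow> bool" (infix \<open>\<approx>\<close> 50)
  where "a \<approx> b \<longleftrightarrow> a - b \<in> J"

lemma minus_mem: "a \<in> J \<Longrightarrow> - a \<in> J"
  using l_mem[of a "- 1"] by simp

lemma diff_mem: "a \<in> J \<Longrightarrow> b \<in> J \<Longrightarrow> a - b \<in> J"
  using add_mem[of a "- b"] minus_mem[of b] by simp

lemma sum_mem: "(\<And>x. x \<in> S \<Longrightarrow> F x \<in> J) \<Longrightarrow> (\<Sum>x\<in>S. F x) \<in> J"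
  by (induction S rule: infinite_finite_induct) (auto intro: add_mem)

lemma cng_refl [simp]: "a \<approx> a" by (simp add: cng_def)
lemma cng_sym: "a \<approx> b \<Longrightarrow> b \<approx> a" unfolding cng_def using minus_mem[of "a - b"] by simp
lemma cng_trans [trans]: "a \<approx> b \<Longrightarrow> b \<approx> c \<Longrightarrow> a \<approx> c"
  unfolding cng_def using add_mem[of "a - b" "b - c"] by simp
lemma cng_add: "a \<approx> b \<Longrightarrow> c \<approx> d \<Longrightarrow> a + c \<approx> b + d"
  unfolding cng_def using add_mem[of "a - b" "c - d"] by (simp add: algebra_simps)
lemma cng_diff: "a \<approx> b \<Longrightarrow> c \<approx> d \<Longrightarrow> a - c \<approx> b - d"
  unfolding cng_def using diff_mem[of "a - b" "c - d"] by (simp add: algebra_simps)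
lemma cng_l: "a \<approx> b \<Longrightarrow> c * a \<approx> c * b"
  unfolding cng_def using l_mem[of "a - b" c] by (simp add: algebra_simps)
lemma cng_r: "a \<approx> b \<Longrightarrow> a * c \<approx> b * c"
  unfolding cng_def using r_mem[of "a - b" c] by (simp add: algebra_simps)
lemma cng_mult: "a \<approx> b \<Longrightarrow> c \<approx> d \<Longrightarrow> a * c \<approx> b * d"
  using cng_l cng_r cng_trans by blast
definition opI :: "('i, 'r) rfmat set"
  where "opI = {A. \<forall>f g. ent A f g \<in> J}"

lemma two_sided_opI: "two_sided opI"
proof
  fix A B C :: "('i, 'r) rfmat"
  assume A: "A \<in> opI"
  then have "ent A f g \<in> J" for f g by (simp add: opI_def)
  then have "ent (C * A) f g \<in> J" "ent (A * C) f g \<in> J" for f g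
    unfolding times_rfmat.rep_eq by (auto intro: sum_mem l_mem) (auto intro: sum_mem r_mem)
  then show "C * A \<in> opI" "A * C \<in> opI"
    by (simp_all add: opI_def)
  assume "B \<in> opI"
  with A show "A + B \<in> opI" by (auto simp: opI_def intro: add_mem)
qed (auto simp: opI_def)

end

section \<open>The RTT relation\<close>

text \<open>\<open>\<chi> k\<close> stands for \<open>e\<^bsup>k h/2\<^esup>\<close>; integer exponents are needed for the powers of \<open>q\<close> in \<open>\<T>\<^sub>k(z q\<^bsup>-k\<^esup>)\<close>.\<close>

locale char_q =
  fixes \<chi> :: "int \<Rightarrow> 'a::ring_1"
  assumes chi_0 [simp]: "\<chi> 0 = 1" and chi_add: "\<chi> (a + b) = \<chi> a * \<chi> b"
    and chi_central: "\<chi> a * x = x * \<chi> a"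
begin

lemma chi_mult: "\<chi> a * \<chi> b = \<chi> (a + b)"
  by (simp add: chi_add)

lemma chi_left: "\<chi> a * (\<chi> b * x) = \<chi> (a + b) * x"
  by (simp add: chi_add mult.assoc)

sublocale sqrt_q "\<chi> 1" "\<chi> (-1)"
  by standard (simp add: chi_mult, simp add: chi_mult, (rule chi_central)+)

sublocale inv: sqrt_q "\<chi> (-1)" "\<chi> 1"
  by standard (simp add: chi_mult, simp add: chi_mult, (rule chi_central)+)

end

text \<open>\<open>t a i j\<close> is the entry \<open>(i, j)\<close> of the coefficient of \<open>x\<^sup>a\<close> in \<open>\<T>(x)\<close>. The last assumption is the entry
  \<open>((i, j), (k, l))\<close> of the coefficient of \<open>x\<^bsup>a+1\<^esup> y\<^bsup>b+1\<^esup>\<close> in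
  \<open>(x U - y W) \<T>\<^sub>1(x) \<T>\<^sub>2(y) - \<T>\<^sub>2(y) \<T>\<^sub>1(x) (x U - y W)\<close>.\<close>

locale rtt = char_q \<chi> + two_sided J
  for \<chi> :: "int \<Rightarrow> 'a::ring_1" and J :: "'a set" +
  fixes t :: "int \<Rightarrow> 'n::{finite,linorder} \<Rightarrow> 'n \<Rightarrow> 'a" and B :: int
  assumes bound: "a > B \<Longrightarrow> t a i j = 0"
    and rtt: "(t a i k * t (b+1) j l + (\<chi> (-1) - qcoeff (\<chi> 1) (\<chi> (-1)) i j) * (t a j k * t (b+1) i l))
       - (t (a+1) i k * t b j l + (\<chi> 1 - qcoeff (\<chi> 1) (\<chi> (-1)) i j) * (t (a+1) j k * t b i l))
       - ((t (b+1) j l * t a i k + t (b+1) j k * t a i l * (\<chi> (-1) - qcoeff (\<chi> 1) (\<chi> (-1)) l k))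
         - (t b j l * t (a+1) i k + t b j k * t (a+1) i l * (\<chi> 1 - qcoeff (\<chi> 1) (\<chi> (-1)) l k))) \<in> J"
begin

definition S :: "nat \<Rightarrow> int \<Rightarrow> ('n, 'a) op"
  where "S k a = site k (t a)"

lemma S_bound: "a > B \<Longrightarrow> S k a = 0"
proof -
  assume "a > B"
  then have "t a = (\<lambda>_ _. 0)" by (intro ext) (rule bound)
  then show ?thesis by (simp add: S_def)
qed

sublocale opI: two_sided "opI :: ('n, 'a) op set"
  by (rule two_sided_opI)

lemma rtt_op:
  assumes "k \<noteq> l"
  shows "U k l * (S k a * S l (b + 1)) - W k l * (S k (a + 1) * S l b)
    - (S l (b + 1) * S k a * U k l - S l b * S k (a + 1) * W k l) \<in> (opI :: ('n, 'a) op set)"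
  unfolding opI_def
proof (intro CollectI allI)
  fix f g :: "nat \<Rightarrow> 'n"
  have 1: "ent (S k a * S l b) f g = (if g = f(k := g k, l := g l) then t a (f k) (g k) * t b (f l) (g l) else 0)"
    "ent (S l b * S k a) f g = (if g = f(k := g k, l := g l) then t b (f l) (g l) * t a (f k) (g k) else 0)"
    for f g a b
    using assms by (auto simp: S_def ent_site_site fun_upd_twist)
  have 2: "swap_sites k l h k = h l" "swap_sites k l h l = h k" for h :: "nat \<Rightarrow> 'n"
    by (auto simp: swap_sites_def)
  have 3: "g = (swap_sites k l f)(k := g k, l := g l) \<longleftrightarrow> g = f(k := g k, l := g l)"
    "swap_sites k l g = f(k := g l, l := g k) \<longleftrightarrow> g = f(k := g k, l := g l)"
    using assms by (auto simp: swap_sites_def fun_eq_iff)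
  show "ent (U k l * (S k a * S l (b + 1)) - W k l * (S k (a + 1) * S l b)
    - (S l (b + 1) * S k a * U k l - S l b * S k (a + 1) * W k l)) f g \<in> J"
    using rtt[of a "f k" "g k" b "f l" "g l"]
    by (simp add: ent_Rop_times ent_times_Rop 1 2 3)
qed

text \<open>The sum is the coefficient of \<open>z\<^sup>c\<close> in \<open>\<T>\<^sub>k(z) \<T>\<^sub>l(z q\<^sup>-\<^sup>1)\<close>. Let \<open>g\<close> and \<open>e\<close> be the coefficients, along the
  diagonal of total degree \<open>c\<close>, of
  \<open>(1 - Q) \<T>\<^sub>k(x) \<T>\<^sub>l(y) - \<T>\<^sub>l(y) \<T>\<^sub>k(x) (1 - Q)\<close> and of \<open>\<T>\<^sub>l(x) \<T>\<^sub>k(y) - \<T>\<^sub>l(y) \<T>\<^sub>k(x)\<close>. The RTT relation is a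
  first-order recursion for \<open>g\<close> with right-hand side \<open>e\<close>. By antisymmetry \<open>e\<close> has sum \<open>0\<close>, so its partial sums
  \<open>p\<close>, which are the coefficients of the quotient by \<open>x - y\<close>, have finite support. The recursion expresses
  \<open>g\<close> by \<open>p\<close>, and in the sum with weights \<open>q\<^bsup>-b\<^esup>\<close> this expression telescopes to \<open>0\<close>.\<close>

lemma fusion_op:
  assumes kl: "k \<noteq> l"
  shows "(1 - Q k l) * (\<Sum>b\<in>{c-B..B}. scalar (\<chi> (- 2 * b)) * (S k (c - b) * S l b)) * (1 + Q k l) \<in> (opI :: ('n, 'a) op set)"
proof -
  define P where "P = (flip k l :: ('n, 'a) op)"
  define g where "g b = (1 - Q k l) * (S k (c - b) * S l b) - S l b * S k (c - b) * (1 - Q k l)" for b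
  define e where "e b = S l (c - b) * S k b - S l b * S k (c - b)" for b
  \<comment> \<open>Both operators vanish for exponents above \<open>B\<close>, so only \<open>c - B \<le> b \<le> B\<close> matters.\<close>
  define L where "L = c - B"
  define p where "p i = (\<Sum>j<i. e (L + int j))" for i
  have scalar_chi_commute: "scalar (\<chi> a) * X = X * scalar (\<chi> a)" for a and X :: "('n, 'a) op"
    by (rule rfmat_eqI) (simp, rule chi_central)
  have Pflip: "P * (S k a * S l b) = S l a * S k b * P" for a b
    unfolding S_def P_def by (rule flip_site_site[OF kl])
  have U: "U k l = (1 - Q k l) + scalar (\<chi> (-1)) * P" and W: "W k l = (1 - Q k l) + scalar (\<chi> 1) * P"
    by (simp_all add: Rop_def P_def)
  have step: "g (b + 1) - g b + (scalar (\<chi> (-1)) * e (b + 1) - scalar (\<chi> 1) * e b) * P \<in> opI" for b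
  proof -
    have "U k l * (S k (c - (b + 1)) * S l (b + 1)) - W k l * (S k (c - (b + 1) + 1) * S l b)
      - (S l (b + 1) * S k (c - (b + 1)) * U k l - S l b * S k (c - (b + 1) + 1) * W k l)
      = g (b + 1) - g b + (scalar (\<chi> (-1)) * e (b + 1) - scalar (\<chi> 1) * e b) * P"
    proof -
      have i: "c - (b + 1) + 1 = c - b" by simp
      have UX: "U k l * (S k x * S l y) = (1 - Q k l) * (S k x * S l y) + scalar (\<chi> (-1)) * (S l x * S k y * P)"
        and WX: "W k l * (S k x * S l y) = (1 - Q k l) * (S k x * S l y) + scalar (\<chi> 1) * (S l x * S k y * P)" for x y
        unfolding U W by (simp_all only: distrib_right mult.assoc Pflip)
      have XU: "S l x * S k y * U k l = S l x * S k y * (1 - Q k l) + scalar (\<chi> (-1)) * (S l x * S k y * P)"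
        and XW: "S l x * S k y * W k l = S l x * S k y * (1 - Q k l) + scalar (\<chi> 1) * (S l x * S k y * P)" for x y
        using scalar_chi_commute[of "-1" "S l x * S k y"] scalar_chi_commute[of 1 "S l x * S k y"]
        unfolding U W by (simp_all only: distrib_left mult.assoc[symmetric])
      show ?thesis
        unfolding i UX WX XU XW g_def e_def
        by (simp only: left_diff_distrib right_diff_distrib mult.assoc) (simp only: algebra_simps)
    qed
    then show ?thesis using rtt_op[OF kl, of "c - (b + 1)" b] by metis
  qed
  have zero: "g b = 0" "e b = 0" if "b < L" for b
    using that by (auto simp: g_def e_def L_def S_bound)
  have gp: "g (L + int i) + (scalar (\<chi> (-1)) * p (Suc i) - scalar (\<chi> 1) * p i) * P \<in> opI" for i
  proof (induction i)
    case 0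
    show ?case using step[of "L - 1"] by (simp add: zero p_def)
  next
    case (Suc i)
    have "L + int (Suc i) = L + int i + 1" by simp
    with opI.add_mem[OF Suc step[of "L + int i"]] show ?case
      by (simp add: p_def algebra_simps)
  qed
  have tele: "(\<Sum>j<i. scalar (\<chi> (- 2 * (L + int j))) * g (L + int j))
      + scalar (\<chi> (1 - 2 * (L + int i))) * p i * P \<in> opI" for i
  proof (induction i)
    case 0
    show ?case by (simp add: p_def)
  next
    case (Suc i)
    define x where "x = L + int i"
    have eqs: "scalar (\<chi> (1 - 2 * x)) = scalar (\<chi> (- 2 * x)) * scalar (\<chi> 1)"
      "scalar (\<chi> (1 - 2 * (L + int (Suc i)))) = scalar (\<chi> (- 2 * x)) * scalar (\<chi> (-1))"
      by (simp_all add: x_def scalar_mult[symmetric] chi_mult algebra_simps)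
    have "(\<Sum>j<Suc i. scalar (\<chi> (- 2 * (L + int j))) * g (L + int j))
        + scalar (\<chi> (1 - 2 * (L + int (Suc i)))) * p (Suc i) * P
      = ((\<Sum>j<i. scalar (\<chi> (- 2 * (L + int j))) * g (L + int j)) + scalar (\<chi> (1 - 2 * x)) * p i * P)
        + scalar (\<chi> (- 2 * x)) * (g x + (scalar (\<chi> (-1)) * p (Suc i) - scalar (\<chi> 1) * p i) * P)"
      unfolding sum.lessThan_Suc x_def[symmetric] eqs
      by (simp only: algebra_simps)
    with opI.add_mem[OF Suc opI.l_mem[OF gp[of i], of "scalar (\<chi> (- 2 * x))"]] show ?case
      by (simp only: x_def)
  qed
  \<comment> \<open>If \<open>B < c - B\<close>, both sides are empty sums.\<close>
  have int_sum: "(\<Sum>b\<in>{c-B..B}. F b) = (\<Sum>j<nat (B - L + 1). F (L + int j))" for F :: "int \<Rightarrow> ('n, 'a) op"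
    by (rule sum.reindex_bij_witness[of _ "\<lambda>j. L + int j" "\<lambda>b. nat (b - L)"]) (auto simp: L_def)
  have "p (nat (B - L + 1)) = (\<Sum>b\<in>{c-B..B}. e b)"
    unfolding int_sum p_def ..
  also have "\<dots> = (\<Sum>b\<in>{c-B..B}. S l (c - b) * S k b) - (\<Sum>b\<in>{c-B..B}. S l b * S k (c - b))"
    by (simp add: e_def sum_subtractf)
  also have "(\<Sum>b\<in>{c-B..B}. S l (c - b) * S k b) = (\<Sum>b\<in>{c-B..B}. S l b * S k (c - b))"
    by (rule sum.reindex_bij_witness[of _ "\<lambda>b. c - b" "\<lambda>b. c - b"]) auto
  finally have p0: "p (nat (B - L + 1)) = 0" by simp
  have G: "(\<Sum>b\<in>{c-B..B}. scalar (\<chi> (- 2 * b)) * g b) \<in> opI"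
    using tele[of "nat (B - L + 1)"] unfolding int_sum p0 by simp
  define Z where "Z = (\<Sum>b\<in>{c-B..B}. scalar (\<chi> (- 2 * b)) * (S k (c - b) * S l b))"
  define Z' where "Z' = (\<Sum>b\<in>{c-B..B}. scalar (\<chi> (- 2 * b)) * (S l b * S k (c - b)))"
  have "(\<Sum>b\<in>{c-B..B}. scalar (\<chi> (- 2 * b)) * g b) = (1 - Q k l) * Z - Z' * (1 - Q k l)"
  proof -
    have "scalar (\<chi> a) * ((1 - Q k l) * X) = (1 - Q k l) * (scalar (\<chi> a) * X)" for a and X :: "('n, 'a) op"
      using scalar_chi_commute[of a "1 - Q k l"] by (simp only: mult.assoc[symmetric])
    then show ?thesis
      by (simp add: g_def Z_def Z'_def right_diff_distrib sum_subtractf sum_distrib_left sum_distrib_right mult.assoc)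
  qed
  moreover have "(1 - Q k l) * (1 + Q k l) = (0 :: ('n, 'a) op)"
    by (simp add: algebra_simps Q_Q)
  ultimately have "(\<Sum>b\<in>{c-B..B}. scalar (\<chi> (- 2 * b)) * g b) * (1 + Q k l) = (1 - Q k l) * Z * (1 + Q k l)"
    by (simp add: left_diff_distrib mult.assoc)
  with opI.r_mem[OF G, of "1 + Q k l"] show ?thesis by (simp add: Z_def)
qed

end

section \<open>Laurent series in the inverse of a variable\<close>

text \<open>Laurent series in \<open>x\<^sup>-\<^sup>1\<close> are used, so that powers of \<open>x\<close> are bounded above: \<open>cf F a\<close> is the coefficient of \<open>x\<^sup>a\<close>.\<close>

definition cf :: "'a::zero fls \<Rightarrow> int \<Rightarrow> 'a"
  where "cf F a = fls_nth F (- a)"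

definition ser :: "(int \<Rightarrow> 'a::zero) \<Rightarrow> 'a fls"
  where "ser c = Abs_fls (\<lambda>k. c (- k))"

lemma cf_ser: "(\<And>a. a > B \<Longrightarrow> c a = 0) \<Longrightarrow> cf (ser c) a = c a"
  unfolding cf_def ser_def by (subst nth_Abs_fls_lower_bound[of "- B"]) auto

lemma cf_eqI: "(\<And>a. cf F a = cf G a) \<Longrightarrow> F = G"
  unfolding cf_def by (rule fls_eqI) (metis minus_minus)

lemma cf_linear [simp]: "cf 0 a = 0" "cf (F + G) a = cf F a + cf G a" "cf (F - G) a = cf F a - cf G a"
  for F G :: "'a::ab_group_add fls"
  by (simp_all add: cf_def)

lemma cf_const [simp]: "cf (fls_const c) a = (if a = 0 then c else 0)"
  by (simp add: cf_def)

lemma cf_const_times [simp]: "cf (fls_const c * F) a = c * cf F a" "cf (F * fls_const c) a = cf F a * c"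
  for F :: "'a::ring_1 fls"
  by (simp_all add: cf_def)

lemma cf_X_inv_times [simp]: "cf (fls_X_inv * F) a = cf F (a - 1)" "cf (F * fls_X_inv) a = cf F (a - 1)"
  for F :: "'a::ring_1 fls"
  by (simp_all add: cf_def fls_X_inv_times_conv_shift)

lemma fls_times_nth_superset:
  fixes F G :: "'a::ring_1 fls"
  assumes "finite S" "\<And>i. fls_nth F i \<noteq> 0 \<Longrightarrow> fls_nth G (n - i) \<noteq> 0 \<Longrightarrow> i \<in> S"
  shows "fls_nth (F * G) n = (\<Sum>i\<in>S. fls_nth F i * fls_nth G (n - i))"
proof -
  let ?I = "{fls_subdegree F..n - fls_subdegree G}"
  have I: "i \<in> ?I" if "fls_nth F i \<noteq> 0" "fls_nth G (n - i) \<noteq> 0" for i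
    using that fls_subdegree_leI[of F i] fls_subdegree_leI[of G "n - i"] by simp
  have "(\<Sum>i\<in>?I. fls_nth F i * fls_nth G (n - i)) = (\<Sum>i\<in>S. fls_nth F i * fls_nth G (n - i))"
  proof (rule sum.mono_neutral_cong)
    show "fls_nth F i * fls_nth G (n - i) = 0" if "i \<in> S - ?I" for i using that I[of i] by fastforce
    show "fls_nth F i * fls_nth G (n - i) = 0" if "i \<in> ?I - S" for i using that assms(2)[of i] by fastforce
  qed (use assms(1) in auto)
  then show ?thesis using fls_times_nth(2)[of F G n] by simp
qed

lemma cf_times:
  fixes F G :: "'a::ring_1 fls"
  assumes "\<And>a. a > A \<Longrightarrow> cf F a = 0" "\<And>b. b > B \<Longrightarrow> cf G b = 0"
  shows "cf (F * G) c = (\<Sum>b\<in>{c - A..B}. cf F (c - b) * cf G b)"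
proof -
  have "cf (F * G) c = (\<Sum>i\<in>{- A..B - c}. fls_nth F i * fls_nth G (- c - i))"
    unfolding cf_def
  proof (rule fls_times_nth_superset)
    fix i assume "fls_nth F i \<noteq> 0" "fls_nth G (- c - i) \<noteq> 0"
    then show "i \<in> {- A..B - c}"
      using assms(1)[of "- i"] assms(2)[of "c + i"] by (force simp: cf_def)
  qed simp
  also have "\<dots> = (\<Sum>b\<in>{c - A..B}. cf F (c - b) * cf G b)"
    by (rule sum.reindex_bij_witness[of _ "\<lambda>b. b - c" "\<lambda>i. c + i"]) (auto simp: cf_def)
  finally show ?thesis .
qed

lemma cf_bound: obtains A where "\<And>a. a > A \<Longrightarrow> cf F a = 0"
  using fls_nth_vanishes_belowE[of F] unfolding cf_def by (metis minus_less_iff neg_less_iff_less)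

context two_sided
begin

definition flsI :: "'r fls set"
  where "flsI = {F. \<forall>a. cf F a \<in> J}"

lemma two_sided_flsI: "two_sided flsI"
proof
  fix F G H :: "'r fls"
  assume F: "F \<in> flsI"
  obtain A where A: "\<And>a. a > A \<Longrightarrow> cf F a = 0" using cf_bound by metis
  obtain C where C: "\<And>a. a > C \<Longrightarrow> cf H a = 0" using cf_bound by metis
  show "H * F \<in> flsI" "F * H \<in> flsI"
    using F by (auto simp: flsI_def cf_times[OF C A] cf_times[OF A C] intro!: sum_mem intro: l_mem)
      (auto simp: flsI_def intro: r_mem)
  assume "G \<in> flsI"
  with F show "F + G \<in> flsI" by (auto simp: flsI_def intro: add_mem)
qed (auto simp: flsI_def)

end

subsection \<open>Two variables\<close>

text \<open>Laurent series in two variables are series in \<open>x\<^sup>-\<^sup>1\<close> with coefficients in series in \<open>y\<^sup>-\<^sup>1\<close>. A series in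
  \<open>x\<close> alone enters through \<open>outer\<close>, one in \<open>y\<close> alone through \<open>fls_const\<close>.\<close>

definition outer :: "'a::ring_1 fls \<Rightarrow> 'a fls fls"
  where "outer F = ser (\<lambda>a. fls_const (cf F a))"

lemma cf_outer [simp]: "cf (outer F) a = fls_const (cf F a)"
proof -
  obtain A where A: "\<And>a. a > A \<Longrightarrow> cf F a = 0" using cf_bound by metis
  show ?thesis unfolding outer_def by (rule cf_ser[of A]) (simp add: A)
qed

lemma fls_const_sum: "fls_const (\<Sum>x\<in>S. F x) = (\<Sum>x\<in>S. fls_const (F x :: 'a::ring_1))"
proof (induction S rule: infinite_finite_induct)
  case (insert x S)
  moreover have "fls_const (F x + sum F S) = fls_const (F x) + fls_const (sum F S)"
    by (rule cf_eqI) simp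
  ultimately show ?case by simp
qed auto

lemma outer_mult: "outer (F * G) = outer F * outer G"
proof (rule cf_eqI)
  fix c
  obtain A where A: "\<And>a. a > A \<Longrightarrow> cf F a = 0" using cf_bound by metis
  obtain B where B: "\<And>a. a > B \<Longrightarrow> cf G a = 0" using cf_bound by metis
  have "cf (outer F * outer G) c = (\<Sum>b\<in>{c - A..B}. cf (outer F) (c - b) * cf (outer G) b)"
    by (rule cf_times) (simp_all add: A B)
  then show "cf (outer (F * G)) c = cf (outer F * outer G) c"
    using cf_times[of A F B G c] A B by (simp add: fls_const_sum)
qed

lemma outer_1 [simp]: "outer 1 = 1"
proof (rule cf_eqI)
  fix a
  have "cf (outer 1) a = fls_const (cf (1 :: 'a fls) a)" by simp
  also have "\<dots> = cf (1 :: 'a fls fls) a" by (simp add: cf_def)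
  finally show "cf (outer (1 :: 'a fls)) a = cf 1 a" .
qed

lemma outer_prod_list: "outer (prod_list Fs) = prod_list (map outer Fs)"
  by (induction Fs) (auto simp: outer_mult)

lemma fls_const_prod_list: "fls_const (prod_list Fs) = prod_list (map fls_const (Fs :: 'a::ring_1 list))"
  by (induction Fs) (auto simp flip: fls_const_mult_const)

abbreviation cst :: "'a::ring_1 \<Rightarrow> 'a fls fls"
  where "cst A \<equiv> fls_const (fls_const A)"

definition cf2 :: "'a::zero fls fls \<Rightarrow> int \<Rightarrow> int \<Rightarrow> 'a"
  where "cf2 F a b = cf (cf F a) b"

text \<open>The variables \<open>x\<close> and \<open>y\<close> themselves.\<close>

definition zx :: "'a::ring_1 fls fls" where "zx = fls_X_inv"
definition zy :: "'a::ring_1 fls fls" where "zy = fls_const fls_X_inv"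

lemma cf2_simps [simp]:
  fixes F G :: "'a::ring_1 fls fls"
  shows "cf2 0 a b = 0" "cf2 (F + G) a b = cf2 F a b + cf2 G a b" "cf2 (F - G) a b = cf2 F a b - cf2 G a b"
    "cf2 (zx * F) a b = cf2 F (a - 1) b" "cf2 (F * zx) a b = cf2 F (a - 1) b"
    "cf2 (zy * F) a b = cf2 F a (b - 1)" "cf2 (F * zy) a b = cf2 F a (b - 1)"
    "cf2 (cst A * F) a b = A * cf2 F a b" "cf2 (F * cst A) a b = cf2 F a b * A"
  by (simp_all add: cf2_def zx_def zy_def)

lemma cf2_outer_const [simp]: "cf2 (outer F * fls_const G) a b = cf F a * cf G b"
    "cf2 (fls_const G * outer F) a b = cf G b * cf F a"
  by (simp_all add: cf2_def)

lemma cf2_eqI: "(\<And>a b. cf2 F a b = cf2 G a b) \<Longrightarrow> F = G"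
  by (auto simp: cf2_def intro!: cf_eqI)

lemma zx_central: "zx * F = F * zx" and zy_central: "zy * F = F * zy"
  by (rule cf2_eqI; simp)+

lemma cst_central: "(\<And>x. c * x = x * c) \<Longrightarrow> cst c * F = F * cst c"
  by (rule cf2_eqI) simp

section \<open>Antisymmetrizers and products of operators\<close>

lemma upt_split_pair: "Suc i < n \<Longrightarrow> [0..<n] = [0..<i] @ [i, Suc i] @ [Suc (Suc i)..<n]"
  using upt_add_eq_append[of 0 i "n - i"] by (simp add: upt_conv_Cons)

lemma prod_list_commute:
  fixes x :: "'b::monoid_mult"
  assumes "\<And>y. y \<in> set ys \<Longrightarrow> x * y = y * x"
  shows "x * prod_list ys = prod_list ys * x"
  using assms
proof (induction ys)
  case (Cons y ys)
  have "x * (y * prod_list ys) = y * (x * prod_list ys)"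
    using Cons.prems[of y] by (simp add: mult.assoc[symmetric])
  also have "\<dots> = y * prod_list ys * x" using Cons by (simp add: mult.assoc)
  finally show ?case by simp
qed simp

text \<open>\<open>A\<close> is an antisymmetrizer for involutions \<open>P i\<close> modulo an ideal in which \<open>2\<close> can be cancelled. The assumption
  \<open>A_right\<close> says that \<open>1 - A\<close> lies, as far as the ideal can see, in the right ideal generated by the
  elements \<open>1 + P i\<close>.\<close>

locale antisymmetrizer = two_sided J for J :: "'b::ring_1 set" +
  fixes n :: nat and P :: "nat \<Rightarrow> 'b" and A :: 'b
  assumes A_P: "Suc i < n \<Longrightarrow> A * P i = - A"
    and A_A: "A * A = A"
    and A_right: "(\<And>i. Suc i < n \<Longrightarrow> W * (1 + P i) \<in> J) \<Longrightarrow> W * (1 - A) \<in> J"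
    and half: "x + x \<in> J \<Longrightarrow> x \<in> J"
begin

text \<open>Equivalently, \<open>W\<close> preserves the kernel of \<open>A\<close>; in this form it is evident that such elements are closed
  under products.\<close>

definition absorbs :: "'b \<Rightarrow> bool"
  where "absorbs W \<longleftrightarrow> A * W \<approx> A * W * A"

text \<open>From \<open>A (1 - P i) = 2 A\<close> one gets \<open>2 A W (1 + P i) \<approx> 0\<close>, so \<open>A W\<close> annihilates every \<open>1 + P i\<close> and therefore \<open>1 - A\<close>.\<close>

lemma absorbs_fusion:
  assumes "\<And>i. Suc i < n \<Longrightarrow> (1 - P i) * W * (1 + P i) \<in> J"
  shows "absorbs W"
proof -
  have "A * W * (1 - A) \<in> J"
  proof (rule A_right)
    fix i assume i: "Suc i < n"
    have "A * W * (1 + P i) + A * W * (1 + P i) = A * ((1 - P i) * W * (1 + P i))"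
    proof -
      have "A * (1 - P i) = A + A" using A_P[OF i] by (simp add: right_diff_distrib)
      then have "A * ((1 - P i) * W * (1 + P i)) = (A + A) * W * (1 + P i)"
        by (simp only: mult.assoc[symmetric])
      then show ?thesis by (simp only: distrib_right)
    qed
    then show "A * W * (1 + P i) \<in> J" using half l_mem[OF assms[OF i], of A] by metis
  qed
  then show ?thesis by (simp add: absorbs_def cng_def right_diff_distrib)
qed

lemma absorbs_commute: "A * W = W * A \<Longrightarrow> absorbs W"
  using A_A unfolding absorbs_def by (simp add: mult.assoc)

lemma absorbs_mult:
  assumes "absorbs V" "absorbs W"
  shows "absorbs (V * W)"
proof -
  have "A * (V * W) \<approx> A * V * A * W"
    using cng_r[of "A * V" "A * V * A" W] assms(1) by (simp add: absorbs_def mult.assoc)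
  also have "A * V * A * W \<approx> A * V * (A * W * A)"
    using cng_l[of "A * W" "A * W * A" "A * V"] assms(2) by (simp add: absorbs_def mult.assoc)
  also have "A * V * (A * W * A) \<approx> A * V * W * A"
    using cng_r[of "A * V * A" "A * V" "W * A"] assms(1) cng_sym by (simp add: absorbs_def mult.assoc)
  finally show ?thesis by (simp add: absorbs_def mult.assoc)
qed

lemma absorbs_prod_list: "(\<And>W. W \<in> set Ws \<Longrightarrow> absorbs W) \<Longrightarrow> absorbs (prod_list Ws)"
proof (induction Ws)
  case Nil
  show ?case by (simp add: absorbs_def A_A)
qed (auto intro: absorbs_mult)

text \<open>Only the two neighbouring factors \<open>g a\<close>, \<open>g b\<close> fail to commute with \<open>P i\<close>, so a fusion relation for these two
  is inherited by the whole product.\<close>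

lemma absorbs_list:
  assumes com: "\<And>i k. Suc i < n \<Longrightarrow> k < n \<Longrightarrow> k \<notin> {i, Suc i} \<Longrightarrow> P i * g k = g k * P i"
    and split: "\<And>i. Suc i < n \<Longrightarrow> \<exists>ys a b zs. xs = ys @ [a, b] @ zs \<and>
      set ys \<union> set zs \<subseteq> {..<n} - {i, Suc i} \<and> (1 - P i) * (g a * g b) * (1 + P i) \<in> J"
  shows "absorbs (prod_list (map g xs))"
proof (rule absorbs_fusion)
  fix i assume i: "Suc i < n"
  obtain ys a b zs where xs: "xs = ys @ [a, b] @ zs" and sub: "set ys \<union> set zs \<subseteq> {..<n} - {i, Suc i}"
    and fus: "(1 - P i) * (g a * g b) * (1 + P i) \<in> J"
    using split[OF i] by blast
  define Y Z where "Y = prod_list (map g ys)" and "Z = prod_list (map g zs)"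
  have "P i * Y = Y * P i" "P i * Z = Z * P i"
    unfolding Y_def Z_def by (rule prod_list_commute; use sub com[OF i] in auto)+
  then have YZ: "(1 - P i) * Y = Y * (1 - P i)" "Z * (1 + P i) = (1 + P i) * Z"
    by (simp_all add: algebra_simps)
  have "prod_list (map g xs) = Y * (g a * g b) * Z"
    by (simp add: xs Y_def Z_def mult.assoc)
  then have "(1 - P i) * prod_list (map g xs) * (1 + P i) = ((1 - P i) * Y) * (g a * g b) * (Z * (1 + P i))"
    by (simp add: mult.assoc)
  also have "\<dots> = Y * ((1 - P i) * (g a * g b) * (1 + P i)) * Z"
    unfolding YZ by (simp add: mult.assoc)
  finally show "(1 - P i) * prod_list (map g xs) * (1 + P i) \<in> J"
    using l_mem[OF r_mem[OF fus, of Z], of Y] by (simp add: mult.assoc)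
qed

lemma absorbs_upt:
  assumes "\<And>i k. Suc i < n \<Longrightarrow> k < n \<Longrightarrow> k \<notin> {i, Suc i} \<Longrightarrow> P i * g k = g k * P i"
    and "\<And>i. Suc i < n \<Longrightarrow> (1 - P i) * (g i * g (Suc i)) * (1 + P i) \<in> J"
  shows "absorbs (prod_list (map g [0..<n]))"
proof (rule absorbs_list)
  fix i assume i: "Suc i < n"
  show "\<exists>ys a b zs. [0..<n] = ys @ [a, b] @ zs \<and>
      set ys \<union> set zs \<subseteq> {..<n} - {i, Suc i} \<and> (1 - P i) * (g a * g b) * (1 + P i) \<in> J"
    by (rule exI[of _ "[0..<i]"], rule exI[of _ i], rule exI[of _ "Suc i"], rule exI[of _ "[Suc (Suc i)..<n]"])
      (use upt_split_pair[OF i] assms(2)[OF i] i in auto)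
qed (use assms(1) in auto)

lemma absorbs_rev_upt:
  assumes "\<And>i k. Suc i < n \<Longrightarrow> k < n \<Longrightarrow> k \<notin> {i, Suc i} \<Longrightarrow> P i * g k = g k * P i"
    and "\<And>i. Suc i < n \<Longrightarrow> (1 - P i) * (g (Suc i) * g i) * (1 + P i) \<in> J"
  shows "absorbs (prod_list (map g (rev [0..<n])))"
proof (rule absorbs_list)
  fix i assume i: "Suc i < n"
  have "rev [0..<n] = rev [Suc (Suc i)..<n] @ [Suc i, i] @ rev [0..<i]"
    by (subst upt_split_pair[OF i]) simp
  then show "\<exists>ys a b zs. rev [0..<n] = ys @ [a, b] @ zs \<and>
      set ys \<union> set zs \<subseteq> {..<n} - {i, Suc i} \<and> (1 - P i) * (g a * g b) * (1 + P i) \<in> J"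
    by (intro exI[of _ "rev [Suc (Suc i)..<n]"] exI[of _ i] exI[of _ "Suc i"] exI[of _ "rev [0..<i]"])
      (use assms(2)[OF i] i in auto)
qed (use assms(1) in auto)

end

subsection \<open>Rectangular products\<close>

text \<open>The product of a rectangular array, row by row; a row runs through \<open>xs\<close> for a fixed element of \<open>ys\<close>.\<close>

definition rect :: "('i \<Rightarrow> 'j \<Rightarrow> 'b::monoid_mult) \<Rightarrow> 'i list \<Rightarrow> 'j list \<Rightarrow> 'b"
  where "rect g xs ys = prod_list (map (\<lambda>j. prod_list (map (\<lambda>i. g i j) xs)) ys)"

text \<open>Two entries commute unless they share a row or a column, so the array may also be multiplied column by column.
  The fusion relations of the first group of sites concern adjacent entries of a row, those of the second
  group adjacent entries of a column.\<close>

lemma rect_columns: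
  assumes "\<And>i i' j j'. {i, i'} \<subseteq> set xs \<Longrightarrow> {j, j'} \<subseteq> set ys \<Longrightarrow> i \<noteq> i' \<Longrightarrow> j \<noteq> j' \<Longrightarrow>
      g i j * g i' j' = g i' j' * g i j"
    and "distinct xs" "distinct ys"
  shows "rect g xs ys = prod_list (map (\<lambda>i. prod_list (map (g i) ys)) xs)"
  using assms(3,1)
proof (induction ys)
  case Nil
  show ?case by (induction xs) (auto simp: rect_def)
next
  case (Cons j ys)
  note com = Cons.prems(2)
  have *: "prod_list (map (\<lambda>i. g i j * prod_list (map (g i) ys)) zs) =
      prod_list (map (\<lambda>i. g i j) zs) * prod_list (map (\<lambda>i. prod_list (map (g i) ys)) zs)"
    if "distinct zs" "set zs \<subseteq> set xs" for zs
    using that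
  proof (induction zs)
    case (Cons i zs)
    have "prod_list (map (g i) ys) * prod_list (map (\<lambda>i. g i j) zs)
        = prod_list (map (\<lambda>i. g i j) zs) * prod_list (map (g i) ys)"
    proof (rule prod_list_commute)
      fix y assume "y \<in> set (map (\<lambda>i. g i j) zs)"
      then obtain i' where i': "y = g i' j" "i' \<in> set zs" by auto
      then have "y * prod_list (map (g i) ys) = prod_list (map (g i) ys) * y"
        using Cons.prems \<open>distinct (j # ys)\<close> i' com[of i' i j]
        by (intro prod_list_commute) auto
      then show "prod_list (map (g i) ys) * y = y * prod_list (map (g i) ys)" by simp
    qed
    then have "g i j * (prod_list (map (g i) ys) * prod_list (map (\<lambda>i. g i j) zs))
        * prod_list (map (\<lambda>i. prod_list (map (g i) ys)) zs)
      = g i j * (prod_list (map (\<lambda>i. g i j) zs) * prod_list (map (g i) ys))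
        * prod_list (map (\<lambda>i. prod_list (map (g i) ys)) zs)" by (simp only:)
    then show ?case using Cons by (simp add: mult.assoc)
  qed simp
  have "rect g xs (j # ys) = prod_list (map (\<lambda>i. g i j) xs) * rect g xs ys"
    by (simp add: rect_def)
  moreover have "rect g xs ys = prod_list (map (\<lambda>i. prod_list (map (g i) ys)) xs)"
    using Cons.prems(1) by (intro Cons.IH) (auto intro!: com)
  ultimately show ?case using *[of xs] assms(2) by simp
qed

section \<open>Commuting traces from an exchange relation\<close>

locale exchange = two_sided J for J :: "'b::ring_1 set" +
  fixes n m :: nat and t u :: "nat \<Rightarrow> 'b" and r :: "nat \<Rightarrow> nat \<Rightarrow> 'b"
  assumes exchange: "i < n \<Longrightarrow> j < m \<Longrightarrow> r i j * t i * u j \<approx> u j * t i * r i j"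
    and r_t: "i < n \<Longrightarrow> j < m \<Longrightarrow> i' < n \<Longrightarrow> i \<noteq> i' \<Longrightarrow> r i j * t i' = t i' * r i j"
    and r_u: "i < n \<Longrightarrow> j < m \<Longrightarrow> j' < m \<Longrightarrow> j \<noteq> j' \<Longrightarrow> r i j * u j' = u j' * r i j"
begin

abbreviation "row xs j \<equiv> prod_list (map (\<lambda>i. r i j) xs)"

text \<open>\<open>u j\<close> moves to the left past the last \<open>t i\<close>, then past the one before it, and so on; at each step the
  corresponding \<open>r i j\<close> passes to the right.\<close>

lemma exchange_row:
  assumes "distinct xs" "set xs \<subseteq> {..<n}" "j < m"
  shows "row xs j * prod_list (map t xs) * u j \<approx> u j * prod_list (map t xs) * row xs j"
  using assms(1,2)
proof (induction xs rule: rev_induct)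
  case (snoc i xs)
  define X T where "X = row xs j" and "T = prod_list (map t xs)"
  have rT: "r i j * T = T * r i j" and Xt: "t i * X = X * t i"
    unfolding T_def X_def using snoc.prems assms(3) by (auto intro!: prod_list_commute r_t r_t[symmetric])
  have "row (xs @ [i]) j * prod_list (map t (xs @ [i])) * u j = X * (r i j * T) * t i * u j"
    by (simp add: X_def T_def mult.assoc)
  also have "\<dots> = X * T * (r i j * t i * u j)"
    unfolding rT by (simp add: mult.assoc)
  also have "X * T * (r i j * t i * u j) \<approx> X * T * (u j * t i * r i j)"
    using snoc.prems assms(3) by (intro cng_l exchange) auto
  also have "X * T * (u j * t i * r i j) = (X * T * u j) * (t i * r i j)"
    by (simp add: mult.assoc)
  also have "(X * T * u j) * (t i * r i j) \<approx> (u j * T * X) * (t i * r i j)"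
    using snoc by (intro cng_r) (simp add: X_def T_def)
  also have "(u j * T * X) * (t i * r i j) = u j * T * (t i * X) * r i j"
    unfolding Xt by (simp add: mult.assoc)
  also have "\<dots> = u j * prod_list (map t (xs @ [i])) * row (xs @ [i]) j"
    by (simp add: X_def T_def mult.assoc)
  finally show ?case .
qed simp

text \<open>The rows appear in reverse order because \<open>row xs j\<close> must act on \<open>u j\<close> after the earlier \<open>u\<close> have already moved
  to the left.\<close>

lemma exchange_rect:
  assumes "distinct xs" "set xs \<subseteq> {..<n}" "distinct ys" "set ys \<subseteq> {..<m}"
  shows "rect r xs (rev ys) * prod_list (map t xs) * prod_list (map u ys)
    \<approx> prod_list (map u ys) * prod_list (map t xs) * rect r xs (rev ys)"
  using assms(3,4)
proof (induction ys rule: rev_induct)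
  case (snoc j ys)
  define R X T V where "R = rect r xs (rev ys)" and "X = row xs j"
    and "T = prod_list (map t xs)" and "V = prod_list (map u ys)"
  have XV: "X * V = V * X"
    unfolding V_def
  proof (rule prod_list_commute)
    fix y assume "y \<in> set (map u ys)"
    then have "y * X = X * y"
      unfolding X_def using snoc.prems assms(2) by (intro prod_list_commute) (auto intro!: r_u[symmetric])
    then show "X * y = y * X" by simp
  qed
  have Ru: "R * u j = u j * R"
  proof -
    have "u j * row xs j' = row xs j' * u j" if "j' \<in> set ys" for j'
      using that snoc.prems assms(2) by (intro prod_list_commute) (auto intro!: r_u[symmetric])
    then have "u j * R = R * u j"
      unfolding R_def rect_def by (intro prod_list_commute) auto
    then show ?thesis by simp
  qed
  have rect: "rect r xs (rev (ys @ [j])) = X * R"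
    by (simp add: rect_def X_def R_def)
  have "X * R * T * (V * u j) = X * (R * T * V) * u j" by (simp add: mult.assoc)
  also have "X * (R * T * V) * u j \<approx> X * (V * T * R) * u j"
    using snoc by (intro cng_r cng_l) (simp add: R_def T_def V_def)
  also have "X * (V * T * R) * u j = (X * V) * T * (R * u j)" by (simp add: mult.assoc)
  also have "\<dots> = V * (X * T * u j) * R" unfolding XV Ru by (simp add: mult.assoc)
  also have "V * (X * T * u j) * R \<approx> V * (u j * T * X) * R"
    using exchange_row[OF assms(1,2), of j] snoc.prems by (intro cng_r cng_l) (simp add: X_def T_def)
  also have "V * (u j * T * X) * R = (V * u j) * T * (X * R)" by (simp add: mult.assoc)
  finally show ?case unfolding rect by (simp add: T_def V_def)
qed (simp add: rect_def)

end

text \<open>\<open>N\<close> is to be the set of elements whose trace vanishes modulo an ideal.\<close>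

locale trace_like = two_sided J for J :: "'b::ring_1 set" +
  fixes N :: "'b set"
  assumes N_add: "a \<in> N \<Longrightarrow> b \<in> N \<Longrightarrow> a + b \<in> N" and J_N: "J \<subseteq> N"
begin

text \<open>The coefficients of \<open>\<T>\<close> do not commute, so the trace is cyclic only with respect to special elements; these
  are closed under sums and products.\<close>

definition cyclic :: "'b \<Rightarrow> bool"
  where "cyclic S \<longleftrightarrow> (\<forall>X. X * S - S * X \<in> N)"

lemma cyclic_mult:
  assumes "cyclic S" "cyclic T"
  shows "cyclic (S * T)"
  unfolding cyclic_def
proof
  fix X
  have "(X * S) * T - T * (X * S) \<in> N" "(T * X) * S - S * (T * X) \<in> N"
    using assms by (simp_all add: cyclic_def)
  from N_add[OF this] show "X * (S * T) - (S * T) * X \<in> N" by (simp add: mult.assoc)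
qed

lemma cyclic_add: "cyclic S \<Longrightarrow> cyclic T \<Longrightarrow> cyclic (S + T)"
  unfolding cyclic_def
proof
  fix X
  assume "\<forall>X. X * S - S * X \<in> N" "\<forall>X. X * T - T * X \<in> N"
  then have "(X * S - S * X) + (X * T - T * X) \<in> N" by (blast intro: N_add)
  then show "X * (S + T) - (S + T) * X \<in> N" by (simp add: algebra_simps)
qed

lemma cyclic_central: "(\<And>X. S * X = X * S) \<Longrightarrow> cyclic S"
  using J_N zero_mem by (auto simp: cyclic_def)

lemma cyclic_prod_list: "(\<And>S. S \<in> set Ss \<Longrightarrow> cyclic S) \<Longrightarrow> cyclic (prod_list Ss)"
proof (induction Ss)
  case Nil
  show ?case using J_N zero_mem by (auto simp: cyclic_def)
qed (auto intro: cyclic_mult)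

text \<open>Inverse to each other up to a central factor that can be cancelled under the trace.\<close>

definition inv_pair :: "'b \<Rightarrow> 'b \<Rightarrow> bool"
  where "inv_pair a b \<longleftrightarrow> (\<exists>F. (\<forall>X. F * X = X * F) \<and> (\<forall>X. F * X \<in> N \<longrightarrow> X \<in> N) \<and> a * b = F \<and> b * a = F)"

lemma inv_pair_mult:
  assumes "inv_pair a b" "inv_pair c d"
  shows "inv_pair (a * c) (d * b)"
proof -
  obtain F where F: "\<forall>X. F * X = X * F" "\<forall>X. F * X \<in> N \<longrightarrow> X \<in> N" "a * b = F" "b * a = F"
    using assms(1) by (auto simp: inv_pair_def)
  obtain G where G: "\<forall>X. G * X = X * G" "\<forall>X. G * X \<in> N \<longrightarrow> X \<in> N" "c * d = G" "d * c = G"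
    using assms(2) by (auto simp: inv_pair_def)
  have "a * c * (d * b) = a * (c * d) * b" by (simp add: mult.assoc)
  also have "\<dots> = a * (b * G)" unfolding G(3) mult.assoc G(1)[rule_format, of b] ..
  also have "\<dots> = F * G" unfolding F(3)[symmetric] mult.assoc ..
  finally have 1: "a * c * (d * b) = F * G" .
  have "d * b * (a * c) = d * (b * a) * c" by (simp add: mult.assoc)
  also have "\<dots> = F * (d * c)" unfolding F(4) F(1)[rule_format, of d, symmetric] mult.assoc ..
  also have "\<dots> = F * G" unfolding G(4) ..
  finally have 2: "d * b * (a * c) = F * G" .
  have "F * G * X = X * (F * G)" for X
  proof -
    have "F * G * X = F * (X * G)" unfolding mult.assoc G(1)[rule_format, of X] ..
    also have "\<dots> = X * G * F" by (rule F(1)[rule_format])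
    also have "\<dots> = X * (F * G)" unfolding mult.assoc F(1)[rule_format, of G] ..
    finally show ?thesis .
  qed
  moreover have "X \<in> N" if "F * G * X \<in> N" for X
    using F(2)[rule_format, of "G * X"] G(2)[rule_format, of X] that unfolding mult.assoc by blast
  ultimately show ?thesis using 1 2 unfolding inv_pair_def by blast
qed

lemma inv_pair_prod_list:
  assumes "\<And>x. x \<in> set xs \<Longrightarrow> inv_pair (g x) (g' x)"
  shows "inv_pair (prod_list (map g xs)) (prod_list (map g' (rev xs)))"
  using assms by (induction xs) (auto intro: inv_pair_mult simp: inv_pair_def[of 1 1])

lemma inv_pair_rect:
  assumes "\<And>i j. i \<in> set xs \<Longrightarrow> j \<in> set ys \<Longrightarrow> inv_pair (g i j) (g' i j)"
  shows "inv_pair (rect g xs ys) (rect g' (rev xs) (rev ys))"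
  unfolding rect_def using assms by (intro inv_pair_prod_list) auto

text \<open>\<open>B\<close> is the product of the two antisymmetrizers. First \<open>R'\<close> is introduced next to \<open>R\<close> at the cost of
  a factor \<open>F\<close>, the exchange relation moves \<open>R\<close> to the right end, and \<open>B\<close> can be inserted everywhere on the right
  of \<open>R'\<close>, \<open>V T\<close> and \<open>R\<close>. Then \<open>B R B\<close> goes around the trace and meets \<open>R'\<close> again. Absorption is needed
  for both \<open>R\<close> and \<open>R'\<close>.\<close>

theorem commute_mod_trace:
  assumes inv: "inv_pair R R'" and ex: "R * T * V \<approx> V * T * R"
    and B: "B * R' \<approx> B * R' * B" "B * R \<approx> B * R * B" "B * (V * T) \<approx> B * (V * T) * B"
      "B * B = B" and cyc: "cyclic B" "cyclic R"
  shows "B * (T * V) - B * (V * T) \<in> N"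
proof -
  obtain F where F: "\<And>X. F * X = X * F" "\<And>X. F * X \<in> N \<Longrightarrow> X \<in> N" "R' * R = F" "R * R' = F"
    using inv by (auto simp: inv_pair_def)
  define Z where "Z = V * T"
  define X where "X = B * R' * B * Z"
  have "F * (B * (T * V)) = B * R' * (R * T * V)"
  proof -
    have "F * (B * (T * V)) = (F * B) * (T * V)" by (simp add: mult.assoc)
    also have "\<dots> = B * (R' * R) * (T * V)" unfolding F(3) F(1)[of B] ..
    finally show ?thesis by (simp add: mult.assoc)
  qed
  also have "B * R' * (R * T * V) \<approx> B * R' * (Z * R)"
    using ex by (intro cng_l) (simp add: Z_def)
  also have "B * R' * (Z * R) \<approx> (B * R' * B) * (Z * R)"
    by (rule cng_r[OF B(1)])
  also have "(B * R' * B) * (Z * R) = B * R' * (B * Z) * R" by (simp add: mult.assoc)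
  also have "B * R' * (B * Z) * R \<approx> B * R' * (B * Z * B) * R"
    using B(3) by (intro cng_r cng_l) (simp add: Z_def)
  also have "B * R' * (B * Z * B) * R = X * (B * R)" by (simp add: X_def mult.assoc)
  also have "X * (B * R) \<approx> X * (B * R * B)" by (rule cng_l[OF B(2)])
  finally have 1: "F * (B * (T * V)) - X * (B * R * B) \<in> N"
    using J_N by (auto simp: cng_def)
  have 2: "X * (B * R * B) - (B * R * B) * X \<in> N"
    using cyclic_mult[OF cyclic_mult[OF cyc] cyc(1)] by (simp add: cyclic_def)
  have "(B * R * B) * X = (B * R * B) * (R' * B * Z)"
  proof -
    have "(B * R * B) * X = B * R * (B * B) * R' * B * Z" by (simp add: X_def mult.assoc)
    then show ?thesis by (simp add: B(4) mult.assoc)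
  qed
  also have "(B * R * B) * (R' * B * Z) \<approx> (B * R) * (R' * B * Z)"
    by (rule cng_r[OF cng_sym[OF B(2)]])
  also have "(B * R) * (R' * B * Z) = F * (B * Z)"
  proof -
    have "(B * R) * (R' * B * Z) = B * (R * R') * B * Z" by (simp add: mult.assoc)
    also have "\<dots> = F * (B * B) * Z" unfolding F(4) F(1)[of B, symmetric] by (simp add: mult.assoc)
    finally show ?thesis by (simp add: B(4) mult.assoc)
  qed
  finally have 3: "(B * R * B) * X - F * (B * Z) \<in> N"
    using J_N by (auto simp: cng_def)
  have "F * (B * (T * V) - B * (V * T)) \<in> N"
    using N_add[OF N_add[OF 1 2] 3] by (simp add: Z_def right_diff_distrib)
  then show ?thesis by (rule F(2))
qed

end

section \<open>Generating series with values in operators\<close>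

lemma cst_simps: "cst (A + B) = cst A + cst B" "cst (A - B) = cst A - cst B" "cst (A * B) = cst A * cst B"
  for A B :: "'a::ring_1"
  by (simp_all flip: fls_plus_const fls_minus_const)

lemma cst_sum: "cst (\<Sum>x\<in>S. F x) = (\<Sum>x\<in>S. cst (F x :: 'a::ring_1))"
  by (simp add: fls_const_sum)

lemma diff_diff_swap: "a - b - (c - d) = a - c - (b - d)" for a b c d :: "'b::ab_group_add"
  by (simp add: algebra_simps)

text \<open>Used to read off the coefficients of \<open>x\<^sup>2\<close>, \<open>x y\<close> and \<open>y\<^sup>2\<close> in products of two R-matrices.\<close>

lemma pull_central:
  fixes x y :: "'b::ring_1"
  assumes "\<And>a. x * a = a * x" "\<And>a. y * a = a * y"
  shows "p * ((x * a) * (y * b)) * z = x * y * (p * (a * (b * z)))"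
proof -
  have "p * ((x * a) * (y * b)) * z = (p * x) * (a * y) * (b * z)" by (simp add: mult.assoc)
  also have "\<dots> = (x * p) * (y * a) * (b * z)" using assms by simp
  also have "\<dots> = x * (p * y) * a * (b * z)" by (simp add: mult.assoc)
  also have "\<dots> = x * (y * p) * a * (b * z)" by (simp only: assms(2))
  finally show ?thesis by (simp add: mult.assoc)
qed

lemma cst_scalar_central:
  assumes "\<And>b. c * b = b * c"
  shows "cst (scalar c) * F = F * cst (scalar c)"
proof (rule cst_central, rule rfmat_eqI)
  show "ent (scalar c * X) f g = ent (X * scalar c) f g" for X :: "('i, 'a::ring_1) rfmat" and f g
    unfolding ent_scalar_times ent_times_scalar by (rule assms)
qed

lemma central_mult:
  fixes x y :: "'b::monoid_mult"
  assumes "\<And>b. x * b = b * x" "\<And>b. y * b = b * y"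
  shows "x * y * b = b * (x * y)"
proof -
  have "x * y * b = x * (b * y)" by (simp only: mult.assoc assms(2))
  also have "\<dots> = b * x * y" by (simp only: mult.assoc[symmetric] assms(1))
  finally show ?thesis by (simp only: mult.assoc)
qed

context sqrt_q
begin

text \<open>\<open>x\<close> and \<open>y\<close> stand for the two variables, each possibly times a power of \<open>q\<close>.\<close>

lemma fusion_series:
  fixes x y :: "('n::linorder, 'a) op fls fls"
  assumes "k \<noteq> l" "k \<noteq> r" "l \<noteq> r"
    and x: "\<And>a. x * a = a * x" and y: "\<And>a. y * a = a * y"
  shows "(1 - cst (Q k l)) * ((x * cst (U k r) - y * cst (W k r)) *
      ((x * cst (scalar (s' * s'))) * cst (U l r) - y * cst (W l r))) * (1 + cst (Q k l)) = 0"
proof -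
  define p where "p = 1 - cst (Q k l :: ('n, 'a) op)"
  define z where "z = 1 + cst (Q k l :: ('n, 'a) op)"
  define c where "c = cst (scalar (s' * s') :: ('n, 'a) op)"
  define F where "F A B = cst ((1 - Q k l) * (A k r * (B l r * (1 + Q k l :: ('n, 'a) op))))" for A B
  have F: "F A B = p * (cst (A k r) * (cst (B l r) * z))" for A B
    by (simp only: F_def p_def z_def cst_simps fls_const_1)
  have c: "c * a = a * c" for a
    unfolding c_def by (intro cst_scalar_central central_mult central_s')
  have xc: "(x * c) * a = a * (x * c)" for a
    by (rule central_mult[OF x c])
  have "p * ((x * cst (U k r) - y * cst (W k r)) * ((x * c) * cst (U l r) - y * cst (W l r))) * z
    = p * ((x * cst (U k r)) * ((x * c) * cst (U l r))) * z - p * ((x * cst (U k r)) * (y * cst (W l r))) * z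
      - (p * ((y * cst (W k r)) * ((x * c) * cst (U l r))) * z - p * ((y * cst (W k r)) * (y * cst (W l r))) * z)"
    by (simp only: left_diff_distrib right_diff_distrib diff_diff_swap)
  also have "\<dots> = x * (x * c) * F U U - x * y * F U W - (y * (x * c) * F W U - y * y * F W W)"
    by (simp only: F pull_central[OF x xc] pull_central[OF x y] pull_central[OF y xc] pull_central[OF y y])
  also have "\<dots> = - (x * y * (F U W + c * F W U))"
  proof -
    have "F U U = 0" "F W W = 0"
      using fusion_identities[OF assms(1-3)] by (simp_all add: F_def)
    moreover have "y * (x * c) * F W U = x * y * (c * F W U)"
      using x[of y] by (simp add: mult.assoc[symmetric])
    ultimately show ?thesis by (simp add: distrib_left)
  qed
  also have "F U W + c * F W U = 0"
    using fusion_identities(3)[OF assms(1-3), where 'n = 'n] unfolding F_def c_def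
    by (simp only: cst_simps(1,3)[symmetric]) simp
  finally show ?thesis by (simp add: p_def z_def c_def)
qed

lemma unitarity_series:
  fixes x y :: "('n::linorder, 'a) op fls fls"
  assumes "k \<noteq> l"
    and x: "\<And>a. x * a = a * x" and y: "\<And>a. y * a = a * y"
  shows "(x * cst (U k l) - y * cst (W k l)) * (x * cst (Rop s' s s k l) - y * cst (Rop s' s s' k l))
    = (x - y * cst (scalar (s * s))) * (x - y * cst (scalar (s' * s')))"
proof -
  define U' W' where "U' = (Rop s' s s k l :: ('n, 'a) op)" and "W' = (Rop s' s s' k l :: ('n, 'a) op)"
  note pull = pull_central[where p = 1 and z = 1, simplified]
  have c: "cst (scalar (a * a) :: ('n, 'a) op) * b = b * cst (scalar (a * a))" if "a \<in> {s, s'}" for a b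
    using that by (intro cst_scalar_central central_mult) (auto intro: central_s central_s')
  have "(x * cst (U k l) - y * cst (W k l)) * (x * cst U' - y * cst W') =
    x * x * cst (U k l * U') - x * y * cst (U k l * W' + W k l * U') + y * y * cst (W k l * W')"
  proof -
    have "y * x = x * y" using x[of y] by simp
    then show ?thesis
      by (simp only: left_diff_distrib right_diff_distrib pull[OF x x] pull[OF x y] pull[OF y x] pull[OF y y]
        cst_simps distrib_left) simp
  qed
  also have "\<dots> = x * x - x * y * (cst (scalar (s * s)) + cst (scalar (s' * s'))) + y * y"
    using unitarity_identities[OF assms(1), where 'n = 'n] unfolding U'_def W'_def
    by (simp only: scalar_add cst_simps fls_const_1 mult_1_right)
  also have "\<dots> = (x - y * cst (scalar (s * s))) * (x - y * cst (scalar (s' * s')))"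
  proof -
    define e e' where "e = cst (scalar (s * s) :: ('n, 'a) op)" and "e' = cst (scalar (s' * s') :: ('n, 'a) op)"
    have "s * s * (s' * s') = 1" by (simp add: mult.assoc)
    then have "e * e' = cst (scalar 1)" unfolding e_def e'_def cst_simps(3)[symmetric] scalar_mult[symmetric] by simp
    then have ee: "e * e' = 1" by simp
    have "y * e * x = x * (y * e)" by (rule x[symmetric])
    moreover have "y * e * (y * e') = y * (e * y) * e'" by (simp only: mult.assoc)
    moreover have "\<dots> = y * y * (e * e')" using c[of s y] by (simp add: e_def mult.assoc)
    ultimately show ?thesis unfolding e_def[symmetric] e'_def[symmetric]
      by (simp add: left_diff_distrib right_diff_distrib distrib_left ee mult.assoc)
  qed
  finally show ?thesis by (simp add: U'_def W'_def)
qed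

end


text \<open>The antisymmetrizer of the sites \<open>o'\<close>, \<dots>, \<open>o' + n - 1\<close> is a polynomial in the operators \<open>Q\<close> of adjacent sites with central
  coefficients. What it commutes with and its cyclicity under the trace only depend on this.\<close>

inductive_set Qalg :: "'a::ring_1 \<Rightarrow> 'a \<Rightarrow> nat \<Rightarrow> nat \<Rightarrow> ('n::linorder, 'a) op set"
  for s s' o' n where
    Q: "Suc i < n \<Longrightarrow> qflip s s' (o' + i) (Suc (o' + i)) \<in> Qalg s s' o' n"
  | scalar: "(\<And>x. c * x = x * c) \<Longrightarrow> scalar c \<in> Qalg s s' o' n"
  | add: "A \<in> Qalg s s' o' n \<Longrightarrow> B \<in> Qalg s s' o' n \<Longrightarrow> A + B \<in> Qalg s s' o' n"
  | mult: "A \<in> Qalg s s' o' n \<Longrightarrow> B \<in> Qalg s s' o' n \<Longrightarrow> A * B \<in> Qalg s s' o' n"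

lemma scalar_central: "(\<And>x. c * x = x * c) \<Longrightarrow> scalar c * X = X * scalar c"
  by (rule rfmat_eqI) simp

lemma Qalg_commute:
  assumes "A \<in> Qalg s s' o' n"
    and "\<And>i. Suc i < n \<Longrightarrow> qflip s s' (o' + i) (Suc (o' + i)) * X = X * qflip s s' (o' + i) (Suc (o' + i))"
  shows "A * X = X * A"
  using assms(1)
proof induction
  case (scalar c)
  then show ?case by (rule scalar_central)
next
  case (mult A B)
  have "A * B * X = A * (X * B)" by (simp only: mult.assoc mult.IH)
  also have "\<dots> = X * A * B" by (simp only: mult.assoc[symmetric] mult.IH)
  finally show ?case by (simp only: mult.assoc)
qed (use assms(2) in \<open>auto simp: algebra_simps\<close>)

subsection \<open>Partial traces\<close>

text \<open>The trace over the first \<open>L\<close> sites runs over the configurations that are constant elsewhere, one for each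
  basis vector of the \<open>L\<close>-fold tensor power.\<close>

definition blk :: "nat \<Rightarrow> (nat \<Rightarrow> 'n) set"
  where "blk L = {f. \<forall>k\<ge>L. f k = undefined}"

definition Tr :: "nat \<Rightarrow> ('n, 'a::ring_1) op \<Rightarrow> 'a"
  where "Tr L A = (\<Sum>f\<in>blk L. ent A f f)"

lemma Tr_linear [simp]: "Tr L 0 = 0" "Tr L (A + B) = Tr L A + Tr L B" "Tr L (A - B) = Tr L A - Tr L B"
  "Tr L (scalar c * A) = c * Tr L A"
  by (simp_all add: Tr_def sum.distrib sum_subtractf sum_distrib_left)

lemma sum_blk_swap_sites:
  assumes "k < L" "l < L"
  shows "(\<Sum>f\<in>blk L. F (swap_sites k l f)) = (\<Sum>f\<in>blk L. F f)"
  by (rule sum.reindex_bij_witness[of _ "swap_sites k l" "swap_sites k l"]) (use assms in \<open>auto simp: blk_def swap_sites_def\<close>)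

lemma (in sqrt_q) Tr_Q: "k < L \<Longrightarrow> l < L \<Longrightarrow> Tr L (X * Q k l) = Tr L (Q k l * X)"
proof -
  assume kl: "k < L" "l < L"
  have "Tr L (Q k l * X) = (\<Sum>f\<in>blk L. qcoeff s s' (swap_sites k l f k) (swap_sites k l f l) * ent X (swap_sites k l (swap_sites k l f)) (swap_sites k l f))"
    unfolding Tr_def ent_qflip_times by (rule sum_blk_swap_sites[OF kl, symmetric])
  also have "\<dots> = Tr L (X * Q k l)"
    unfolding Tr_def by (intro sum.cong refl) (auto simp: swap_sites_def qcoeff_central)
  finally show ?thesis by simp
qed

lemma Tr_flip: "k < L \<Longrightarrow> l < L \<Longrightarrow> Tr L (X * flip k l) = Tr L (flip k l * X)"
proof -
  assume kl: "k < L" "l < L"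
  have "Tr L (flip k l * X) = (\<Sum>f\<in>blk L. ent X (swap_sites k l (swap_sites k l f)) (swap_sites k l f))"
    unfolding Tr_def ent_flip_times by (rule sum_blk_swap_sites[OF kl, symmetric])
  then show ?thesis by (simp add: Tr_def)
qed

lemma (in sqrt_q) Tr_Rop:
  assumes "k < L" "l < L" "\<And>x. c * x = x * c"
  shows "Tr L (X * Rop s s' c k l) = Tr L (Rop s s' c k l * X)"
proof -
  have "X * (scalar c * flip k l) = scalar c * (X * flip k l)"
    using scalar_central[OF assms(3), of X] by (simp only: mult.assoc[symmetric])
  then show ?thesis
    using assms by (simp add: Rop_def left_diff_distrib right_diff_distrib distrib_left distrib_right
      Tr_Q Tr_flip mult.assoc)
qed

lemma (in sqrt_q) Tr_Qalg:
  assumes "A \<in> Qalg s s' o' n" "o' + n \<le> L"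
  shows "Tr L (X * A) = Tr L (A * X)"
  using assms(1)
proof (induction arbitrary: X)
  case (Q i)
  then show ?case using assms(2) by (intro Tr_Q) auto
next
  case (scalar c)
  then show ?case by (simp only: scalar_central)
next
  case (mult A B)
  have "Tr L (X * (A * B)) = Tr L (B * (X * A))" using mult.IH(2)[of "X * A"] by (simp only: mult.assoc)
  also have "\<dots> = Tr L (A * (B * X))" using mult.IH(1)[of "B * X"] by (simp only: mult.assoc)
  finally show ?case by (simp only: mult.assoc)
qed (simp add: distrib_left distrib_right)

section \<open>Commuting traces of fused RTT products\<close>

lemma linear_commute:
  fixes x y :: "'b::ring_1"
  assumes "\<And>a. x * a = a * x" "\<And>a. y * a = a * y" "A * Z = Z * A" "B * Z = Z * B"
  shows "(x * A - y * B) * Z = Z * (x * A - y * B)"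
proof -
  have "x * A * Z = Z * (x * A)" "y * B * Z = Z * (y * B)"
    using assms(1,2)[of Z] assms(3,4) by (simp_all add: mult.assoc) (simp_all add: mult.assoc[symmetric])
  then show ?thesis by (simp only: left_diff_distrib right_diff_distrib)
qed

context sqrt_q
begin

lemma Rop_commute_if:
  assumes "Q k l * Z = Z * Q k l" "flip k l * Z = Z * flip k l" "c \<in> {s, s'}"
  shows "Rop s s' c k l * Z = Z * Rop s s' c k l"
proof -
  have c: "scalar c * B = B * scalar c" for B :: "('n, 'a) op"
    using assms(3) by (intro scalar_central) (auto intro: central_s central_s')
  have "scalar c * flip k l * Z = Z * (scalar c * flip k l)"
    by (simp only: mult.assoc assms(2)) (simp only: mult.assoc[symmetric] c[of Z])
  then show ?thesis using assms(1) by (simp add: Rop_def algebra_simps)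
qed

definition is_antisym :: "nat \<Rightarrow> nat \<Rightarrow> ('n::linorder, 'a) op \<Rightarrow> bool"
  where "is_antisym o' n A \<longleftrightarrow> A * A = A \<and> A \<in> Qalg s s' o' n
    \<and> (\<forall>i. Suc i < n \<longrightarrow> A * Q (o' + i) (Suc (o' + i)) = - A)
    \<and> (\<exists>Y. 1 - A = (\<Sum>i | Suc i < n. (1 + Q (o' + i) (Suc (o' + i))) * Y i))"

end

context rtt
begin

sublocale fI: two_sided "opI.flsI :: ('n, 'a) op fls set"
  by (rule opI.two_sided_flsI)

sublocale ffI: two_sided "fI.flsI :: ('n, 'a) op fls fls set"
  by (rule fI.two_sided_flsI)

abbreviation KK :: "('n, 'a) op fls fls set" where "KK \<equiv> fI.flsI"

lemma KK_iff: "F \<in> KK \<longleftrightarrow> (\<forall>a b. cf2 F a b \<in> opI)"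
  by (simp add: fI.flsI_def) (simp add: opI.flsI_def cf2_def)

text \<open>\<open>\<T>(z q\<^bsup>-i\<^esup>)\<close> acting on site \<open>k\<close>.\<close>

definition Tser :: "nat \<Rightarrow> nat \<Rightarrow> ('n, 'a) op fls"
  where "Tser k i = ser (\<lambda>a. scalar (\<chi> (- 2 * int i * a)) * S k a)"

lemma cf_Tser: "cf (Tser k i) a = scalar (\<chi> (- 2 * int i * a)) * S k a"
  unfolding Tser_def by (rule cf_ser[of B]) (simp add: S_bound)

lemma scalar_chi_commute: "scalar (\<chi> a) * Z = Z * scalar (\<chi> a)"
  by (rule scalar_central) (rule chi_central)

lemma scalar_chi_move: "A * (scalar (\<chi> c) * Z) = scalar (\<chi> c) * (A * Z)"
  by (simp only: mult.assoc[symmetric] scalar_chi_commute[of c A])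

lemma scalar_chi_left: "scalar (\<chi> a) * (scalar (\<chi> b) * Z) = scalar (\<chi> (a + b)) * Z"
  by (simp add: chi_add scalar_mult mult.assoc)

text \<open>The arguments \<open>x q\<^bsup>-i\<^esup>\<close> and \<open>y q\<^bsup>-j\<^esup>\<close> of the factors of the two fused products.\<close>

definition X :: "nat \<Rightarrow> ('n, 'a) op fls fls" where "X i = zx * cst (scalar (\<chi> (- 2 * int i)))"
definition Y :: "nat \<Rightarrow> ('n, 'a) op fls fls" where "Y j = zy * cst (scalar (\<chi> (- 2 * int j)))"

lemma X_central: "X i * F = F * X i" and Y_central: "Y i * F = F * Y i"
  unfolding X_def Y_def by (intro central_mult zx_central zy_central cst_scalar_central chi_central)+

lemma X_Suc: "X (Suc i) = X i * cst (scalar (\<chi> (-1) * \<chi> (-1)))"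
  and Y_Suc: "Y (Suc i) = Y i * cst (scalar (\<chi> (-1) * \<chi> (-1)))"
  and X_pred: "X i = X (Suc i) * cst (scalar (\<chi> 1 * \<chi> 1))"
  and Y_pred: "Y i = Y (Suc i) * cst (scalar (\<chi> 1 * \<chi> 1))"
  unfolding X_def Y_def mult.assoc cst_simps(3)[symmetric] scalar_mult[symmetric] chi_mult
  by (simp_all add: algebra_simps)

text \<open>The R-matrix between site \<open>i\<close> of the first and site \<open>n + j\<close> of the second group, at the arguments of these sites;
  \<open>r'\<close> is its inverse up to a factor.\<close>

definition r :: "nat \<Rightarrow> nat \<Rightarrow> nat \<Rightarrow> ('n, 'a) op fls fls"
  where "r n i j = X i * cst (U i (n + j)) - Y j * cst (W i (n + j))"

definition r' :: "nat \<Rightarrow> nat \<Rightarrow> nat \<Rightarrow> ('n, 'a) op fls fls"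
  where "r' n i j = X i * cst (inv.U i (n + j)) - Y j * cst (inv.W i (n + j))"

text \<open>Rescaling \<open>x\<close> and \<open>y\<close> by powers of \<open>q\<close> multiplies the coefficient of \<open>x\<^sup>a y\<^sup>b\<close> in the RTT relation by a common
  factor, here \<open>\<chi> e\<close>.\<close>

lemma exchange_series:
  assumes "i < n"
  shows "ffI.cng (r n i j * outer (Tser i i) * fls_const (Tser (n + j) j))
    (fls_const (Tser (n + j) j) * outer (Tser i i) * r n i j)"
  unfolding ffI.cng_def KK_iff
proof (intro allI)
  fix a b
  define F where "F = outer (Tser i i)"
  define G where "G = fls_const (Tser (n + j) j)"
  define k l where "k = i" and "l = n + j"
  have kl: "k \<noteq> l" using assms by (simp add: k_def l_def)
  define e where "e = - 2 * int i * a - 2 * int j * b"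
  have L: "r n i j * F * G = X i * (cst (U k l) * (F * G)) - Y j * (cst (W k l) * (F * G))"
    by (simp add: r_def k_def l_def algebra_simps)
  have R: "G * F * r n i j = X i * (G * F * cst (U k l)) - Y j * (G * F * cst (W k l))"
  proof -
    have "G * F * (X i * A) = X i * (G * F * A)" "G * F * (Y j * A) = Y j * (G * F * A)" for A
      using X_central[of i "G * F"] Y_central[of j "G * F"] by (simp_all only: mult.assoc[symmetric])
    then show ?thesis by (simp only: r_def k_def l_def right_diff_distrib)
  qed
  have FG: "cf2 (F * G) a b = scalar (\<chi> (- 2 * int i * a + - 2 * int j * b)) * (S k a * S l b)"
    "cf2 (G * F) a b = scalar (\<chi> (- 2 * int i * a + - 2 * int j * b)) * (S l b * S k a)" for a b
    unfolding F_def G_def k_def l_def cf2_outer_const cf_Tser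
      mult.assoc[of "scalar _"] scalar_chi_move[of "S _ _"] scalar_chi_left
    by (simp_all only: add.commute)
  have idx: "- 2 * int i + (- 2 * int i * (a - 1) + - 2 * int j * b) = e"
    "- 2 * int j + (- 2 * int i * a + - 2 * int j * (b - 1)) = e"
    by (simp_all add: e_def algebra_simps)
  have "cf2 (r n i j * F * G - G * F * r n i j) a b = scalar (\<chi> e) *
    (U k l * (S k (a - 1) * S l b) - W k l * (S k a * S l (b - 1))
     - (S l b * S k (a - 1) * U k l - S l (b - 1) * S k a * W k l))"
    unfolding L R X_def Y_def cf2_simps mult.assoc[of zx] mult.assoc[of zy] FG scalar_chi_move[of "U k l"] scalar_chi_move[of "W k l"] scalar_chi_left
      mult.assoc[of "scalar (\<chi> _)"] idx
    by (simp only: right_diff_distrib)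
  then show "cf2 (r n i j * F * G - G * F * r n i j) a b \<in> opI"
    using opI.l_mem[OF rtt_op[OF kl, of "a - 1" "b - 1"], of "scalar (\<chi> e)"] by simp
qed

lemma fusion_Tser:
  assumes "k \<noteq> l"
  shows "(1 - Q k l) * cf (Tser k i * Tser l (Suc i)) c * (1 + Q k l) \<in> (opI :: ('n, 'a) op set)"
proof -
  have "cf (Tser k i * Tser l (Suc i)) c = (\<Sum>b\<in>{c - B..B}. cf (Tser k i) (c - b) * cf (Tser l (Suc i)) b)"
    by (rule cf_times) (simp_all add: cf_Tser S_bound)
  also have "\<dots> = (\<Sum>b\<in>{c - B..B}. scalar (\<chi> (- 2 * int i * c)) * (scalar (\<chi> (- 2 * b)) * (S k (c - b) * S l b)))"
  proof (intro sum.cong refl)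
    fix b
    have "- 2 * int i * (c - b) + - 2 * int (Suc i) * b = - 2 * int i * c + - 2 * b"
      by (simp add: algebra_simps)
    then show "cf (Tser k i) (c - b) * cf (Tser l (Suc i)) b =
        scalar (\<chi> (- 2 * int i * c)) * (scalar (\<chi> (- 2 * b)) * (S k (c - b) * S l b))"
      by (simp only: cf_Tser mult.assoc scalar_chi_move[of "S _ _"] scalar_chi_left)
  qed
  also have "\<dots> = scalar (\<chi> (- 2 * int i * c)) * (\<Sum>b\<in>{c - B..B}. scalar (\<chi> (- 2 * b)) * (S k (c - b) * S l b))"
    by (simp only: sum_distrib_left)
  finally have "(1 - Q k l) * cf (Tser k i * Tser l (Suc i)) c * (1 + Q k l) = scalar (\<chi> (- 2 * int i * c)) *
     ((1 - Q k l) * (\<Sum>b\<in>{c - B..B}. scalar (\<chi> (- 2 * b)) * (S k (c - b) * S l b)) * (1 + Q k l))"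
    using scalar_chi_commute[of "- 2 * int i * c" "1 - Q k l :: ('n, 'a) op"] by (simp only: mult.assoc[symmetric])
  then show ?thesis using opI.l_mem[OF fusion_op[OF assms]] by simp
qed

lemma fusion_series_T:
  assumes "k \<noteq> l"
  shows "(1 - cst (Q k l)) * (outer (Tser k i) * outer (Tser l (Suc i))) * (1 + cst (Q k l)) \<in> KK"
    and "(1 - cst (Q k l)) * (fls_const (Tser k i) * fls_const (Tser l (Suc i))) * (1 + cst (Q k l)) \<in> KK"
proof -
  have c: "1 - cst A = cst (1 - A)" "1 + cst A = cst (1 + A)" for A :: "('n, 'a) op"
    by (simp_all only: cst_simps fls_const_1)
  show "(1 - cst (Q k l)) * (outer (Tser k i) * outer (Tser l (Suc i))) * (1 + cst (Q k l)) \<in> KK"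
    unfolding c KK_iff outer_mult[symmetric] cf2_simps using fusion_Tser[OF assms, of i] by (simp add: cf2_def)
  show "(1 - cst (Q k l)) * (fls_const (Tser k i) * fls_const (Tser l (Suc i))) * (1 + cst (Q k l)) \<in> KK"
    unfolding c KK_iff fls_const_mult_const cf2_simps using fusion_Tser[OF assms, of i] by (simp add: cf2_def)
qed

lemma Tser_commute:
  assumes "\<And>a. A * S k a = S k a * A"
  shows "cst A * outer (Tser k i) = outer (Tser k i) * cst A"
    and "cst A * fls_const (Tser k i) = fls_const (Tser k i) * cst A"
proof -
  have A: "A * cf (Tser k i) a = cf (Tser k i) a * A" for a
    by (simp only: cf_Tser mult.assoc scalar_chi_move[of A] assms)
  then show "cst A * outer (Tser k i) = outer (Tser k i) * cst A"
    by (intro cf2_eqI) (simp add: cf2_def)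
  have "fls_const A * Tser k i = Tser k i * fls_const A"
    using A by (intro cf_eqI) simp
  then show "cst A * fls_const (Tser k i) = fls_const (Tser k i) * cst A"
    by (simp only: fls_const_mult_const)
qed

lemma Q_S: "k \<notin> {i, j} \<Longrightarrow> Q i j * S k a = S k a * Q i j"
  and flip_S: "k \<notin> {i, j} \<Longrightarrow> flip i j * S k a = S k a * flip i j"
  unfolding S_def using Q_site_commute[of k i j] flip_site_commute[of k i j] by metis+

lemma Rop_S:
  assumes "k \<notin> {i, j}"
  shows "U i j * S k a = S k a * U i j" "W i j * S k a = S k a * W i j"
  by (rule Rop_commute_if[OF Q_S[OF assms] flip_S[OF assms]]; simp)+

lemma Rop_disjoint:
  assumes "k \<notin> {i, j}" "l \<notin> {i, j}" "c \<in> {\<chi> 1, \<chi> (-1)}" "d \<in> {\<chi> 1, \<chi> (-1)}"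
  shows "Rop (\<chi> 1) (\<chi> (-1)) c k l * Q i j = (Q i j * Rop (\<chi> 1) (\<chi> (-1)) c k l :: ('n, 'a) op)"
    and "Rop (\<chi> 1) (\<chi> (-1)) c k l * flip i j = (flip i j * Rop (\<chi> 1) (\<chi> (-1)) c k l :: ('n, 'a) op)"
    and "Rop (\<chi> 1) (\<chi> (-1)) c k l * Rop (\<chi> 1) (\<chi> (-1)) d i j
      = (Rop (\<chi> 1) (\<chi> (-1)) d i j * Rop (\<chi> 1) (\<chi> (-1)) c k l :: ('n, 'a) op)"
proof -
  have sym: "i \<notin> {k, l}" "j \<notin> {k, l}" using assms by auto
  show 1: "Rop (\<chi> 1) (\<chi> (-1)) c k l * Q i j = (Q i j * Rop (\<chi> 1) (\<chi> (-1)) c k l :: ('n, 'a) op)"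
    by (rule Rop_commute_if[OF disjoint_commute(1)[OF assms(1,2)] disjoint_commute(2)[OF sym, symmetric] assms(3)])
  show 2: "Rop (\<chi> 1) (\<chi> (-1)) c k l * flip i j = (flip i j * Rop (\<chi> 1) (\<chi> (-1)) c k l :: ('n, 'a) op)"
    by (rule Rop_commute_if[OF disjoint_commute(2,3)[OF assms(1,2)] assms(3)])
  show "Rop (\<chi> 1) (\<chi> (-1)) c k l * Rop (\<chi> 1) (\<chi> (-1)) d i j
      = (Rop (\<chi> 1) (\<chi> (-1)) d i j * Rop (\<chi> 1) (\<chi> (-1)) c k l :: ('n, 'a) op)"
    by (rule Rop_commute_if[OF 1[symmetric] 2[symmetric] assms(4), symmetric])
qed

lemma inv_U: "inv.U k l = Rop (\<chi> 1) (\<chi> (-1)) (\<chi> 1) l k"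
  and inv_W: "inv.W k l = Rop (\<chi> 1) (\<chi> (-1)) (\<chi> (-1)) l k"
  and inv_Q: "inv.Q k l = Q l k"
  by (simp_all add: Rop_commute[of _ _ _ l k] qflip_commute[of _ _ l k])

lemma r'_eq: "r' n i j = X i * cst (W (n + j) i) - Y j * cst (U (n + j) i)"
  unfolding r'_def inv_U inv_W ..

lemma r_T:
  assumes "i < n" "i' < n" "i \<noteq> i'"
  shows "r n i j * outer (Tser i' l) = outer (Tser i' l) * r n i j"
proof -
  have "i' \<notin> {i, n + j}" using assms by auto
  then show ?thesis
    unfolding r_def by (intro linear_commute X_central Y_central Tser_commute Rop_S)
qed

lemma r_U:
  assumes "i < n" "j \<noteq> j'"
  shows "r n i j * fls_const (Tser (n + j') l) = fls_const (Tser (n + j') l) * r n i j"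
proof -
  have "n + j' \<notin> {i, n + j}" using assms by auto
  then show ?thesis
    unfolding r_def by (intro linear_commute X_central Y_central Tser_commute Rop_S)
qed

lemma cst_commute: "A * C = C * A \<Longrightarrow> cst A * cst C = cst C * cst A" for A C :: "'b::ring_1"
  by (simp only: cst_simps(3)[symmetric])

lemma r_Q:
  assumes "k \<notin> {i, n + j}" "l \<notin> {i, n + j}"
  shows "cst (Q k l) * r n i j = r n i j * cst (Q k l)" "cst (Q k l) * r' n i j = r' n i j * cst (Q k l)"
proof -
  have 1: "i \<notin> {k, l}" "n + j \<notin> {k, l}" using assms by auto
  show "cst (Q k l) * r n i j = r n i j * cst (Q k l)"
    unfolding r_def
    by (rule sym, intro linear_commute X_central Y_central cst_commute Rop_disjoint[OF 1, where d = "\<chi> 1"]) auto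
  show "cst (Q k l) * r' n i j = r' n i j * cst (Q k l)"
    unfolding r'_eq
    by (rule sym, intro linear_commute X_central Y_central cst_commute Rop_disjoint[OF 1(2,1), where d = "\<chi> 1"]) auto
qed

lemma r_r:
  assumes "i < n" "i' < n" "i \<noteq> i'" "j \<noteq> j'"
  shows "r n i j * r n i' j' = r n i' j' * r n i j" "r' n i j * r' n i' j' = r' n i' j' * r' n i j"
proof -
  have 1: "i \<notin> {i', n + j'}" "n + j \<notin> {i', n + j'}" using assms by auto
  have 2: "i \<notin> {n + j', i'}" "n + j \<notin> {n + j', i'}" using assms by auto
  show "r n i j * r n i' j' = r n i' j' * r n i j"
    unfolding r_def
    by (intro linear_commute X_central Y_central cst_commute
      linear_commute[OF X_central Y_central, symmetric] Rop_disjoint(3)[OF 1, symmetric]) auto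
  show "r' n i j * r' n i' j' = r' n i' j' * r' n i j"
    unfolding r'_eq
    by (intro linear_commute X_central Y_central cst_commute
      linear_commute[OF X_central Y_central, symmetric] Rop_disjoint(3)[OF 2(2,1), symmetric]) auto
qed

text \<open>The next argument on the right is \<open>q\<^sup>-\<^sup>1\<close> times the previous one, as \<open>fusion_series\<close> demands. For \<open>r'\<close>
  the order of the factors is reversed while \<open>s\<close> and \<open>s\<^sup>-\<^sup>1\<close> are exchanged, so that again the ratio is right.\<close>

lemma fusion_r:
  assumes "Suc i < n"
  shows "(1 - cst (Q i (Suc i))) * (r n i j * r n (Suc i) j) * (1 + cst (Q i (Suc i))) = 0"
    and "(1 - cst (Q i (Suc i))) * (r' n (Suc i) j * r' n i j) * (1 + cst (Q i (Suc i))) = 0"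
proof -
  have d: "i \<noteq> Suc i" "i \<noteq> n + j" "Suc i \<noteq> n + j" "Suc i \<noteq> i" using assms by auto
  show "(1 - cst (Q i (Suc i))) * (r n i j * r n (Suc i) j) * (1 + cst (Q i (Suc i))) = 0"
    unfolding r_def X_Suc by (rule fusion_series[OF d(1-3) X_central Y_central])
  show "(1 - cst (Q i (Suc i))) * (r' n (Suc i) j * r' n i j) * (1 + cst (Q i (Suc i))) = 0"
    unfolding r'_def X_pred[of i] inv_Q[of "Suc i" i, symmetric]
    by (rule inv.fusion_series[OF d(4,3,2) X_central Y_central])
qed

text \<open>\<open>R\<^sub>1\<^sub>2(x, y; s) = - R\<^sub>2\<^sub>1(y, x; s\<^sup>-\<^sup>1)\<close> reduces fusion in the second tensor factor to fusion in the first.\<close>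

lemma fusion_r_right:
  fixes i j n :: nat
  assumes "i < n"
  defines "q \<equiv> cst (Q (n + j) (Suc (n + j)) :: ('n, 'a) op)"
  shows "(1 - q) * (r n i (Suc j) * r n i j) * (1 + q) = 0"
    and "(1 - q) * (r' n i j * r' n i (Suc j)) * (1 + q) = 0"
proof -
  have d: "n + j \<noteq> Suc (n + j)" "n + j \<noteq> i" "Suc (n + j) \<noteq> i" "Suc (n + j) \<noteq> n + j" using assms by auto
  have neg: "(a - b) * (c - e) = (b - a) * (e - c)" for a b c e :: "('n, 'a) op fls fls"
    by (simp add: algebra_simps)
  have r: "r n i j = X i * cst (inv.W (n + j) i) - Y j * cst (inv.U (n + j) i)" for j
    unfolding r_def inv_U inv_W ..
  show "(1 - q) * (r n i (Suc j) * r n i j) * (1 + q) = 0"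
    unfolding r add_Suc_right neg[of "X i * _"] Y_pred[of j] q_def inv_Q[of "Suc _", symmetric]
    by (rule inv.fusion_series[OF d(4,3,2) Y_central X_central])
  show "(1 - q) * (r' n i j * r' n i (Suc j)) * (1 + q) = 0"
    unfolding r'_eq add_Suc_right neg[of "X i * _"] Y_Suc q_def
    by (rule fusion_series[OF d(1-3) Y_central X_central])
qed

lemma r_r':
  fixes i j n :: nat
  assumes "i < n"
  defines "F \<equiv> (X i - Y j * cst (scalar (\<chi> 2))) * (X i - Y j * cst (scalar (\<chi> (-2))))"
  shows "r n i j * r' n i j = F" "r' n i j * r n i j = F"
proof -
  have d: "i \<noteq> n + j" using assms by auto
  show "r n i j * r' n i j = F"
    using unitarity_series[OF d X_central[of i] Y_central[of j]] by (simp add: r_def r'_def F_def chi_mult)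
  have c: "(X i - Y j * cst (scalar (\<chi> a))) * Z = Z * (X i - Y j * cst (scalar (\<chi> a)))" for a Z
    using linear_commute[OF X_central[of i] central_mult[OF Y_central[of j] cst_scalar_central[OF chi_central[of a]]],
      where A = 1 and B = 1] by simp
  have "r' n i j * r n i j = (X i - Y j * cst (scalar (\<chi> (-2)))) * (X i - Y j * cst (scalar (\<chi> 2)))"
    using inv.unitarity_series[OF d X_central[of i] Y_central[of j]] by (simp add: r_def r'_def chi_mult)
  then show "r' n i j * r n i j = F" unfolding F_def by (simp only: c[of "- 2" "X i - Y j * cst (scalar (\<chi> 2))"])
qed

subsection \<open>Traces of the fused products\<close>

definition NN :: "nat \<Rightarrow> ('n, 'a) op fls fls set"
  where "NN L = {Z. \<forall>a b. Tr L (cf2 Z a b) \<in> J}"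

lemma trace_like_NN: "trace_like KK (NN L)"
proof (intro trace_like.intro trace_like_axioms.intro)
  show "two_sided KK" by (rule fI.two_sided_flsI)
  show "a + b \<in> NN L" if "a \<in> NN L" "b \<in> NN L" for a b
    using that by (auto simp: NN_def intro: add_mem)
  show "KK \<subseteq> NN L"
  proof
    fix Z :: "('n, 'a) op fls fls" assume "Z \<in> KK"
    then have "cf2 Z a b \<in> opI" for a b by (simp add: KK_iff)
    then show "Z \<in> NN L" by (auto simp: NN_def opI_def Tr_def intro: sum_mem)
  qed
qed

text \<open>The hypothesis says that the trace of the coefficient of \<open>x\<^bsup>a-1\<^esup> y\<^sup>b\<close> is, up to a unit and modulo \<open>J\<close>, that of
  \<open>x\<^sup>a y\<^bsup>b-1\<^esup>\<close>. Moving up in \<open>a\<close> one eventually meets vanishing coefficients.\<close>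

lemma NN_cancel:
  assumes "(X i - Y j * cst (scalar (\<chi> c))) * Z \<in> NN L"
  shows "Z \<in> NN L"
proof -
  define \<tau> where "\<tau> a b = Tr L (cf2 Z a b)" for a b
  have step: "\<chi> (- 2 * int i) * \<tau> (a - 1) b - \<chi> (- 2 * int j) * (\<chi> c * \<tau> a (b - 1)) \<in> J" for a b
  proof -
    have "cf2 ((X i - Y j * cst (scalar (\<chi> c))) * Z) a b = scalar (\<chi> (- 2 * int i)) * cf2 Z (a - 1) b
        - scalar (\<chi> (- 2 * int j)) * (scalar (\<chi> c) * cf2 Z a (b - 1))"
      by (simp only: X_def Y_def left_diff_distrib mult.assoc cf2_simps)
    moreover have "Tr L (cf2 ((X i - Y j * cst (scalar (\<chi> c))) * Z) a b) \<in> J"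
      using assms by (simp add: NN_def)
    ultimately show ?thesis by (simp only: Tr_linear \<tau>_def)
  qed
  obtain A where A: "\<And>a. a > A \<Longrightarrow> cf Z a = 0" using cf_bound by metis
  have le: "\<tau> (A + 1 - int k) b \<in> J" for k b
  proof (induction k arbitrary: b)
    case 0
    then show ?case by (simp add: \<tau>_def cf2_def A)
  next
    case (Suc k)
    define a where "a = A + 1 - int k"
    have "\<chi> (- 2 * int i) * \<tau> (a - 1) b \<in> J"
      using add_mem[OF step[of a b] l_mem[OF l_mem[OF Suc]], of "\<chi> (- 2 * int j)" "\<chi> c" "b - 1"]
      by (simp add: a_def)
    from l_mem[OF this, of "\<chi> (2 * int i)"] show ?case
      by (simp add: chi_left a_def algebra_simps)
  qed
  have "\<tau> a b = 0" if "a > A" for a b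
    using that by (simp add: \<tau>_def cf2_def A)
  then have "\<tau> a b \<in> J" for a b
  proof (cases "a > A")
    case False
    then have "a = A + 1 - int (nat (A + 1 - a))" by simp
    then show ?thesis using le by metis
  qed simp
  then show ?thesis by (simp add: NN_def \<tau>_def)
qed

lemma cyclic_cst:
  assumes "\<And>Z. Tr L (Z * M) = Tr L (M * Z)"
  shows "trace_like.cyclic (NN L) (cst M)"
proof -
  interpret M: trace_like KK "NN L" by (rule trace_like_NN)
  show ?thesis unfolding M.cyclic_def by (auto simp: NN_def assms[of "cf2 _ _ _"])
qed

lemma cyclic_r:
  assumes "i < n" "j < m"
  shows "trace_like.cyclic (NN (n + m)) (r n i j)"
proof -
  interpret M: trace_like KK "NN (n + m)" by (rule trace_like_NN)
  have ij: "i < n + m" "n + j < n + m" using assms by auto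
  have UW: "M.cyclic (cst (U i (n + j)))" "M.cyclic (cst (W i (n + j)))"
    by (rule cyclic_cst, rule Tr_Rop[OF ij], rule chi_central)+
  have "- Y j * Z = Z * - Y j" for Z using Y_central[of j Z] by simp
  then have "M.cyclic (- Y j)" by (rule M.cyclic_central)
  moreover have "M.cyclic (X i)" by (rule M.cyclic_central) (rule X_central)
  ultimately have "M.cyclic (X i * cst (U i (n + j)) + - Y j * cst (W i (n + j)))"
    using UW by (intro M.cyclic_add M.cyclic_mult)
  then show ?thesis by (simp add: r_def)
qed

lemma inv_pair_r:
  assumes "i < n"
  shows "trace_like.inv_pair (NN L) (r n i j) (r' n i j)"
  unfolding trace_like.inv_pair_def[OF trace_like_NN]
proof (intro exI conjI allI impI)
  let ?F = "(X i - Y j * cst (scalar (\<chi> 2))) * (X i - Y j * cst (scalar (\<chi> (-2))))"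
  have c: "(X i - Y j * cst (scalar (\<chi> a))) * Z = Z * (X i - Y j * cst (scalar (\<chi> a)))" for a Z
    using linear_commute[OF X_central[of i] central_mult[OF Y_central[of j] cst_scalar_central[OF chi_central[of a]]],
      where A = 1 and B = 1] by simp
  show "?F * Z = Z * ?F" for Z by (rule central_mult[OF c c])
  show "Z \<in> NN L" if "?F * Z \<in> NN L" for Z
    by (rule NN_cancel[OF NN_cancel[OF that[unfolded mult.assoc]]])
  show "r n i j * r' n i j = ?F" "r' n i j * r n i j = ?F" by (rule r_r'[OF assms])+
qed

lemma antisymmetrizer_cst:
  assumes half: "\<And>x. x + x \<in> J \<Longrightarrow> x \<in> J" and A: "is_antisym o' n A"
  shows "antisymmetrizer KK n (\<lambda>i. cst (Q (o' + i) (Suc (o' + i)))) (cst A)"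
proof (intro antisymmetrizer.intro antisymmetrizer_axioms.intro)
  show "two_sided KK" by (rule fI.two_sided_flsI)
  show "cst A * cst (Q (o' + i) (Suc (o' + i))) = - cst A" if "Suc i < n" for i
  proof -
    have "A * Q (o' + i) (Suc (o' + i)) = - A" using that A unfolding is_antisym_def by blast
    then show ?thesis by (simp only: fls_const_mult_const fls_const_uminus)
  qed
  show "cst A * cst A = cst A"
  proof -
    have "A * A = A" using A unfolding is_antisym_def by blast
    then show ?thesis by (simp only: fls_const_mult_const)
  qed
  show "x \<in> KK" if "x + x \<in> KK" for x
  proof -
    have "cf2 x a b + cf2 x a b \<in> opI" for a b using that by (simp add: KK_iff)
    then have "ent (cf2 x a b) f g + ent (cf2 x a b) f g \<in> J" for a b f g by (simp add: opI_def)
    then have "ent (cf2 x a b) f g \<in> J" for a b f g by (rule half)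
    then have "cf2 x a b \<in> opI" for a b by (simp add: opI_def)
    then show ?thesis by (simp add: KK_iff)
  qed
  fix W :: "('n, 'a) op fls fls"
  assume W: "\<And>i. Suc i < n \<Longrightarrow> W * (1 + cst (Q (o' + i) (Suc (o' + i)))) \<in> KK"
  obtain Y where Y: "1 - A = (\<Sum>i | Suc i < n. (1 + Q (o' + i) (Suc (o' + i))) * Y i)"
    using A unfolding is_antisym_def by blast
  have "W * (1 - cst A) = W * cst (1 - A)" by (simp only: cst_simps fls_const_1)
  also have "\<dots> = (\<Sum>i | Suc i < n. W * (1 + cst (Q (o' + i) (Suc (o' + i)))) * cst (Y i))"
    unfolding Y by (simp only: cst_sum cst_simps fls_const_1 sum_distrib_left mult.assoc)
  also have "\<dots> \<in> KK" by (rule ffI.sum_mem, rule ffI.r_mem, rule W, simp)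
  finally show "W * (1 - cst A) \<in> KK" .
qed

text \<open>\<open>\<T>\<^sub>1(z) \<T>\<^sub>2(z q\<^sup>-\<^sup>1) \<cdots> \<T>\<^sub>n(z q\<^bsup>-(n-1)\<^esup>)\<close> on the sites from \<open>o'\<close> on.\<close>

definition Tp :: "nat \<Rightarrow> nat \<Rightarrow> ('n, 'a) op fls"
  where "Tp o' n = prod_list (map (\<lambda>i. Tser (o' + i) i) [0..<n])"

theorem traces_commute:
  assumes half: "\<And>x. x + x \<in> J \<Longrightarrow> x \<in> J"
    and A: "is_antisym 0 n A" and A': "is_antisym n m A'"
  shows "Tr (n + m) (A * A' * (cf (Tp 0 n) a * cf (Tp n m) b))
       - Tr (n + m) (A * A' * (cf (Tp n m) b * cf (Tp 0 n) a)) \<in> J"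
proof -
  define tt where "tt i = outer (Tser i i)" for i
  define uu where "uu j = fls_const (Tser (n + j) j)" for j
  interpret M: trace_like KK "NN (n + m)" by (rule trace_like_NN)
  interpret E: exchange KK n m tt uu "r n"
  proof (intro exchange.intro exchange_axioms.intro)
    show "two_sided KK" by (rule fI.two_sided_flsI)
  qed (auto simp: tt_def uu_def intro: exchange_series r_T r_U)
  interpret AN: antisymmetrizer KK n "\<lambda>i. cst (Q i (Suc i))" "cst A"
    using antisymmetrizer_cst[OF half A] by simp
  interpret AM: antisymmetrizer KK m "\<lambda>j. cst (Q (n + j) (Suc (n + j)))" "cst A'"
    by (rule antisymmetrizer_cst[OF half A'])
  have QA: "A \<in> Qalg (\<chi> 1) (\<chi> (-1)) 0 n" and QA': "A' \<in> Qalg (\<chi> 1) (\<chi> (-1)) n m"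
    using A A' by (simp_all add: is_antisym_def)
  have AA': "A * A' = A' * A"
  proof (rule Qalg_commute[OF QA])
    fix i assume i: "Suc i < n"
    have "A' * Q i (Suc i) = Q i (Suc i) * A'"
      by (rule Qalg_commute[OF QA'], rule disjoint_commute) (use i in auto)
    then show "Q (0 + i) (Suc (0 + i)) * A' = A' * Q (0 + i) (Suc (0 + i))" by simp
  qed
  have A_uu: "cst A * uu j = uu j * cst A" for j
    unfolding uu_def by (intro Tser_commute Qalg_commute[OF QA] Q_S) auto
  have A'_tt: "cst A' * tt i = tt i * cst A'" if "i < n" for i
    unfolding tt_def by (intro Tser_commute Qalg_commute[OF QA'] Q_S) (use that in auto)
  define T V R R' where "T = prod_list (map tt [0..<n])" and "V = prod_list (map uu [0..<m])"
    and "R = rect (r n) [0..<n] (rev [0..<m])" and "R' = rect (r' n) (rev [0..<n]) [0..<m]"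
  have T: "AN.absorbs T" "AM.absorbs T"
  proof -
    show "AN.absorbs T" unfolding T_def
    proof (rule AN.absorbs_upt)
      show "cst (Q i (Suc i)) * tt k = tt k * cst (Q i (Suc i))" if "k \<notin> {i, Suc i}" for i k
        unfolding tt_def by (intro Tser_commute Q_S that)
      show "(1 - cst (Q i (Suc i))) * (tt i * tt (Suc i)) * (1 + cst (Q i (Suc i))) \<in> KK" for i
        unfolding tt_def by (rule fusion_series_T) simp
    qed
    show "AM.absorbs T" unfolding T_def
      by (intro AM.absorbs_commute prod_list_commute) (auto simp: A'_tt)
  qed
  have V: "AN.absorbs V" "AM.absorbs V"
  proof -
    show "AM.absorbs V" unfolding V_def
    proof (rule AM.absorbs_upt)
      show "cst (Q (n + i) (Suc (n + i))) * uu k = uu k * cst (Q (n + i) (Suc (n + i)))" if "k \<notin> {i, Suc i}" for i k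
        unfolding uu_def by (intro Tser_commute Q_S) (use that in auto)
      show "(1 - cst (Q (n + i) (Suc (n + i)))) * (uu i * uu (Suc i)) * (1 + cst (Q (n + i) (Suc (n + i)))) \<in> KK" for i
        unfolding uu_def add_Suc_right by (rule fusion_series_T) simp
    qed
    show "AN.absorbs V" unfolding V_def
      by (intro AN.absorbs_commute prod_list_commute) (auto simp: A_uu)
  qed
  have list: "AN.absorbs (prod_list (map g xs))" if "\<And>x. x \<in> set xs \<Longrightarrow> AN.absorbs (g x)" for g :: "nat \<Rightarrow> _" and xs
    using that by (intro AN.absorbs_prod_list) auto
  have list': "AM.absorbs (prod_list (map g xs))" if "\<And>x. x \<in> set xs \<Longrightarrow> AM.absorbs (g x)" for g :: "nat \<Rightarrow> _" and xs
    using that by (intro AM.absorbs_prod_list) auto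
  have R: "AN.absorbs R" "AM.absorbs R"
  proof -
    show "AN.absorbs R" unfolding R_def rect_def
      by (rule list, rule AN.absorbs_upt) (auto simp: fusion_r intro: r_Q)
    have col: "R = prod_list (map (\<lambda>i. prod_list (map (r n i) (rev [0..<m]))) [0..<n])"
      unfolding R_def by (rule rect_columns) (auto intro: r_r)
    show "AM.absorbs R" unfolding col
      by (rule list', rule AM.absorbs_rev_upt) (auto simp: fusion_r_right intro: r_Q)
  qed
  have R': "AN.absorbs R'" "AM.absorbs R'"
  proof -
    show "AN.absorbs R'" unfolding R'_def rect_def
      by (rule list, rule AN.absorbs_rev_upt) (auto simp: fusion_r intro: r_Q)
    have col: "R' = prod_list (map (\<lambda>i. prod_list (map (r' n i) [0..<m])) (rev [0..<n]))"
      unfolding R'_def by (rule rect_columns) (auto intro: r_r)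
    show "AM.absorbs R'" unfolding col
      by (rule list', rule AM.absorbs_upt) (auto simp: fusion_r_right intro: r_Q)
  qed
  define D where "D = cst A * cst A'"
  have D_alt: "D = cst A' * cst A" by (simp add: D_def AA')
  have D: "ffI.cng (D * Z) (D * Z * D)" if "AN.absorbs Z" "AM.absorbs Z" for Z
  proof -
    have "D * Z = cst A * (cst A' * Z)" by (simp only: D_def mult.assoc)
    also have "ffI.cng \<dots> (cst A * (cst A' * Z * cst A'))"
      using that(2) unfolding AM.absorbs_def by (rule ffI.cng_l)
    also have "cst A * (cst A' * Z * cst A') = cst A' * (cst A * Z) * cst A'"
      using D_alt by (simp only: D_def mult.assoc[symmetric])
    also have "ffI.cng \<dots> (cst A' * (cst A * Z * cst A) * cst A')"
      using that(1) unfolding AN.absorbs_def by (intro ffI.cng_l ffI.cng_r)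
    also have "cst A' * (cst A * Z * cst A) * cst A' = D * Z * D"
      by (simp only: D_alt[symmetric] mult.assoc[symmetric]) (simp only: D_def mult.assoc)
    finally show ?thesis .
  qed
  have DD: "D * D = D"
  proof -
    have "D * D = cst A * (cst A' * cst A) * cst A'" by (simp only: D_def mult.assoc)
    also have "\<dots> = (cst A * cst A) * (cst A' * cst A')"
      unfolding D_alt[symmetric] D_def by (simp only: mult.assoc)
    finally show ?thesis unfolding AN.A_A AM.A_A by (simp only: D_def)
  qed
  have "D * (T * V) - D * (V * T) \<in> NN (n + m)"
  proof (rule M.commute_mod_trace)
    show "M.inv_pair R R'"
      using M.inv_pair_rect[of "[0..<n]" "rev [0..<m]" "r n" "r' n"] inv_pair_r
      by (simp add: R_def R'_def)
    show "ffI.cng (R * T * V) (V * T * R)"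
      unfolding R_def T_def V_def by (rule E.exchange_rect) auto
    show "ffI.cng (D * (V * T)) (D * (V * T) * D)"
      by (rule D[OF AN.absorbs_mult[OF V(1) T(1)] AM.absorbs_mult[OF V(2) T(2)]])
    show "M.cyclic D" unfolding D_def
      by (intro M.cyclic_mult cyclic_cst Tr_Qalg[OF QA] Tr_Qalg[OF QA']) auto
    show "M.cyclic R" unfolding R_def rect_def
      by (intro M.cyclic_prod_list) (auto intro!: M.cyclic_prod_list cyclic_r)
  qed (use D R R' DD in auto)
  moreover have "tt = (\<lambda>i. outer (Tser i i))" "uu = (\<lambda>j. fls_const (Tser (n + j) j))"
    by (auto simp: tt_def uu_def)
  then have "T = outer (Tp 0 n)" "V = fls_const (Tp n m)"
    by (simp_all add: T_def V_def Tp_def outer_prod_list fls_const_prod_list comp_def)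
  ultimately show ?thesis
    by (auto simp: NN_def D_def mult.assoc)
qed

end

section \<open>Operators on a window of sites\<close>

text \<open>An operator on the \<open>w\<close>-fold tensor power, whose matrix is indexed by lists of length \<open>w\<close>, is placed on the sites
  \<open>o'\<close>, \<open>\<dots>\<close>, \<open>o' + w - 1\<close> by \<open>emb\<close> below. A configuration \<open>f\<close> contributes the list \<open>window o' w f\<close>, and
  \<open>overwrite o' I f\<close> replaces it by \<open>I\<close>.\<close>

definition window :: "nat \<Rightarrow> nat \<Rightarrow> (nat \<Rightarrow> 'n) \<Rightarrow> 'n list"
  where "window o' w f = map f [o'..<o' + w]"

definition overwrite :: "nat \<Rightarrow> 'n list \<Rightarrow> (nat \<Rightarrow> 'n) \<Rightarrow> nat \<Rightarrow> 'n"
  where "overwrite o' I f = (\<lambda>i. if o' \<le> i \<and> i < o' + length I then I ! (i - o') else f i)"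

definition agree_off :: "nat \<Rightarrow> nat \<Rightarrow> (nat \<Rightarrow> 'n) \<Rightarrow> (nat \<Rightarrow> 'n) \<Rightarrow> bool"
  where "agree_off o' w f g \<longleftrightarrow> (\<forall>i. i < o' \<or> o' + w \<le> i \<longrightarrow> g i = f i)"

lemma window_idx [simp]: "window o' w f \<in> idx w"
  by (simp add: window_def idx_def)

lemma window_nth [simp]: "k < w \<Longrightarrow> window o' w f ! k = f (o' + k)"
  by (simp add: window_def)

lemma window_overwrite [simp]: "I \<in> idx w \<Longrightarrow> window o' w (overwrite o' I f) = I"
  by (rule nth_equalityI) (auto simp: window_def overwrite_def idx_def)

lemma agree_off_iff: "agree_off o' w f g \<longleftrightarrow> g = overwrite o' (window o' w g) f"
  by (auto simp: agree_off_def overwrite_def window_def fun_eq_iff not_le)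

lemma agree_off_overwrite: "I \<in> idx w \<Longrightarrow> agree_off o' w (overwrite o' I f) g \<longleftrightarrow> agree_off o' w f g"
  by (auto simp: agree_off_def overwrite_def idx_def)

lift_definition emb :: "nat \<Rightarrow> nat \<Rightarrow> ('n::finite list \<Rightarrow> 'n list \<Rightarrow> 'a::zero) \<Rightarrow> ('n, 'a) op"
  is "\<lambda>o' w M f g. if agree_off o' w f g then M (window o' w f) (window o' w g) else 0"
proof -
  fix o' w and M :: "'n list \<Rightarrow> 'n list \<Rightarrow> 'a" and f :: "nat \<Rightarrow> 'n"
  have "{g. (if agree_off o' w f g then M (window o' w f) (window o' w g) else 0) \<noteq> 0} \<subseteq> (\<lambda>I. overwrite o' I f) ` idx w"
  proof
    fix g assume "g \<in> {g. (if agree_off o' w f g then M (window o' w f) (window o' w g) else 0) \<noteq> 0}"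
    then have "g = overwrite o' (window o' w g) f" by (auto simp: agree_off_iff[symmetric] split: if_splits)
    then show "g \<in> (\<lambda>I. overwrite o' I f) ` idx w" by (rule image_eqI) simp
  qed
  then show "finite {g. (if agree_off o' w f g then M (window o' w f) (window o' w g) else 0) \<noteq> 0}"
    by (rule finite_subset) simp
qed

lemma ent_emb: "ent (emb o' w M) f g = (if agree_off o' w f g then M (window o' w f) (window o' w g) else 0)"
  by (rule emb.rep_eq[THEN fun_cong, THEN fun_cong])

lemma ent_emb_times:
  "ent (emb o' w M * B) f g = (\<Sum>K\<in>idx w. M (window o' w f) K * ent B (overwrite o' K f) g)"
proof -
  have inj: "inj_on (\<lambda>K. overwrite o' K f) (idx w)"
    by (rule inj_on_inverseI[of _ "window o' w"]) simp
  have "ent (emb o' w M * B) f g = (\<Sum>h\<in>(\<lambda>K. overwrite o' K f) ` idx w. ent (emb o' w M) f h * ent B h g)"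
  proof (rule ent_times_superset)
    show "{h. ent (emb o' w M) f h \<noteq> 0} \<subseteq> (\<lambda>K. overwrite o' K f) ` idx w"
    proof
      fix g assume "g \<in> {h. ent (emb o' w M) f h \<noteq> 0}"
      then have "g = overwrite o' (window o' w g) f" by (auto simp: ent_emb agree_off_iff[symmetric] split: if_splits)
      then show "g \<in> (\<lambda>I. overwrite o' I f) ` idx w" by (rule image_eqI) simp
    qed
  qed simp
  also have "\<dots> = (\<Sum>K\<in>idx w. ent (emb o' w M) f (overwrite o' K f) * ent B (overwrite o' K f) g)"
    using inj by (simp add: sum.reindex)
  also have "\<dots> = (\<Sum>K\<in>idx w. M (window o' w f) K * ent B (overwrite o' K f) g)"
    by (intro sum.cong refl) (simp add: ent_emb agree_off_iff)
  finally show ?thesis .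
qed

definition lmul :: "nat \<Rightarrow> ('n::finite list \<Rightarrow> 'n list \<Rightarrow> 'a::ring_1) \<Rightarrow> ('n list \<Rightarrow> 'n list \<Rightarrow> 'a) \<Rightarrow> 'n list \<Rightarrow> 'n list \<Rightarrow> 'a"
  where "lmul w A B = (\<lambda>I J. \<Sum>K\<in>idx w. A I K * B K J)"

lemma emb_mult: "emb o' w M * emb o' w M' = emb o' w (lmul w M M')"
proof (rule rfmat_eqI)
  fix f g
  have "ent (emb o' w M * emb o' w M') f g
    = (\<Sum>K\<in>idx w. if agree_off o' w f g then M (window o' w f) K * M' K (window o' w g) else 0)"
    unfolding ent_emb_times by (intro sum.cong refl) (simp add: ent_emb agree_off_overwrite)
  then show "ent (emb o' w M * emb o' w M') f g = ent (emb o' w (lmul w M M')) f g"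
    by (simp add: ent_emb lmul_def)
qed

lemma emb_cong:
  assumes "\<And>I J. I \<in> idx w \<Longrightarrow> J \<in> idx w \<Longrightarrow> M I J = M' I J"
  shows "emb o' w M = emb o' w M'"
  by (rule rfmat_eqI) (simp add: ent_emb assms)

lemma emb_1: "emb o' w (\<lambda>I J. if I = J then 1 else 0) = 1"
proof (rule rfmat_eqI)
  fix f g :: "nat \<Rightarrow> 'a"
  have "agree_off o' w f g \<and> window o' w f = window o' w g \<longleftrightarrow> g = f"
  proof
    assume a: "agree_off o' w f g \<and> window o' w f = window o' w g"
    then have "g = overwrite o' (window o' w f) f" by (metis agree_off_iff)
    then show "g = f" by (auto simp: overwrite_def window_def fun_eq_iff)
  qed (auto simp: agree_off_def)
  then show "ent (emb o' w (\<lambda>I J. if I = J then 1 else 0)) f g = ent 1 f g"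
    by (auto simp: ent_emb ent_one)
qed

lemma emb_sum: "emb o' w (\<lambda>I J. \<Sum>x\<in>S. M x I J) = (\<Sum>x\<in>S. emb o' w (M x))"
  by (rule rfmat_eqI) (simp add: ent_emb)

lemma emb_scalar: "emb o' w (\<lambda>I J. c * M I J) = scalar c * emb o' w M"
  by (rule rfmat_eqI) (simp add: ent_emb)

lemma site_emb:
  assumes "k < w"
  shows "site (o' + k) N = emb o' w (\<lambda>I J. if \<forall>l<w. l \<noteq> k \<longrightarrow> I ! l = J ! l then N (I ! k) (J ! k) else 0)"
proof (rule rfmat_eqI)
  fix f g :: "nat \<Rightarrow> 'a"
  have "g = f(o' + k := g (o' + k)) \<longleftrightarrow>
    agree_off o' w f g \<and> (\<forall>l<w. l \<noteq> k \<longrightarrow> window o' w f ! l = window o' w g ! l)"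
  proof
    assume L: "g = f(o' + k := g (o' + k))"
    then have "g i = f i" if "i \<noteq> o' + k" for i using that by (metis fun_upd_other)
    then show "agree_off o' w f g \<and> (\<forall>l<w. l \<noteq> k \<longrightarrow> window o' w f ! l = window o' w g ! l)"
      using assms by (auto simp: agree_off_def)
  next
    assume R: "agree_off o' w f g \<and> (\<forall>l<w. l \<noteq> k \<longrightarrow> window o' w f ! l = window o' w g ! l)"
    show "g = f(o' + k := g (o' + k))"
    proof
      fix i
      consider "i < o' \<or> o' + w \<le> i" | "i = o' + k" | l where "i = o' + l" "l < w" "l \<noteq> k"
        by (metis add_diff_inverse_nat nat_add_left_cancel_less not_le)
      then show "g i = (f(o' + k := g (o' + k))) i"
        using R assms by cases (auto simp: agree_off_def)
    qed
  qed
  then show "ent (site (o' + k) N) f g =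
      ent (emb o' w (\<lambda>I J. if \<forall>l<w. l \<noteq> k \<longrightarrow> I ! l = J ! l then N (I ! k) (J ! k) else 0)) f g"
    using assms by (auto simp: ent_site ent_emb)
qed

lemma qflip_emb:
  assumes "Suc k < w"
  shows "qflip s s' (o' + k) (Suc (o' + k)) = emb o' w (\<lambda>I J.
    if \<forall>l<w. l \<noteq> k \<and> l \<noteq> Suc k \<longrightarrow> I ! l = J ! l then
      if J ! k = I ! Suc k \<and> J ! Suc k = I ! k then qcoeff s s' (I ! k) (I ! Suc k) else 0 else 0)"
proof (rule rfmat_eqI)
  fix f g :: "nat \<Rightarrow> 'a"
  have w: "window o' w h ! k = h (o' + k)" "window o' w h ! Suc k = h (Suc (o' + k))" for h :: "nat \<Rightarrow> 'a"
    using assms by simp_all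
  have "g = swap_sites (o' + k) (Suc (o' + k)) f \<longleftrightarrow>
    agree_off o' w f g \<and> (\<forall>l<w. l \<noteq> k \<and> l \<noteq> Suc k \<longrightarrow> window o' w f ! l = window o' w g ! l)
      \<and> g (o' + k) = f (Suc (o' + k)) \<and> g (Suc (o' + k)) = f (o' + k)"
  proof
    assume "g = swap_sites (o' + k) (Suc (o' + k)) f"
    then show "agree_off o' w f g \<and> (\<forall>l<w. l \<noteq> k \<and> l \<noteq> Suc k \<longrightarrow> window o' w f ! l = window o' w g ! l)
      \<and> g (o' + k) = f (Suc (o' + k)) \<and> g (Suc (o' + k)) = f (o' + k)"
      using assms by (auto simp: agree_off_def swap_sites_def)
  next
    assume R: "agree_off o' w f g \<and> (\<forall>l<w. l \<noteq> k \<and> l \<noteq> Suc k \<longrightarrow> window o' w f ! l = window o' w g ! l)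
      \<and> g (o' + k) = f (Suc (o' + k)) \<and> g (Suc (o' + k)) = f (o' + k)"
    show "g = swap_sites (o' + k) (Suc (o' + k)) f"
    proof
      fix i
      consider "i < o' \<or> o' + w \<le> i" | "i = o' + k" | "i = Suc (o' + k)"
        | l where "i = o' + l" "l < w" "l \<noteq> k" "l \<noteq> Suc k"
        by (metis add_Suc_right add_diff_inverse_nat nat_add_left_cancel_less not_le)
      then show "g i = swap_sites (o' + k) (Suc (o' + k)) f i"
        using R assms by cases (auto simp: agree_off_def swap_sites_def)
    qed
  qed
  then show "ent (qflip s s' (o' + k) (Suc (o' + k))) f g = ent (emb o' w (\<lambda>I J.
    if \<forall>l<w. l \<noteq> k \<and> l \<noteq> Suc k \<longrightarrow> I ! l = J ! l then
      if J ! k = I ! Suc k \<and> J ! Suc k = I ! k then qcoeff s s' (I ! k) (I ! Suc k) else 0 else 0)) f g"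
    unfolding qflip_def ent_monomial ent_emb w by auto
qed

text \<open>Operators on complementary windows do not see each other, so an entry of the product is a product of entries in the
  order of the factors.\<close>

lemma ent_emb_emb:
  shows "ent (emb 0 n M * emb n m M') f g = (if agree_off 0 (n + m) f g then
      M (window 0 n f) (window 0 n g) * M' (window n m f) (window n m g) else 0)"
    and "ent (emb n m M' * emb 0 n M) f g = (if agree_off 0 (n + m) f g then
      M' (window n m f) (window n m g) * M (window 0 n f) (window 0 n g) else 0)"
proof -
  have ov: "window n m (overwrite 0 K f) = window n m f" if "K \<in> idx n" for K
    using that by (auto simp: window_def overwrite_def idx_def)
  have ov': "window 0 n (overwrite n K f) = window 0 n f" for K
    by (auto simp: window_def overwrite_def)
  have ag: "agree_off n m (overwrite 0 K f) g \<longleftrightarrow> K = window 0 n g \<and> agree_off 0 (n + m) f g" if "K \<in> idx n" for K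
  proof -
    have "K = window 0 n g \<longleftrightarrow> (\<forall>i<n. K ! i = g i)"
      using that by (auto simp: list_eq_iff_nth_eq idx_def window_def)
    then show ?thesis using that by (auto simp: agree_off_def overwrite_def idx_def)
  qed
  have ag': "agree_off 0 n (overwrite n K f) g \<longleftrightarrow> K = window n m g \<and> agree_off 0 (n + m) f g" if "K \<in> idx m" for K
  proof -
    have "K = window n m g \<longleftrightarrow> (\<forall>i<m. K ! i = g (n + i))"
      using that by (auto simp: list_eq_iff_nth_eq idx_def window_def)
    also have "\<dots> \<longleftrightarrow> (\<forall>i. n \<le> i \<and> i < n + m \<longrightarrow> g i = K ! (i - n))"
      by (metis add_diff_inverse_nat diff_add_inverse le_add1 nat_add_left_cancel_less not_le)
    finally show ?thesis using that by (auto simp: agree_off_def overwrite_def idx_def)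
  qed
  have "ent (emb 0 n M * emb n m M') f g = (\<Sum>K\<in>idx n. if K = window 0 n g then
      (if agree_off 0 (n + m) f g then M (window 0 n f) K * M' (window n m f) (window n m g) else 0) else 0)"
    unfolding ent_emb_times by (intro sum.cong refl) (simp add: ent_emb ov ag)
  then show "ent (emb 0 n M * emb n m M') f g = (if agree_off 0 (n + m) f g then
      M (window 0 n f) (window 0 n g) * M' (window n m f) (window n m g) else 0)" by simp
  have "ent (emb n m M' * emb 0 n M) f g = (\<Sum>K\<in>idx m. if K = window n m g then
      (if agree_off 0 (n + m) f g then M' (window n m f) K * M (window 0 n f) (window 0 n g) else 0) else 0)"
    unfolding ent_emb_times by (intro sum.cong refl) (simp add: ent_emb ov' ag')
  then show "ent (emb n m M' * emb 0 n M) f g = (if agree_off 0 (n + m) f g then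
      M' (window n m f) (window n m g) * M (window 0 n f) (window 0 n g) else 0)" by simp
qed

lemma emb_commute:
  assumes "\<And>I J K L. M I J * M' K L = M' K L * M I J"
  shows "emb 0 n M * emb n m M' = emb n m M' * emb 0 n M"
  by (rule rfmat_eqI) (simp add: ent_emb_emb assms)

lemma Tr_emb_emb:
  fixes M M' :: "'n::finite list \<Rightarrow> 'n list \<Rightarrow> 'a::ring_1"
  shows "Tr (n + m) (emb 0 n M * emb n m M') = (\<Sum>I\<in>idx n. M I I) * (\<Sum>J\<in>idx m. M' J J)"
    and "Tr (n + m) (emb n m M' * emb 0 n M) = (\<Sum>J\<in>idx m. M' J J) * (\<Sum>I\<in>idx n. M I I)"
proof -
  have bij: "(\<Sum>f\<in>blk (n + m). F (window 0 n f) (window n m f)) = (\<Sum>I\<in>idx n. \<Sum>J\<in>idx m. F I J)"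
    for F :: "'n list \<Rightarrow> 'n list \<Rightarrow> 'a"
  proof -
    have "(\<Sum>f\<in>blk (n + m). F (window 0 n f) (window n m f)) = (\<Sum>(I, J)\<in>idx n \<times> idx m. F I J)"
    proof (rule sum.reindex_bij_witness[of _ "\<lambda>(I, J). overwrite 0 I (overwrite n J (\<lambda>_. undefined))"
          "\<lambda>f. (window 0 n f, window n m f)"]; clarsimp)
      fix f :: "nat \<Rightarrow> 'n" assume "f \<in> blk (n + m)"
      then show "overwrite 0 (window 0 n f) (overwrite n (window n m f) (\<lambda>_. undefined)) = f"
        by (auto simp: blk_def overwrite_def window_def fun_eq_iff)
    next
      fix I J :: "'n list" assume IJ: "I \<in> idx n" "J \<in> idx m"
      have "window n m (overwrite 0 I h) = window n m h" for h
        using IJ by (auto simp: window_def overwrite_def idx_def)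
      then show "window n m (overwrite 0 I (overwrite n J (\<lambda>_. undefined))) = J"
        using IJ by simp
      show "overwrite 0 I (overwrite n J (\<lambda>_. undefined)) \<in> blk (n + m)"
        using IJ by (auto simp: blk_def overwrite_def idx_def)
    qed
    then show ?thesis by (simp add: sum.cartesian_product)
  qed
  have refl: "agree_off o' w f f" for o' w and f :: "nat \<Rightarrow> 'n" by (simp add: agree_off_def)
  show "Tr (n + m) (emb 0 n M * emb n m M') = (\<Sum>I\<in>idx n. M I I) * (\<Sum>J\<in>idx m. M' J J)"
    unfolding Tr_def ent_emb_emb using bij[of "\<lambda>I J. M I I * M' J J"]
    by (simp add: refl sum_product)
  show "Tr (n + m) (emb n m M' * emb 0 n M) = (\<Sum>J\<in>idx m. M' J J) * (\<Sum>I\<in>idx n. M I I)"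
    unfolding Tr_def ent_emb_emb using bij[of "\<lambda>I J. M' J J * M I I"]
    by (simp add: refl sum_product) (rule sum.swap)
qed

section \<open>The h-antisymmetrizer as an operator\<close>

lemma scalF_simps: "scalF 0 = 0" "scalF 1 = 1" "scalF (c + d) = scalF c + scalF d" "scalF (c * d) = scalF c * scalF d"
  "scalF (- c) = - scalF c"
  by (simp_all add: scalF_def single_add mult_single single_uminus)

lemma scalF_sum: "scalF (\<Sum>x\<in>S. F x) = (\<Sum>x\<in>S. scalF (F x))"
  by (induction S rule: infinite_finite_induct) (auto simp: scalF_simps)

lemma scalF_central: "scalF c * x = x * scalF c"
proof (induction x rule: update_induct)
  case const
  show ?case by simp
next
  case (update f a b)
  have "Poly_Mapping.update a b f = Poly_Mapping.single a b + f"
    using update(1) by (intro poly_mapping_eqI) (auto simp: lookup_update lookup_add lookup_single in_keys_iff when_def)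
  then show ?case using update.IH by (simp add: distrib_left distrib_right scalF_def mult_single mult.commute)
qed

definition qexp :: "int \<Rightarrow> 'n falg"
  where "qexp k = scalF (fps_exp (of_int k / 2))"

interpretation qexp: char_q "qexp :: int \<Rightarrow> 'n falg"
proof
  show "qexp 0 = (1 :: 'n falg)" by (simp add: qexp_def scalF_simps)
  show "qexp (a + b) = qexp a * (qexp b :: 'n falg)" for a b
    unfolding qexp_def scalF_simps(4)[symmetric] fps_exp_add_mult[symmetric] of_int_add add_divide_distrib ..
  show "qexp a * x = x * (qexp a :: 'n falg)" for a x
    unfolding qexp_def by (rule scalF_central)
qed

text \<open>\<open>emb\<close> for matrices over the ground ring \<open>\<complex>[[h]]\<close>.\<close>

definition oemb :: "nat \<Rightarrow> nat \<Rightarrow> 'n oper \<Rightarrow> ('n::{finite,linorder}, 'n falg) op"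
  where "oemb o' n M = emb o' n (\<lambda>I J. scalF (M I J))"

lemma oemb_mult: "oemb o' n (op_mult n A B) = oemb o' n A * oemb o' n B"
  unfolding oemb_def emb_mult by (rule emb_cong) (simp add: op_mult_def lmul_def scalF_sum scalF_simps)

lemma oemb_one: "oemb o' n (op_one n) = 1"
  unfolding oemb_def emb_1[of o' n, symmetric] by (rule emb_cong) (simp add: op_one_def scalF_simps)

lemma scalF_Ph: "scalF (if P then if a = b then 1 else if b < a then fps_exp (1/2) else fps_exp (-1/2) else 0)
    = (if P then qcoeff (qexp 1) (qexp (-1)) a b else 0)"
  by (simp add: qcoeff_def qexp_def scalF_simps)

lemma oemb_Ph_adj:
  assumes "Suc k < n"
  shows "oemb o' n (Ph_adj n k) = qexp.Q (o' + k) (Suc (o' + k))"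
  unfolding oemb_def qflip_emb[OF assms]
proof (rule emb_cong)
  fix I J :: "'a list" assume IJ: "I \<in> idx n" "J \<in> idx n"
  let ?C = "\<forall>l<n. l \<noteq> k \<and> l \<noteq> Suc k \<longrightarrow> I ! l = J ! l"
  have "Ph_adj n k I J = (if ?C then Ph (I ! k, I ! Suc k) (J ! k, J ! Suc k) else 0)"
    unfolding Ph_adj_def by (rule if_cong) (use IJ in blast, rule refl, rule refl)
  then have "scalF (Ph_adj n k I J) = (if ?C then scalF (Ph (I ! k, I ! Suc k) (J ! k, J ! Suc k)) else 0)"
    by (simp only: if_distrib[of scalF] scalF_simps(1))
  then show "scalF (Ph_adj n k I J) = (if ?C then
      if J ! k = I ! Suc k \<and> J ! Suc k = I ! k then qcoeff (qexp 1) (qexp (-1)) (I ! k) (I ! Suc k) else 0 else 0)"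
    by (simp only: Ph_entry scalF_Ph)
qed

abbreviation Phi :: "nat \<Rightarrow> nat \<Rightarrow> (nat \<Rightarrow> nat) \<Rightarrow> ('n::{finite,linorder}, 'n falg) op"
  where "Phi o' n p \<equiv> oemb o' n (sym_action n p)"

lemma Phi_id: "Phi o' n id = 1"
proof -
  have "sym_action n id = (op_one n :: 'a oper)" using sym_action[of n] unfolding is_sym_action_def by blast
  then show ?thesis by (simp add: oemb_one)
qed

lemma Phi_comp: "p permutes {..<n} \<Longrightarrow> q permutes {..<n} \<Longrightarrow> Phi o' n (p \<circ> q) = Phi o' n p * Phi o' n q"
proof -
  assume "p permutes {..<n}" "q permutes {..<n}"
  then have "sym_action n (p \<circ> q) = (op_mult n (sym_action n p) (sym_action n q) :: 'a oper)"
    using sym_action[of n] unfolding is_sym_action_def by blast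
  then show ?thesis by (simp add: oemb_mult)
qed

lemma Phi_transpose: "Suc k < n \<Longrightarrow> Phi o' n (transpose k (Suc k)) = qexp.Q (o' + k) (Suc (o' + k))"
proof -
  assume k: "Suc k < n"
  then have "sym_action n (transpose k (Suc k)) = (Ph_adj n k :: 'a oper)"
    using sym_action[of n] unfolding is_sym_action_def by blast
  then show ?thesis by (simp add: oemb_Ph_adj[OF k])
qed

lemma transpose_adj_permutes: "Suc k < n \<Longrightarrow> transpose k (Suc k) permutes {..<n}"
  by (intro permutes_swap_id) auto

lemma Ah_oemb:
  "oemb o' n (Ah n) = scalar (scalF (fps_const (1 / fact n))) *
     (\<Sum>p | p permutes {..<n}. of_int (sign p) * Phi o' n p)"
proof -
  have s: "scalF (of_int (sign p)) = of_int (sign p)" "of_int (sign p) = (scalar (of_int (sign p)) :: ('n, 'n falg) op)"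
    for p :: "nat \<Rightarrow> nat"
    by (cases "evenperm p"; simp add: sign_def scalF_simps scalar_minus)+
  have "oemb o' n (Ah n) = emb o' n (\<lambda>I J. scalF (fps_const (1 / fact n)) *
     (\<Sum>p | p permutes {..<n}. of_int (sign p) * scalF (sym_action n p I J)))"
    unfolding oemb_def by (rule emb_cong) (simp only: Ah_def scalF_simps scalF_sum s)
  then show ?thesis
    unfolding emb_scalar emb_sum oemb_def s(2) .
qed

lemma sign_mult_transpose:
  assumes "p permutes {..<n::nat}" "Suc k < n"
  shows "sign (transpose k (Suc k) \<circ> p) = - sign p"
proof -
  have "permutation p" using assms(1) permutation_permutes by blast
  then show ?thesis by (simp add: sign_compose permutation_swap_id sign_swap_id)
qed

lemma adjacent_transposition_induct [consumes 1, case_names id transpose]: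
  assumes "p permutes {..<n}" and "P id"
    and "\<And>k p. Suc k < n \<Longrightarrow> p permutes {..<n} \<Longrightarrow> P p \<Longrightarrow> P (transpose k (Suc k) \<circ> p)"
  shows "P p"
proof -
  obtain xs where xs: "\<forall>x\<in>set xs. Suc x < n" "p = apply_adj_transps xs"
    using permutes_adj_transps[OF assms(1)] by blast
  from xs(1) have "P (apply_adj_transps xs)"
  proof (induction xs)
    case (Cons x xs)
    have "apply_adj_transps xs permutes {..<n}"
      using Cons.prems by (intro permutes_apply_adj_transps) auto
    then show ?case using Cons assms(3)[of x "apply_adj_transps xs"]
      by (simp only: apply_adj_transps_Cons Suc_eq_plus1[symmetric] list.set) blast
  qed (use assms(2) in simp)
  then show ?thesis using xs by simp
qed

lemma Phi_Qalg:
  assumes "p permutes {..<n}"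
  shows "Phi o' n p \<in> Qalg (qexp 1) (qexp (-1)) o' n"
  using assms
proof (induction rule: adjacent_transposition_induct)
  case id
  have "scalar 1 \<in> Qalg (qexp 1) (qexp (-1)) o' n" by (rule Qalg.scalar) simp
  then show ?case by (simp only: Phi_id scalar_1)
next
  case (transpose k p)
  then show ?case
    by (simp only: Phi_comp transpose_adj_permutes Phi_transpose) (intro Qalg.mult Qalg.Q)
qed

text \<open>With \<open>p = t p'\<close> for an adjacent transposition \<open>t\<close>, which acts as \<open>Q\<close>, one has
  \<open>sgn(p) - p = - (1 + Q) p' - (sgn(p') - p')\<close>. Averaged over all \<open>p\<close> this puts \<open>1 - A\<close> into the right ideal generated by
  the elements \<open>1 + Q\<close>.\<close>

lemma Phi_minus_sign:
  assumes "p permutes {..<n}"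
  shows "\<exists>Y. of_int (sign p) - (Phi o' n p :: ('a::{finite,linorder}, 'a falg) op) = (\<Sum>i | Suc i < n. (1 + qexp.Q (o' + i) (Suc (o' + i))) * Y i)"
  using assms
proof (induction rule: adjacent_transposition_induct)
  case id
  show ?case by (rule exI[of _ "\<lambda>_. 0"]) (simp only: Phi_id sign_id, simp)
next
  case (transpose k p)
  obtain Y where Y: "of_int (sign p) - (Phi o' n p :: ('a, 'a falg) op) = (\<Sum>i | Suc i < n. (1 + qexp.Q (o' + i) (Suc (o' + i))) * Y i)"
    using transpose by blast
  have fin: "finite {i. Suc i < n}" by (rule finite_subset[of _ "{..<n}"]) auto
  \<comment> \<open>The new summand belongs to the transposition split off from the permutation.\<close>
  let ?Y = "\<lambda>i. (if i = k then - Phi o' n p else 0) - Y i"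
  have "of_int (sign (transpose k (Suc k) \<circ> p)) - (Phi o' n (transpose k (Suc k) \<circ> p) :: ('a, 'a falg) op)
      = (1 + qexp.Q (o' + k) (Suc (o' + k))) * (- Phi o' n p) - (of_int (sign p) - Phi o' n p)"
    using transpose by (simp add: sign_mult_transpose Phi_comp transpose_adj_permutes Phi_transpose algebra_simps)
  also have "\<dots> = (\<Sum>i | Suc i < n. (1 + qexp.Q (o' + i) (Suc (o' + i))) * (if i = k then - Phi o' n p else 0))
      - (\<Sum>i | Suc i < n. (1 + qexp.Q (o' + i) (Suc (o' + i))) * Y i)"
    unfolding Y using transpose(1) fin by (simp add: if_distrib[of "\<lambda>x. _ * x"] cong: if_cong)
  also have "\<dots> = (\<Sum>i | Suc i < n. (1 + qexp.Q (o' + i) (Suc (o' + i))) * ?Y i)"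
    by (simp only: sum_subtractf[symmetric] right_diff_distrib)
  finally show ?case by (rule exI[of _ ?Y])
qed

theorem Ah_is_antisym: "qexp.is_antisym o' n (oemb o' n (Ah n))"
proof -
  define c where "c = (scalar (scalF (fps_const (1 / fact n))) :: ('a, 'a falg) op)"
  define Ps where "Ps = {p. p permutes {..<n}}"
  define A where "A = oemb o' n (Ah n :: 'a oper)"
  have A: "A = c * (\<Sum>p\<in>Ps. of_int (sign p) * Phi o' n p)"
    unfolding A_def c_def Ps_def by (rule Ah_oemb)
  have finP: "finite Ps" by (simp add: Ps_def finite_permutations)
  have c: "c * X = X * c" for X unfolding c_def by (rule scalar_central) (rule scalF_central)
  have c_fact: "c * of_nat (fact n) = 1"
  proof -
    have "scalF (of_nat k) = (of_nat k :: 'a falg)" for k by (induction k) (simp_all add: scalF_simps)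
    moreover have "(of_nat k :: ('a, 'a falg) op) = scalar (of_nat k)" for k
      by (induction k) (simp_all add: scalar_add)
    ultimately have "c * of_nat (fact n) = scalar (scalF (fps_const (1 / fact n) * of_nat (fact n)))"
      by (simp only: c_def scalar_mult[symmetric] scalF_simps)
    also have "fps_const (1 / fact n) * of_nat (fact n) = (1 :: complex fps)"
      by (simp only: fps_of_nat[symmetric] fps_const_mult of_nat_fact) simp
    finally show ?thesis by (simp add: scalF_simps)
  qed
  have perm: "permutation p" if "p \<in> Ps" for p
    using that permutation_permutes by (auto simp: Ps_def)
  have of_int_c: "of_int k * X = X * of_int k" for k and X :: "('a, 'a falg) op"
    by (rule mult_of_int_commute) 
  have absorb: "A * Phi o' n q = of_int (sign q) * A" if q: "q \<in> Ps" for q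
  proof -
    have "A * Phi o' n q = c * (\<Sum>p\<in>Ps. of_int (sign p) * (Phi o' n p * Phi o' n q))"
      by (simp only: A mult.assoc sum_distrib_right)
    also have "\<dots> = c * (\<Sum>p\<in>Ps. of_int (sign q) * (of_int (sign (p \<circ> q)) * Phi o' n (p \<circ> q)))"
    proof (rule arg_cong[of _ _ "(*) c"], rule sum.cong[OF refl])
      fix p assume p: "p \<in> Ps"
      have "sign p = sign q * sign (p \<circ> q)"
        using perm[OF p] perm[OF q] by (simp add: sign_compose mult.left_commute)
      then have "(of_int (sign p) :: ('a, 'a falg) op) = of_int (sign q) * of_int (sign (p \<circ> q))"
        by (simp only: of_int_mult)
      then show "of_int (sign p) * (Phi o' n p * (Phi o' n q :: ('a, 'a falg) op))
          = of_int (sign q) * (of_int (sign (p \<circ> q)) * Phi o' n (p \<circ> q))"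
        using p q by (simp add: Phi_comp Ps_def mult.assoc)
    qed
    also have "\<dots> = c * (of_int (sign q) * (\<Sum>p\<in>Ps. of_int (sign p) * Phi o' n p))"
    proof -
      have "q permutes {..<n}" using q by (simp add: Ps_def)
      from sum_permutations_compose_right[OF this, of "\<lambda>p. of_int (sign p) * (Phi o' n p :: ('a, 'a falg) op)"]
      show ?thesis unfolding Ps_def sum_distrib_left[symmetric] by (rule arg_cong[OF sym])
    qed
    also have "\<dots> = of_int (sign q) * A"
      unfolding A by (simp only: mult.assoc[symmetric] c[of "of_int (sign q)"])
    finally show ?thesis .
  qed
  have "A * A = A"
  proof -
    have "A * A = c * (\<Sum>q\<in>Ps. of_int (sign q) * (A * Phi o' n q))"
    proof -
      have "A * (c * Z) = c * (A * Z)" for Z using c[of A] by (simp only: mult.assoc[symmetric])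
      moreover have "A * (of_int k * Z) = of_int k * (A * Z)" for k Z
        using of_int_c[of k A] by (simp only: mult.assoc[symmetric])
      ultimately show ?thesis
        by (subst (2) A) (simp only: sum_distrib_left)
    qed
    also have "\<dots> = c * (\<Sum>q\<in>Ps. A)"
    proof (rule arg_cong[of _ _ "(*) c"], rule sum.cong[OF refl])
      fix q assume "q \<in> Ps"
      then have "of_int (sign q) * (A * Phi o' n q) = of_int (sign q * sign q) * A"
        by (simp only: absorb of_int_mult mult.assoc)
      then show "of_int (sign q) * (A * Phi o' n q) = A" by simp
    qed
    also have "\<dots> = c * of_nat (fact n) * A"
      by (simp add: Ps_def card_permutations mult.assoc)
    finally show ?thesis by (simp add: c_fact)
  qed
  moreover have "A \<in> Qalg (qexp 1) (qexp (-1)) o' n"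
  proof -
    have ofint: "(of_int (sign p) :: ('a, 'a falg) op) = scalar (of_int (sign p))" for p :: "nat \<Rightarrow> nat"
      by (cases "evenperm p"; simp add: sign_def scalar_minus)
    have "(\<Sum>p\<in>S. of_int (sign p) * (Phi o' n p :: ('a, 'a falg) op)) \<in> Qalg (qexp 1) (qexp (-1)) o' n" if "S \<subseteq> Ps" for S
      using finite_subset[OF that finP] that
    proof (induction S)
      case empty
      have "scalar 0 \<in> Qalg (qexp 1) (qexp (-1)) o' n" by (rule Qalg.scalar) simp
      then show ?case by simp
    next
      case (insert p S)
      have "of_int (sign p) * (Phi o' n p :: ('a, 'a falg) op) \<in> Qalg (qexp 1) (qexp (-1)) o' n"
        unfolding ofint
        by (intro Qalg.mult Qalg.scalar Phi_Qalg) (use insert.prems in \<open>auto simp: Ps_def intro: mult_of_int_commute\<close>)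
      then show ?case using insert by (simp add: Qalg.add)
    qed
    moreover have "c \<in> Qalg (qexp 1) (qexp (-1)) o' n"
      unfolding c_def by (intro Qalg.scalar scalF_central)
    ultimately show ?thesis unfolding A by (intro Qalg.mult) auto
  qed
  moreover have "A * qexp.Q (o' + i) (Suc (o' + i)) = - A" if i: "Suc i < n" for i
  proof -
    have "transpose i (Suc i) \<in> Ps" using transpose_adj_permutes[OF i] by (simp add: Ps_def)
    from absorb[OF this] show ?thesis by (simp add: Phi_transpose[OF i] sign_swap_id)
  qed
  moreover have "\<exists>Y. 1 - A = (\<Sum>i | Suc i < n. (1 + qexp.Q (o' + i) (Suc (o' + i))) * Y i)"
  proof -
    have "\<forall>p\<in>Ps. \<exists>Y. of_int (sign p) - (Phi o' n p :: ('a, 'a falg) op)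
        = (\<Sum>i | Suc i < n. (1 + qexp.Q (o' + i) (Suc (o' + i))) * Y i)"
      unfolding Ps_def by (intro ballI Phi_minus_sign) simp
    from bchoice[OF this] obtain Y where "\<forall>p\<in>Ps. of_int (sign p) - (Phi o' n p :: ('a, 'a falg) op)
        = (\<Sum>i | Suc i < n. (1 + qexp.Q (o' + i) (Suc (o' + i))) * Y p i)" ..
    note Y = this[rule_format]
    have "1 - A = c * (\<Sum>p\<in>Ps. of_int (sign p) * (of_int (sign p) - Phi o' n p))"
    proof -
      have one: "of_int (sign p) * of_int (sign p) = (1 :: ('a, 'a falg) op)" for p :: "nat \<Rightarrow> nat"
        by (simp flip: of_int_mult)
      have "1 - A = c * of_nat (fact n) - A" by (simp add: c_fact)
      also have "of_nat (fact n) = (\<Sum>p\<in>Ps. (1 :: ('a, 'a falg) op))"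
        by (simp add: Ps_def card_permutations)
      also have "c * (\<Sum>p\<in>Ps. 1) - A = c * (\<Sum>p\<in>Ps. 1 - of_int (sign p) * Phi o' n p)"
        by (simp only: A right_diff_distrib sum_subtractf)
      finally show ?thesis by (simp only: right_diff_distrib one)
    qed
    also have "\<dots> = c * (\<Sum>p\<in>Ps. \<Sum>i | Suc i < n. (1 + qexp.Q (o' + i) (Suc (o' + i))) * (of_int (sign p) * Y p i))"
    proof (rule arg_cong[of _ _ "(*) c"], rule sum.cong[OF refl])
      fix p assume "p \<in> Ps"
      have mv: "of_int k * (Z * W) = Z * (of_int k * W)" for k and Z W :: "('a, 'a falg) op"
        using of_int_c[of k Z] by (simp only: mult.assoc[symmetric])
      show "of_int (sign p) * (of_int (sign p) - (Phi o' n p :: ('a, 'a falg) op)) =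
          (\<Sum>i | Suc i < n. (1 + qexp.Q (o' + i) (Suc (o' + i))) * (of_int (sign p) * Y p i))"
        unfolding Y[OF \<open>p \<in> Ps\<close>] sum_distrib_left mv ..
    qed
    also have "\<dots> = (\<Sum>i | Suc i < n. (1 + qexp.Q (o' + i) (Suc (o' + i))) * (c * (\<Sum>p\<in>Ps. of_int (sign p) * Y p i)))"
    proof -
      have mv: "c * (Z * W) = Z * (c * W)" for Z W
        using c[of Z] by (simp only: mult.assoc[symmetric])
      show ?thesis
        by (subst sum.swap) (simp only: sum_distrib_left mv)
    qed
    finally show ?thesis by (rule exI[of _ "\<lambda>i. c * (\<Sum>p\<in>Ps. of_int (sign p) * Y p i)"])
  qed
  ultimately show ?thesis
    unfolding qexp.is_antisym_def A_def by blast
qed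

section \<open>Reduction of the completed algebra modulo \<open>I\<^sub>p\<close>\<close>

text \<open>The image of an element of the free algebra in \<open>Y/I\<^sub>p\<close>. It is enough to compare the two sides
  of the final theorem there, for every \<open>p\<close>.\<close>

definition red :: "nat \<Rightarrow> 'n::{finite,linorder} falg \<Rightarrow> 'n falg set set"
  where "red p x = toYt x p"

lemma red_hom: "red p \<in> ring_hom free_alg (Yq p :: 'n::{finite,linorder} falg set set ring)"
proof -
  have eq: "red p = ((+>\<^bsub>Yalg\<^esub>) (Iid p) \<circ> toY :: 'n falg \<Rightarrow> _)" by (auto simp: red_def toYt_def)
  show ?thesis unfolding eq by (rule ring_hom_trans[OF toY_hom coset_hom])
qed

lemma red_simps:
  fixes x y :: "'n::{finite,linorder} falg"
  shows red_closed: "red p x \<in> carrier (Yq p)"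
    and red_add: "red p (x + y) = red p x \<oplus>\<^bsub>Yq p\<^esub> red p y"
    and red_mult: "red p (x * y) = red p x \<otimes>\<^bsub>Yq p\<^esub> red p y"
    and red_0: "red p (0 :: 'n falg) = \<zero>\<^bsub>Yq p\<^esub>"
    and red_1: "red p (1 :: 'n falg) = \<one>\<^bsub>Yq p\<^esub>"
proof -
  have c: "x \<in> carrier free_alg" for x :: "'n falg" by (simp add: free_alg_def)
  show "red p x \<in> carrier (Yq p)" using ring_hom_closed[OF red_hom c] .
  show "red p (x + y) = red p x \<oplus>\<^bsub>Yq p\<^esub> red p y"
    using ring_hom_add[OF red_hom c c, of p x y] by (simp add: free_alg_def)
  show "red p (x * y) = red p x \<otimes>\<^bsub>Yq p\<^esub> red p y"
    using ring_hom_mult[OF red_hom c c, of p x y] by (simp add: free_alg_def)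
  show "red p (0 :: 'n falg) = \<zero>\<^bsub>Yq p\<^esub>"
    using ring_hom_zero[OF red_hom ring_free_alg ring_Yq, of p] by (simp add: free_alg_def)
  show "red p (1 :: 'n falg) = \<one>\<^bsub>Yq p\<^esub>"
    using ring_hom_one[OF red_hom, of p] by (simp add: free_alg_def)
qed

lemma red_sum:
  fixes F :: "'i \<Rightarrow> 'n::{finite,linorder} falg"
  assumes "finite S"
  shows "red p (\<Sum>i\<in>S. F i) = finsum (Yq p) (\<lambda>i. red p (F i)) S"
  using assms
proof (induction S)
  case empty
  interpret Q: ring "Yq p :: 'n falg set set ring" by (rule ring_Yq)
  show ?case by (simp add: red_0)
next
  case (insert i S)
  interpret Q: ring "Yq p :: 'n falg set set ring" by (rule ring_Yq)
  show ?case using insert by (simp add: red_add red_closed Q.finsum_insert)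
qed

definition redI :: "nat \<Rightarrow> 'n::{finite,linorder} falg set"
  where "redI p = {x. red p x = \<zero>\<^bsub>Yq p\<^esub>}"

interpretation redI: two_sided "redI p :: 'n::{finite,linorder} falg set"
proof
  interpret Q: ring "Yq p :: 'n falg set set ring" by (rule ring_Yq)
  fix a b c :: "'n falg"
  assume "a \<in> redI p"
  then show "c * a \<in> redI p" "a * c \<in> redI p"
    by (simp_all add: redI_def red_mult red_closed)
  assume "b \<in> redI p"
  with \<open>a \<in> redI p\<close> show "a + b \<in> redI p" by (simp add: redI_def red_add)
qed (simp add: redI_def red_0)

lemma red_eqI:
  assumes "x - y \<in> (redI p :: 'n::{finite,linorder} falg set)"
  shows "red p x = red p y"
proof -
  interpret Q: ring "Yq p :: 'n falg set set ring" by (rule ring_Yq)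
  have "red p x = red p (x - y) \<oplus>\<^bsub>Yq p\<^esub> red p y" using red_add[of p "x - y" y] by simp
  then show ?thesis using assms red_closed[of p y] by (simp add: redI_def)
qed

lemma redI_half: "x + x \<in> redI p \<Longrightarrow> x \<in> redI p"
proof -
  assume "x + x \<in> redI p"
  then have "scalF (fps_const (1/2)) * (x + x) \<in> redI p" by (rule redI.l_mem)
  also have "scalF (fps_const (1/2)) * (x + x) = (scalF (fps_const (1/2)) + scalF (fps_const (1/2))) * x"
    by (simp only: distrib_left distrib_right)
  also have "scalF (fps_const (1/2)) + scalF (fps_const (1/2)) = scalF (1 :: complex fps)"
    unfolding scalF_simps(3)[symmetric] by simp
  finally show ?thesis by (simp add: scalF_simps)
qed

lemma tauF_mem_redI:
  assumes "a > int p"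
  shows "tauF i j (- a) \<in> redI p"
proof -
  interpret Y: ring "Yalg :: 'a falg set ring" by (rule ring_Yalg)
  interpret Ip: ideal "Iid p" "Yalg :: 'a falg set ring" by (rule ideal_Iid)
  have "{toY (scalF (fps_X ^ (p + 1)))} \<union> {toY (tauF i j (- r)) | i j r. r > int p} \<subseteq> (Iid p :: 'a falg set set)"
    unfolding Iid_def by (rule Y.genideal_self) auto
  then have "toY (tauF i j (- a)) \<in> Iid p" using assms by blast
  then show ?thesis by (simp add: redI_def red_def toYt_def Yq_def FactRing_def Ip.a_rcos_const)
qed

lemma rtt_rel_mem_redI: "rtt_rel a b r c \<in> (redI p :: 'n::{finite,linorder} falg set)"
proof -
  interpret F: ring "free_alg :: 'n falg ring" by (rule ring_free_alg)
  interpret R: ideal "rtt_ideal" "free_alg :: 'n falg ring" by (rule ideal_rtt)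
  have "rtt_rel a b r c \<in> (rtt_ideal :: 'n falg set)"
    unfolding rtt_ideal_def
    by (rule subsetD[OF F.genideal_self]) (simp add: free_alg_def, blast)
  then have "toY (rtt_rel a b r c) = toY (0 :: 'n falg)"
    unfolding toY_def using R.a_rcos_const[of "rtt_rel a b r c"] R.a_rcos_const[OF R.zero_closed]
    by (simp add: free_alg_def)
  then have "red p (rtt_rel a b r c) = red p (0 :: 'n falg)" by (simp add: red_def toYt_def)
  then show ?thesis by (simp add: redI_def red_0)
qed

subsection \<open>The defining relation, entry by entry\<close>

lemma sum_matrix_units:
  fixes r c :: "'n::{finite,linorder} \<times> 'n"
  shows "(\<Sum>i\<in>UNIV. tens (munit i i) (munit i i) r c) = (if fst r = snd r \<and> c = r then 1 else (0 :: 'a::comm_ring_1))"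
    and "(\<Sum>(i, j) | P i j. tens (munit i i) (munit j j) r c) = (if P (fst r) (snd r) \<and> c = r then 1 else (0 :: 'a))"
    and "(\<Sum>(i, j) | P i j. tens (munit i j) (munit j i) r c) = (if P (fst r) (snd r) \<and> c = prod.swap r then 1 else (0 :: 'a))"
proof -
  have "(\<Sum>i\<in>UNIV. tens (munit i i) (munit i i) r c) =
      (\<Sum>i\<in>UNIV. if i = fst r then (if fst r = snd r \<and> c = r then 1 else (0 :: 'a)) else 0)"
    by (intro sum.cong) (auto simp: tens_def munit_def prod_eq_iff)
  then show "(\<Sum>i\<in>UNIV. tens (munit i i) (munit i i) r c) = (if fst r = snd r \<and> c = r then 1 else (0 :: 'a))"
    by simp
  have "(\<Sum>(i, j) | P i j. tens (munit i i) (munit j j) r c) =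
      (\<Sum>x\<in>{(i, j). P i j}. if x = r then (if c = r then 1 else (0 :: 'a)) else 0)"
    by (intro sum.cong) (auto simp: tens_def munit_def prod_eq_iff)
  then show "(\<Sum>(i, j) | P i j. tens (munit i i) (munit j j) r c) = (if P (fst r) (snd r) \<and> c = r then 1 else (0 :: 'a))"
    by (cases r) auto
  have "(\<Sum>(i, j) | P i j. tens (munit i j) (munit j i) r c) =
      (\<Sum>x\<in>{(i, j). P i j}. if x = r then (if c = prod.swap r then 1 else (0 :: 'a)) else 0)"
    by (intro sum.cong) (auto simp: tens_def munit_def prod_eq_iff)
  then show "(\<Sum>(i, j) | P i j. tens (munit i j) (munit j i) r c) = (if P (fst r) (snd r) \<and> c = prod.swap r then 1 else (0 :: 'a))"
    by (cases r) auto
qed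

text \<open>The entries of \<open>1 - P\<^sup>h + d P\<close> over the ground ring.\<close>

definition Rcoeff :: "complex fps \<Rightarrow> 'n::linorder \<times> 'n \<Rightarrow> 'n \<times> 'n \<Rightarrow> complex fps"
  where "Rcoeff d r c = (if c = r then 1 else 0)
    + (if c = prod.swap r then d - qcoeff (fps_exp (1/2)) (fps_exp (-1/2)) (fst r) (snd r) else 0)"

text \<open>The decomposition \<open>\<R>(x, 1) = x (1 - P\<^sup>h + e\<^bsup>-h/2\<^esup> P) - (1 - P\<^sup>h + e\<^bsup>h/2\<^esup> P)\<close>.\<close>

lemma Rhat_eq: "Rhat r c = smult (fps_exp (-1/2)) [:- Rcoeff (fps_exp (1/2)) r c, Rcoeff (fps_exp (-1/2)) r c:]"
proof -
  obtain i j where r: "r = (i, j)" by force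
  have "Rmat [:0, 1:] 1 r c = [:- Rcoeff (fps_exp (1/2)) r c, Rcoeff (fps_exp (-1/2)) r c:]"
    unfolding Rmat_def sum_matrix_units Rcoeff_def r
    by (cases i j rule: trichotomy) (auto simp: qcoeff_def one_pCons)
  then show ?thesis by (simp add: Rhat_def)
qed

text \<open>The degree of an entry of \<open>Rhat\<close> may be smaller than \<open>1\<close>; missing coefficients contribute \<open>0\<close>.\<close>

lemma sum_coeff_Rhat:
  fixes F :: "nat \<Rightarrow> complex fps \<Rightarrow> 'b::comm_monoid_add"
  assumes "\<And>s. F s 0 = 0"
  shows "(\<Sum>s\<le>degree (Rhat r c). F s (coeff (Rhat r c) s)) =
    F 0 (- (fps_exp (-1/2) * Rcoeff (fps_exp (1/2)) r c)) + F 1 (fps_exp (-1/2) * Rcoeff (fps_exp (-1/2)) r c)"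
proof -
  have "degree (Rhat r c) \<le> 1" unfolding Rhat_eq
    by (rule order_trans[OF degree_smult_le]) (simp add: degree_pCons_le)
  then have "(\<Sum>s\<le>degree (Rhat r c). F s (coeff (Rhat r c) s)) = (\<Sum>s\<le>1. F s (coeff (Rhat r c) s))"
    by (intro sum.mono_neutral_left) (auto simp: coeff_eq_0 assms)
  also have "\<dots> = F 0 (coeff (Rhat r c) 0) + F 1 (coeff (Rhat r c) 1)" by simp
  finally show ?thesis by (simp add: Rhat_eq)
qed

lemma scalF_diff: "scalF (c - d) = scalF c - scalF d"
  using scalF_simps(3)[of c "- d"] unfolding scalF_simps(5) by (simp only: diff_conv_add_uminus)

lemma qexp_1: "qexp 1 = scalF (fps_exp (1/2))" and qexp_m1: "qexp (-1) = scalF (fps_exp (-1/2))"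
  by (simp_all add: qexp_def)

lemma scalF_qcoeff: "scalF (qcoeff (fps_exp (1/2)) (fps_exp (-1/2)) i j) = qcoeff (qexp 1) (qexp (-1)) i j"
  by (simp add: qcoeff_def qexp_1 qexp_m1 scalF_simps)

text \<open>Stated for arbitrary conditions \<open>P\<close> and \<open>P'\<close>: at a diagonal pair \<open>r = prod.swap r\<close> both hold.\<close>

lemma scalF_if_times:
  "scalF (e * ((if P then 1 else 0) + (if P' then x else 0))) * g
    = scalF e * ((if P then g else 0) + (if P' then scalF x * g else 0))"
  by (cases P; cases P') (simp_all add: scalF_simps mult.assoc distrib_left distrib_right)

lemma times_scalF_if:
  "g * scalF (e * ((if P then 1 else 0) + (if P' then x else 0)))
    = scalF e * ((if P then g else 0) + (if P' then g * scalF x else 0))"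
proof -
  have "g * (scalF e * y) = scalF e * (g * y)" for y
    using scalF_central[of e g] by (simp only: mult.assoc[symmetric])
  with scalF_central[of e g] show ?thesis by (cases P; cases P') (simp_all add: scalF_simps distrib_left)
qed

lemma sum_Rcoeff_left:
  fixes G :: "'n::{finite,linorder} \<times> 'n \<Rightarrow> 'n falg"
  shows "(\<Sum>k\<in>UNIV. scalF (e * Rcoeff d r k) * G k)
    = scalF e * (G r + (scalF d - qcoeff (qexp 1) (qexp (-1)) (fst r) (snd r)) * G (prod.swap r))"
proof -
  have "(\<Sum>k\<in>UNIV. scalF (e * Rcoeff d r k) * G k) = scalF e * (\<Sum>k\<in>UNIV. (if k = r then G k else 0)
    + (if k = prod.swap r then (scalF d - qcoeff (qexp 1) (qexp (-1)) (fst r) (snd r)) * G k else 0))"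
    unfolding sum_distrib_left
    by (intro sum.cong refl) (simp only: Rcoeff_def scalF_if_times scalF_diff scalF_qcoeff)
  then show ?thesis by (simp add: sum.distrib)
qed

lemma sum_Rcoeff_right:
  fixes G :: "'n::{finite,linorder} \<times> 'n \<Rightarrow> 'n falg"
  shows "(\<Sum>k\<in>UNIV. G k * scalF (e * Rcoeff d k c))
    = scalF e * (G c + G (prod.swap c) * (scalF d - qcoeff (qexp 1) (qexp (-1)) (snd c) (fst c)))"
proof -
  have sw: "c = prod.swap k \<longleftrightarrow> k = prod.swap c" for k by (metis swap_swap)
  have "(\<Sum>k\<in>UNIV. G k * scalF (e * Rcoeff d k c)) = scalF e * (\<Sum>k\<in>UNIV. (if k = c then G k else 0)
    + (if k = prod.swap c then G k * (scalF d - qcoeff (qexp 1) (qexp (-1)) (snd c) (fst c)) else 0))"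
    unfolding sum_distrib_left
  proof (intro sum.cong refl)
    fix k
    have eq: "(c = k) = (k = c)" by blast
    have "(if k = prod.swap c then G k * (scalF d - qcoeff (qexp 1) (qexp (-1)) (fst k) (snd k)) else 0)
        = (if k = prod.swap c then G k * (scalF d - qcoeff (qexp 1) (qexp (-1)) (snd c) (fst c)) else 0)"
      by (rule if_cong) simp_all
    then show "G k * scalF (e * Rcoeff d k c) = scalF e * ((if k = c then G k else 0)
      + (if k = prod.swap c then G k * (scalF d - qcoeff (qexp 1) (qexp (-1)) (snd c) (fst c)) else 0))"
      by (simp only: Rcoeff_def sw eq times_scalF_if scalF_diff scalF_qcoeff)
  qed
  then show ?thesis by (simp add: sum.distrib)
qed

text \<open>The expression in the last assumption of the locale \<open>rtt\<close>.\<close>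

definition rtt_expr :: "(int \<Rightarrow> 'n::{finite,linorder} \<Rightarrow> 'n \<Rightarrow> 'n falg) \<Rightarrow> int \<Rightarrow> int \<Rightarrow> 'n \<Rightarrow> 'n \<Rightarrow> 'n \<Rightarrow> 'n \<Rightarrow> 'n falg"
  where "rtt_expr t a b i j k l =
    (t a i k * t (b+1) j l + (qexp (-1) - qcoeff (qexp 1) (qexp (-1)) i j) * (t a j k * t (b+1) i l))
       - (t (a+1) i k * t b j l + (qexp 1 - qcoeff (qexp 1) (qexp (-1)) i j) * (t (a+1) j k * t b i l))
       - ((t (b+1) j l * t a i k + t (b+1) j k * t a i l * (qexp (-1) - qcoeff (qexp 1) (qexp (-1)) l k))
         - (t b j l * t (a+1) i k + t b j k * t (a+1) i l * (qexp 1 - qcoeff (qexp 1) (qexp (-1)) l k)))"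

lemma rtt_rel_eq:
  "rtt_rel (a + 1) b (i, j) (k, l) = scalF (fps_exp (-1/2)) * rtt_expr (\<lambda>a i j. tauF i j (- a)) a b i j k l"
proof -
  define r c where "r = (i, j)" and "c = (k, l)"
  let ?e = "fps_exp (-1/2) :: complex fps"
  have L: "(\<Sum>k\<in>UNIV. \<Sum>s\<le>degree (Rhat r k). scalF (coeff (Rhat r k) s) * TT12 (a + 1 - int s) (b + int s) k c)
    = (\<Sum>k\<in>UNIV. scalF (?e * Rcoeff (fps_exp (-1/2)) r k) * TT12 a (b + 1) k c)
      - (\<Sum>k\<in>UNIV. scalF (?e * Rcoeff (fps_exp (1/2)) r k) * TT12 (a + 1) b k c)"
    by (subst sum_coeff_Rhat) (simp_all add: scalF_simps sum_subtractf[symmetric])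
  have R: "(\<Sum>k\<in>UNIV. \<Sum>s\<le>degree (Rhat k c). TT21 (a + 1 - int s) (b + int s) r k * scalF (coeff (Rhat k c) s))
    = (\<Sum>k\<in>UNIV. TT21 a (b + 1) r k * scalF (?e * Rcoeff (fps_exp (-1/2)) k c))
      - (\<Sum>k\<in>UNIV. TT21 (a + 1) b r k * scalF (?e * Rcoeff (fps_exp (1/2)) k c))"
    by (subst sum_coeff_Rhat) (simp_all add: scalF_simps sum_subtractf[symmetric])
  show ?thesis
    unfolding r_def[symmetric] c_def[symmetric] rtt_rel_def L R sum_Rcoeff_left sum_Rcoeff_right
      right_diff_distrib[symmetric]
    by (simp add: rtt_expr_def TT12_def TT21_def r_def c_def qexp_1 qexp_m1)
qed

text \<open>Dropping the generators that vanish in \<open>Y/I\<^sub>p\<close> makes \<open>\<T>(x)\<close> a Laurent series in \<open>x\<^sup>-\<^sup>1\<close> already over the free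
  algebra.\<close>

definition tau_trunc :: "nat \<Rightarrow> int \<Rightarrow> 'n::{finite,linorder} \<Rightarrow> 'n \<Rightarrow> 'n falg"
  where "tau_trunc p a i j = (if a \<le> int p then tauF i j (- a) else 0)"

lemma rtt_tau_trunc: "rtt qexp (redI p) (tau_trunc p :: int \<Rightarrow> 'n::{finite,linorder} \<Rightarrow> 'n \<Rightarrow> 'n falg) (int p)"
proof (intro rtt.intro rtt_axioms.intro qexp.char_q_axioms redI.two_sided_axioms)
  show "tau_trunc p a i j = 0" if "a > int p" for a and i j :: 'n
    using that by (simp add: tau_trunc_def)
  fix a b and i j k l :: 'n
  let ?T = "\<lambda>a (i :: 'n) j. tauF i j (- a)"
  have t: "redI.cng p (tau_trunc p a i j) (?T a i j)" for a i j
    using tauF_mem_redI[of p a i j] redI.minus_mem[of _ p] by (auto simp: redI.cng_def tau_trunc_def)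
  have "scalF (fps_exp (1/2)) * rtt_rel (a + 1) b (i, j) (k, l) \<in> redI p"
    by (intro redI.l_mem rtt_rel_mem_redI)
  also have "scalF (fps_exp (1/2)) * rtt_rel (a + 1) b (i, j) (k, l) = rtt_expr ?T a b i j k l"
    unfolding rtt_rel_eq mult.assoc[symmetric] scalF_simps(4)[symmetric]
    by (simp add: fps_exp_add_mult[symmetric] scalF_simps)
  finally have "rtt_expr ?T a b i j k l \<in> redI p" .
  moreover have "redI.cng p (rtt_expr (tau_trunc p) a b i j k l) (rtt_expr ?T a b i j k l)"
    unfolding rtt_expr_def by (intro redI.cng_diff redI.cng_add redI.cng_mult redI.cng_refl t)
  ultimately have "rtt_expr (tau_trunc p) a b i j k l \<in> redI p"
    using redI.add_mem[of "rtt_expr (tau_trunc p) a b i j k l - rtt_expr ?T a b i j k l" p "rtt_expr ?T a b i j k l"]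
    by (simp add: redI.cng_def)
  then show "(tau_trunc p a i k * tau_trunc p (b+1) j l + (qexp (-1) - qcoeff (qexp 1) (qexp (-1)) i j) * (tau_trunc p a j k * tau_trunc p (b+1) i l))
       - (tau_trunc p (a+1) i k * tau_trunc p b j l + (qexp 1 - qcoeff (qexp 1) (qexp (-1)) i j) * (tau_trunc p (a+1) j k * tau_trunc p b i l))
       - ((tau_trunc p (b+1) j l * tau_trunc p a i k + tau_trunc p (b+1) j k * tau_trunc p a i l * (qexp (-1) - qcoeff (qexp 1) (qexp (-1)) l k))
         - (tau_trunc p b j l * tau_trunc p (a+1) i k + tau_trunc p b j k * tau_trunc p (a+1) i l * (qexp 1 - qcoeff (qexp 1) (qexp (-1)) l k)))
      \<in> redI p"
    by (simp only: rtt_expr_def)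
qed

interpretation R: rtt qexp "redI p" "tau_trunc p :: int \<Rightarrow> 'n::{finite,linorder} \<Rightarrow> 'n \<Rightarrow> 'n falg" "int p" for p
  by (rule rtt_tau_trunc)

section \<open>Coefficients of the fused products\<close>

text \<open>The exponents of the nonzero contributions to the coefficient of \<open>z\<^sup>a\<close> in a product of \<open>n\<close> series whose exponents
  are at most \<open>B\<close>.\<close>

definition parts :: "int \<Rightarrow> nat \<Rightarrow> int \<Rightarrow> int list set"
  where "parts B n a = {as. length as = n \<and> sum_list as = a \<and> (\<forall>r\<in>set as. r \<le> B)}"

lemma parts_le: "as \<in> parts B n a \<Longrightarrow> a \<le> int n * B"
proof (induction as arbitrary: n a)
  case (Cons r as)
  then have "as \<in> parts B (n - 1) (a - r)" "r \<le> B" "n > 0" by (auto simp: parts_def)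
  with Cons.IH[of "n - 1" "a - r"] show ?case by (simp add: of_nat_diff algebra_simps)
qed (simp add: parts_def)

lemma parts_0: "parts B 0 a = (if a = 0 then {[]} else {})"
  by (auto simp: parts_def)

lemma parts_Suc: "parts B (Suc n) a = (\<lambda>(b, as). as @ [b]) ` (SIGMA b:{a - int n * B..B}. parts B n (a - b))"
proof
  show "parts B (Suc n) a \<subseteq> (\<lambda>(b, as). as @ [b]) ` (SIGMA b:{a - int n * B..B}. parts B n (a - b))"
  proof
    fix as assume as: "as \<in> parts B (Suc n) a"
    then have "as \<noteq> []" by (auto simp: parts_def)
    then obtain cs b where cs: "as = cs @ [b]" by (metis append_butlast_last_id)
    with as have mem: "cs \<in> parts B n (a - b)" "b \<le> B" by (auto simp: parts_def)
    then have "b \<ge> a - int n * B" using parts_le[of cs B n "a - b"] by simp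
    with mem cs show "as \<in> (\<lambda>(b, as). as @ [b]) ` (SIGMA b:{a - int n * B..B}. parts B n (a - b))"
      by (intro image_eqI[of _ _ "(b, cs)"]) auto
  qed
qed (auto simp: parts_def)

lemma finite_parts: "finite (parts B n a)"
  by (induction n arbitrary: a) (auto simp: parts_0 parts_Suc)

lemma cf_prod_list:
  fixes g :: "nat \<Rightarrow> 'r::ring_1 fls"
  assumes g: "\<And>k a. a > B \<Longrightarrow> cf (g k) a = 0"
  shows "cf (prod_list (map g [0..<n])) a = (\<Sum>as\<in>parts B n a. prod_list (map (\<lambda>k. cf (g k) (as ! k)) [0..<n]))"
proof (induction n arbitrary: a)
  case 0
  have "cf (1 :: 'r fls) a = (if a = 0 then 1 else 0)" by (simp add: cf_def)
  then show ?case by (simp add: parts_0)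
next
  case (Suc n)
  define P where "P = prod_list (map g [0..<n])"
  have P: "cf P c = 0" if "c > int n * B" for c
  proof -
    have "parts B n c = {}" using that parts_le[of _ B n c] by force
    then show ?thesis using Suc[of c] by (simp add: P_def)
  qed
  have inj: "inj_on (\<lambda>(b, as). as @ [b]) X" for X :: "(int \<times> int list) set"
    by (auto simp: inj_on_def)
  have "cf (prod_list (map g [0..<Suc n])) a = cf (P * g n) a" by (simp add: P_def)
  also have "\<dots> = (\<Sum>b\<in>{a - int n * B..B}. cf P (a - b) * cf (g n) b)"
    by (rule cf_times) (use P g in auto)
  also have "\<dots> = (\<Sum>b\<in>{a - int n * B..B}. \<Sum>as\<in>parts B n (a - b).
      prod_list (map (\<lambda>k. cf (g k) (as ! k)) [0..<n]) * cf (g n) b)"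
    by (simp add: P_def Suc sum_distrib_right)
  also have "\<dots> = (\<Sum>(b, as)\<in>(SIGMA b:{a - int n * B..B}. parts B n (a - b)).
      prod_list (map (\<lambda>k. cf (g k) (as ! k)) [0..<n]) * cf (g n) b)"
    by (rule sum.Sigma) (auto simp: finite_parts)
  also have "\<dots> = (\<Sum>(b, as)\<in>(SIGMA b:{a - int n * B..B}. parts B n (a - b)).
      prod_list (map (\<lambda>k. cf (g k) ((as @ [b]) ! k)) [0..<Suc n]))"
  proof (intro sum.cong refl, clarify)
    fix b as assume "as \<in> parts B n (a - b)"
    then have len: "length as = n" by (simp add: parts_def)
    have "map (\<lambda>k. cf (g k) ((as @ [b]) ! k)) [0..<n] = map (\<lambda>k. cf (g k) (as ! k)) [0..<n]"
      using len by (intro map_cong refl) (simp add: nth_append)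
    then have "prod_list (map (\<lambda>k. cf (g k) ((as @ [b]) ! k)) [0..<n]) = prod_list (map (\<lambda>k. cf (g k) (as ! k)) [0..<n])"
      by (simp only:)
    then show "prod_list (map (\<lambda>k. cf (g k) (as ! k)) [0..<n]) * cf (g n) b
        = prod_list (map (\<lambda>k. cf (g k) ((as @ [b]) ! k)) [0..<Suc n])"
      using len by (simp add: nth_append_length[of as b "[]", unfolded len])
  qed
  also have "\<dots> = (\<Sum>as\<in>parts B (Suc n) a. prod_list (map (\<lambda>k. cf (g k) (as ! k)) [0..<Suc n]))"
    unfolding parts_Suc by (subst sum.reindex[OF inj]) (simp add: case_prod_unfold)
  finally show ?case .
qed

text \<open>\<open>Lcopy\<close>, \<open>Lterm\<close> and \<open>Lprod\<close> lift the values in \<open>Y/I\<^sub>p\<close> of \<open>T_copy\<close>, \<open>T_term\<close> and \<open>T_prod\<close> to the free algebra.\<close>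

definition Lcopy :: "nat \<Rightarrow> nat \<Rightarrow> nat \<Rightarrow> int \<Rightarrow> 'n list \<Rightarrow> 'n list \<Rightarrow> 'n::{finite,linorder} falg"
  where "Lcopy p n k a = (\<lambda>I J.
    if I \<in> idx n \<and> J \<in> idx n \<and> (\<forall>l<n. l \<noteq> k \<longrightarrow> I ! l = J ! l)
    then scalF (fps_exp (- (of_nat k * of_int a))) * tau_trunc p a (I ! k) (J ! k) else 0)"

definition Lterm :: "nat \<Rightarrow> nat \<Rightarrow> int list \<Rightarrow> 'n list \<Rightarrow> 'n list \<Rightarrow> 'n::{finite,linorder} falg"
  where "Lterm p n as = foldr (\<lambda>k. lmul n (Lcopy p n k (as ! k))) [0..<n] (\<lambda>I J. if I \<in> idx n \<and> I = J then 1 else 0)"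

definition Lprod :: "nat \<Rightarrow> nat \<Rightarrow> int \<Rightarrow> 'n list \<Rightarrow> 'n list \<Rightarrow> 'n::{finite,linorder} falg"
  where "Lprod p n a = (\<lambda>I J. \<Sum>as\<in>parts (int p) n a. Lterm p n as I J)"

lemma emb_Lcopy:
  assumes "k < n"
  shows "emb o' n (Lcopy p n k a) = scalar (qexp (- 2 * int k * a)) * R.S p (o' + k) a"
proof -
  have q: "qexp (- 2 * int k * a) = scalF (fps_exp (- (of_nat k * of_int a)))"
    by (simp add: qexp_def)
  show ?thesis
    unfolding R.S_def site_emb[OF assms] emb_scalar[symmetric] q
    by (rule emb_cong) (auto simp: Lcopy_def)
qed

lemma emb_Lterm:
  "(emb o' n (Lterm p n as) :: ('n::{finite,linorder}, 'n falg) op) = prod_list (map (\<lambda>k. emb o' n (Lcopy p n k (as ! k))) [0..<n])"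
proof -
  have one: "emb o' n (\<lambda>I J. if I \<in> idx n \<and> I = J then 1 else 0) = (1 :: ('n, 'n falg) op)"
    unfolding emb_1[of o' n, symmetric] by (rule emb_cong) simp
  have "emb o' n (foldr (\<lambda>k. lmul n (Lcopy p n k (as ! k) :: _ \<Rightarrow> _ \<Rightarrow> 'n falg)) ks (\<lambda>I J. if I \<in> idx n \<and> I = J then 1 else 0))
     = prod_list (map (\<lambda>k. emb o' n (Lcopy p n k (as ! k))) ks)" for ks
    by (induction ks) (simp_all add: one emb_mult[symmetric])
  then show ?thesis by (simp add: Lterm_def)
qed

text \<open>The link between the two descriptions: coefficients of Laurent series of operators on one side, sums
  over lists of exponents on the other.\<close>

lemma cf_Tp: "cf (R.Tp p o' n) a = emb o' n (Lprod p n a)"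
proof -
  have "cf (R.Tp p o' n) a = (\<Sum>as\<in>parts (int p) n a.
      prod_list (map (\<lambda>k. cf (R.Tser p (o' + k) k) (as ! k)) [0..<n]))"
    unfolding R.Tp_def by (rule cf_prod_list) (simp add: R.cf_Tser R.S_bound)
  also have "\<dots> = (\<Sum>as\<in>parts (int p) n a. emb o' n (Lterm p n as))"
  proof (rule sum.cong[OF refl])
    fix as
    show "prod_list (map (\<lambda>k. cf (R.Tser p (o' + k) k) (as ! k)) [0..<n]) = emb o' n (Lterm p n as)"
      unfolding emb_Lterm by (rule arg_cong[of _ _ prod_list], rule map_cong[OF refl])
        (simp add: R.cf_Tser emb_Lcopy)
  qed
  finally show ?thesis by (simp add: Lprod_def[abs_def] emb_sum)
qed

lemma Ytilde_finsum_at: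
  fixes F :: "'i \<Rightarrow> 'n::{finite,linorder} ytilde"
  assumes "finite S" "\<And>i. i \<in> S \<Longrightarrow> F i \<in> carrier Ytilde"
  shows "finsum Ytilde F S p = finsum (Yq p) (\<lambda>i. F i p) S"
  using assms
proof (induction S)
  case empty
  interpret Q: ring "Yq p :: 'n falg set set ring" by (rule ring_Yq)
  interpret Y: ring "Ytilde :: 'n ytilde ring" by (rule ring_Ytilde)
  have "finsum Ytilde F {} = \<zero>\<^bsub>Ytilde\<^esub>" by simp
  then show ?case by (simp only:) (simp add: Ytilde_def)
next
  case (insert i S)
  interpret Q: ring "Yq p :: 'n falg set set ring" by (rule ring_Yq)
  interpret Y: ring "Ytilde :: 'n ytilde ring" by (rule ring_Ytilde)
  have "F j p \<in> carrier (Yq p)" if "j \<in> insert i S" for j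
    using insert.prems[OF that] by (simp add: Ytilde_def)
  then have "finsum (Yq p) (\<lambda>i. F i p) (insert i S) = F i p \<oplus>\<^bsub>Yq p\<^esub> finsum (Yq p) (\<lambda>i. F i p) S"
    using insert.hyps by (intro Q.finsum_insert) auto
  moreover have "finsum Ytilde F (insert i S) = F i \<oplus>\<^bsub>Ytilde\<^esub> finsum Ytilde F S"
    using insert by (intro Y.finsum_insert) auto
  ultimately show ?case using insert by (simp add: Ytilde_def)
qed

lemma T_copy_red: "T_copy n k a I J p = red p (Lcopy p n k a I J :: 'n::{finite,linorder} falg)"
proof -
  have t: "red p (tauF i j (- a)) = red p (tau_trunc p a i j)" for i j :: 'n
    using tauF_mem_redI[of p a i j] by (intro red_eqI) (auto simp: tau_trunc_def)
  have "(scal c \<otimes>\<^bsub>Ytilde\<^esub> tau i j (- a)) p = red p (scalF c * tau_trunc p a i j)" for c and i j :: 'n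
    by (simp add: red_mult t[symmetric] red_def[symmetric] Ytilde_def)
  moreover have "\<zero>\<^bsub>Ytilde\<^esub> p = red p (0 :: 'n falg)" by (simp add: red_0 Ytilde_def)
  ultimately show ?thesis unfolding T_copy_def Lcopy_def by auto
qed

lemma T_term_red: "T_term n as I J p = red p (Lterm p n as I J :: 'n::{finite,linorder} falg)"
proof -
  interpret Q: ring "Yq p :: 'n falg set set ring" by (rule ring_Yq)
  interpret Y: ring "Ytilde :: 'n ytilde ring" by (rule ring_Ytilde)
  have "foldr (\<lambda>k. mat_mult Ytilde n (T_copy n k (as ! k))) ks (mat_one Ytilde n) I J p
      = red p (foldr (\<lambda>k. lmul n (Lcopy p n k (as ! k))) ks (\<lambda>I J. if I \<in> idx n \<and> I = J then 1 else 0) I J :: 'n falg)" for ks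
  proof (induction ks arbitrary: I J)
    case Nil
    show ?case by (cases "I \<in> idx n \<and> I = J") (auto simp: mat_one_def red_0 red_1 Ytilde_def)
  next
    case (Cons k ks)
    define M where "M = foldr (\<lambda>k. mat_mult Ytilde n (T_copy n k (as ! k) :: _ \<Rightarrow> _ \<Rightarrow> 'n ytilde)) ks (mat_one Ytilde n)"
    define L where "L = foldr (\<lambda>k. lmul n (Lcopy p n k (as ! k) :: _ \<Rightarrow> _ \<Rightarrow> 'n falg)) ks (\<lambda>I J. if I \<in> idx n \<and> I = J then 1 else 0)"
    have M: "M I J \<in> carrier Ytilde" for I J unfolding M_def by (rule T_term_closed_aux)
    have entry: "M I J p = red p (L I J)" for I J unfolding M_def L_def by (rule Cons.IH)
    have "mat_mult Ytilde n (T_copy n k (as ! k)) M I J p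
        = finsum (Yq p) (\<lambda>K. (T_copy n k (as ! k) I K \<otimes>\<^bsub>Ytilde\<^esub> M K J) p) (idx n)"
      unfolding mat_mult_def by (rule Ytilde_finsum_at) (auto simp: T_copy_closed M)
    also have "\<dots> = finsum (Yq p) (\<lambda>K. red p (Lcopy p n k (as ! k) I K * L K J)) (idx n)"
    proof -
      have "(T_copy n k (as ! k) I K \<otimes>\<^bsub>Ytilde\<^esub> M K J) p = red p (Lcopy p n k (as ! k) I K * L K J)" for K
        by (simp add: red_mult T_copy_red[symmetric] entry[symmetric] Ytilde_def)
      then show ?thesis by simp
    qed
    also have "\<dots> = red p (lmul n (Lcopy p n k (as ! k)) L I J)"
      unfolding lmul_def by (rule red_sum[symmetric]) simp
    finally show ?case by (simp add: M_def L_def)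
  qed
  then show ?thesis by (simp add: T_term_def Lterm_def)
qed

text \<open>The finitely many terms that are nonzero in \<open>Y/I\<^sub>p\<close> all have exponents at most \<open>p\<close>.\<close>

lemma T_prod_red: "T_prod n a I J p = red p (Lprod p n a I J :: 'n::{finite,linorder} falg)"
proof -
  interpret Q: ring "Yq p :: 'n falg set set ring" by (rule ring_Yq)
  let ?supp = "{as \<in> {as. length as = n \<and> sum_list as = a}. T_term n as I J p \<noteq> \<zero>\<^bsub>Yq p :: 'n falg set set ring\<^esub>}"
  have sub: "?supp \<subseteq> parts (int p) n a"
  proof
    fix as assume as: "as \<in> ?supp"
    have "r \<le> int p" if r: "r \<in> set as" for r
    proof (rule ccontr)
      assume "\<not> r \<le> int p"
      moreover have "length as = n" using as by simp
      then obtain k where "k < n" "as ! k = r" using r by (auto simp: in_set_conv_nth)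
      ultimately show False using T_term_zero[of k n p as I J] as by auto
    qed
    then show "as \<in> parts (int p) n a" using as by (simp add: parts_def)
  qed
  have "T_prod n a I J p = finsum (Yq p) (\<lambda>as. T_term n as I J p) ?supp"
    by (simp add: T_prod_def csum_def)
  also have "\<dots> = finsum (Yq p) (\<lambda>as. T_term n as I J p) (parts (int p) n a)"
    using sub by (intro Q.add.finprod_mono_neutral_cong_left finite_parts)
      (auto simp: parts_def T_term_red red_closed)
  also have "\<dots> = red p (Lprod p n a I J)"
    unfolding T_term_red Lprod_def by (rule red_sum[symmetric, OF finite_parts])
  finally show ?thesis .
qed

lemma Tn_red:
  "Tn n a p = red p (\<Sum>I\<in>idx n. lmul n (\<lambda>I J. scalF (Ah n I J)) (Lprod p n a) I I :: 'n::{finite,linorder} falg)"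
proof -
  interpret Q: ring "Yq p :: 'n falg set set ring" by (rule ring_Yq)
  interpret Y: ring "Ytilde :: 'n ytilde ring" by (rule ring_Ytilde)
  have T: "T_prod n a J I \<in> carrier (Ytilde :: 'n ytilde ring)" for I J
    unfolding T_prod_def by (rule csum_closed[OF T_term_closed T_prod_summable])
  have prod: "(scal (Ah n I J) \<otimes>\<^bsub>Ytilde\<^esub> T_prod n a J I) p = red p (scalF (Ah n I J) * Lprod p n a J I)" for I J :: "'n list"
    by (simp add: red_mult T_prod_red[symmetric] red_def[symmetric] Ytilde_def)
  have "Tn n a p = finsum (Yq p) (\<lambda>I. finsum Ytilde (\<lambda>J. scal (Ah n I J) \<otimes>\<^bsub>Ytilde\<^esub> T_prod n a J I) (idx n) p) (idx n :: 'n list set)"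
    unfolding Tn_def by (rule Ytilde_finsum_at) (use T in \<open>auto intro!: Y.finsum_closed\<close>)
  also have "\<dots> = finsum (Yq p) (\<lambda>I. red p (lmul n (\<lambda>I J. scalF (Ah n I J)) (Lprod p n a) I I)) (idx n :: 'n list set)"
  proof -
    have "finsum Ytilde (\<lambda>J. scal (Ah n I J) \<otimes>\<^bsub>Ytilde\<^esub> T_prod n a J I) (idx n) p
       = red p (lmul n (\<lambda>I J. scalF (Ah n I J)) (Lprod p n a) I I)" for I :: "'n list"
    proof -
      have "finsum Ytilde (\<lambda>J. scal (Ah n I J) \<otimes>\<^bsub>Ytilde\<^esub> T_prod n a J I) (idx n) p
        = finsum (Yq p) (\<lambda>J. (scal (Ah n I J) \<otimes>\<^bsub>Ytilde\<^esub> T_prod n a J I) p) (idx n)"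
        by (rule Ytilde_finsum_at) (use T in auto)
      also have "\<dots> = red p (\<Sum>J\<in>idx n. scalF (Ah n I J) * Lprod p n a J I)"
        unfolding prod by (rule red_sum[symmetric]) simp
      finally show ?thesis by (simp add: lmul_def)
    qed
    then show ?thesis by simp
  qed
  also have "\<dots> = red p (\<Sum>I\<in>idx n. lmul n (\<lambda>I J. scalF (Ah n I J)) (Lprod p n a) I I)"
    by (rule red_sum[symmetric]) simp
  finally show ?thesis .
qed

text \<open>Each antisymmetrizer has central entries and hence commutes with the fused product of the other group of sites. So
  both products under the trace over \<open>n + m\<close> sites are arranged into two factors on complementary windows.\<close>

lemma Tn_commute_red:
  "(Tn n a :: 'n::{finite,linorder} ytilde) p \<otimes>\<^bsub>Yq p\<^esub> Tn m b p = Tn m b p \<otimes>\<^bsub>Yq p\<^esub> Tn n a p"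
proof -
  define A1 where "A1 = (\<lambda>I J :: 'n list. scalF (Ah n I J) :: 'n falg)"
  define A2 where "A2 = (\<lambda>I J :: 'n list. scalF (Ah m I J) :: 'n falg)"
  define t1 where "t1 = (\<Sum>I\<in>idx n. lmul n A1 (Lprod p n a) I I)"
  define t2 where "t2 = (\<Sum>I\<in>idx m. lmul m A2 (Lprod p m b) I I)"
  define A where "A = emb 0 n A1"
  define A' where "A' = emb n m A2"
  define T where "T = emb 0 n (Lprod p n a :: _ \<Rightarrow> _ \<Rightarrow> 'n falg)"
  define V where "V = emb n m (Lprod p m b :: _ \<Rightarrow> _ \<Rightarrow> 'n falg)"
  have "Tr (n + m) (A * A' * (T * V)) - Tr (n + m) (A * A' * (V * T)) \<in> redI p"
    unfolding T_def V_def cf_Tp[symmetric]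
    by (rule R.traces_commute[OF redI_half])
      (use Ah_is_antisym[of 0 n] Ah_is_antisym[of n m] in \<open>simp_all add: A_def A'_def A1_def A2_def oemb_def\<close>)
  moreover have "A * A' * (T * V) = (A * T) * (A' * V)"
  proof -
    have "A' * T = T * A'" unfolding A'_def T_def
      by (rule emb_commute[symmetric]) (simp add: A2_def scalF_central)
    then show ?thesis by (simp add: mult.assoc) (simp add: mult.assoc[symmetric])
  qed
  moreover have "A * A' * (V * T) = (A' * V) * (A * T)"
  proof -
    have "A * (A' * V) = (A' * V) * A" unfolding A_def A'_def V_def emb_mult
      by (rule emb_commute) (simp add: A1_def scalF_central)
    then show ?thesis by (simp add: mult.assoc[symmetric])
  qed
  moreover have "Tr (n + m) ((A * T) * (A' * V)) = t1 * t2" "Tr (n + m) ((A' * V) * (A * T)) = t2 * t1"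
    unfolding A_def A'_def T_def V_def emb_mult Tr_emb_emb t1_def t2_def by simp_all
  ultimately have "t1 * t2 - t2 * t1 \<in> redI p" by simp
  then have "red p (t1 * t2) = red p (t2 * t1)" by (rule red_eqI)
  then show ?thesis unfolding red_mult Tn_red A1_def[symmetric] A2_def[symmetric] t1_def[symmetric] t2_def[symmetric] .
qed

theorem proposition8p2:
  fixes n m :: nat and a b :: int
  assumes "CARD('n::{finite,linorder}) \<ge> 2"
    and "n \<in> {1..CARD('n)}" and "m \<in> {1..CARD('n)}"
  shows "(Tn n a :: 'n ytilde) \<otimes>\<^bsub>Ytilde\<^esub> Tn m b = Tn m b \<otimes>\<^bsub>Ytilde\<^esub> Tn n a"
  using Tn_commute_red[where n = n and a = a and m = m and b = b and 'n = 'n] by (simp add: Ytilde_def fun_eq_iff)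

end
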